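(* Let $\Gamma$ be a perfect ring and let $M$ be a $\Gamma$-bimodule of strongly-finite right projective dimension. Then $M$ is right perfect and $M\otimes_\Gamma M=0$.
   Context: A perfect ring is one that is left and right perfect. Fix a basic set $\{e_i\}_i$ of primitive orthogonal idempotents of $\Gamma$ (each indecomposable projective right module is isomorphic to $e_i\Gamma$, and each indecomposable projective left module to $\Gamma e_i$, for exactly one $i$). For a $\Gamma$-bimodule $M$ let $\mathrm{supp}({}_\Gamma M)=\{e_i\mid e_iM\ne0\}$. If $\cdots\to P_1\to P_0\to M\to0$ is a minimal projective resolution of the right module $M_\Gamma$, let $\mathrm{supp}_j(M_\Gamma)$ be the set of $e_i$ such that $e_i\Gamma$ is isomorphic to a direct summand of $P_j$, and $\mathrm{supp}_\infty(M_\Gamma)=\bigcup_{j\ge0}\mathrm{supp}_j(M_\Gamma)$. The right projective dimension of $M$ is strongly-finite if $\mathrm{pd}\,M_\Gamma<\infty$ and $\mathrm{supp}({}_\Gamma M)\cap\mathrm{supp}_\infty(M_\Gamma)=\emptyset$. A $\Gamma$-bimodule $M$ is right perfect if $\mathrm{Tor}_i^\Gamma(M^{\otimes_\Gamma j},M)=0$ for all $i,j\ge1$ and $\mathrm{pd}\,M_\Gamma<\infty$. *)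

theory Defs
  imports "HOL-Algebra.Module" "HOL-Algebra.QuotRing" "HOL-Algebra.Free_Abelian_Groups"
begin

section \<open>Modules over a not necessarily commutative ring\<close>

text \<open>
  The library locale \<open>module\<close> requires a commutative ring, so only its record type is reused.
  A right \<open>R\<close>-module is a left module over the opposite ring: if \<open>U\<close> is a left module over
  \<open>opp R\<close>, then \<open>r \<odot>\<^bsub>U\<^esub> x\<close> stands for the product usually written \<open>x r\<close>.
\<close>

definition opp :: "('a, 'm) ring_scheme \<Rightarrow> ('a, 'm) ring_scheme" where
  "opp R = R\<lparr>mult := (\<lambda>x y. y \<otimes>\<^bsub>R\<^esub> x)\<rparr>"

lemma carrier_opp [simp]: "carrier (opp R) = carrier R"
  and zero_opp [simp]: "\<zero>\<^bsub>opp R\<^esub> = \<zero>\<^bsub>R\<^esub>"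
  and one_opp [simp]: "\<one>\<^bsub>opp R\<^esub> = \<one>\<^bsub>R\<^esub>"
  and add_opp [simp]: "x \<oplus>\<^bsub>opp R\<^esub> y = x \<oplus>\<^bsub>R\<^esub> y"
  and mult_opp [simp]: "x \<otimes>\<^bsub>opp R\<^esub> y = y \<otimes>\<^bsub>R\<^esub> x"
  by (simp_all add: opp_def)

locale left_module = R?: ring R + M?: abelian_group M
  for R :: "('a, 'r) ring_scheme" (structure) and M :: "('a, 'b, 'm) module_scheme" (structure) +
  assumes smult_closed [simp, intro]:
      "\<lbrakk>a \<in> carrier R; x \<in> carrier M\<rbrakk> \<Longrightarrow> a \<odot>\<^bsub>M\<^esub> x \<in> carrier M"
    and smult_l_distr:
      "\<lbrakk>a \<in> carrier R; b \<in> carrier R; x \<in> carrier M\<rbrakk> \<Longrightarrow>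
        (a \<oplus> b) \<odot>\<^bsub>M\<^esub> x = a \<odot>\<^bsub>M\<^esub> x \<oplus>\<^bsub>M\<^esub> b \<odot>\<^bsub>M\<^esub> x"
    and smult_r_distr:
      "\<lbrakk>a \<in> carrier R; x \<in> carrier M; y \<in> carrier M\<rbrakk> \<Longrightarrow>
        a \<odot>\<^bsub>M\<^esub> (x \<oplus>\<^bsub>M\<^esub> y) = a \<odot>\<^bsub>M\<^esub> x \<oplus>\<^bsub>M\<^esub> a \<odot>\<^bsub>M\<^esub> y"
    and smult_assoc1:
      "\<lbrakk>a \<in> carrier R; b \<in> carrier R; x \<in> carrier M\<rbrakk> \<Longrightarrow>
        (a \<otimes> b) \<odot>\<^bsub>M\<^esub> x = a \<odot>\<^bsub>M\<^esub> (b \<odot>\<^bsub>M\<^esub> x)"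
    and smult_one [simp]:
      "x \<in> carrier M \<Longrightarrow> \<one> \<odot>\<^bsub>M\<^esub> x = x"

text \<open>In a bimodule, \<open>smult\<close> is the left action and \<open>rsmult M x r\<close> is the product \<open>x r\<close>.\<close>

record ('a, 'b) bimodule = "('a, 'b) module" +
  rsmult :: "'b \<Rightarrow> 'a \<Rightarrow> 'b"

definition right_mod :: "('a, 'b, 'm) bimodule_scheme \<Rightarrow> ('a, 'b) module" where
  "right_mod M = \<lparr>carrier = carrier M, mult = mult M, one = one M, ring.zero = ring.zero M,
     ring.add = ring.add M,
     smult = (\<lambda>r x. rsmult M x r)\<rparr>"

definition is_bimodule :: "('a, 'r) ring_scheme \<Rightarrow> ('a, 'b, 'm) bimodule_scheme \<Rightarrow> bool" where
  "is_bimodule R M \<longleftrightarrow>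
     left_module R M \<and> left_module (opp R) (right_mod M) \<and>
     (\<forall>a\<in>carrier R. \<forall>b\<in>carrier R. \<forall>x\<in>carrier M.
        rsmult M (a \<odot>\<^bsub>M\<^esub> x) b = a \<odot>\<^bsub>M\<^esub> rsmult M x b)"

definition mod_hom ::
  "('a, 'r) ring_scheme \<Rightarrow> ('a, 'b, 'm) module_scheme \<Rightarrow> ('a, 'c, 'n) module_scheme \<Rightarrow> ('b \<Rightarrow> 'c) set"
  where
  "mod_hom S U V = {f \<in> carrier U \<rightarrow> carrier V.
     (\<forall>x\<in>carrier U. \<forall>y\<in>carrier U. f (x \<oplus>\<^bsub>U\<^esub> y) = f x \<oplus>\<^bsub>V\<^esub> f y) \<and>
     (\<forall>a\<in>carrier S. \<forall>x\<in>carrier U. f (a \<odot>\<^bsub>U\<^esub> x) = a \<odot>\<^bsub>V\<^esub> f x)}"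

definition mod_isomorphic ::
  "('a, 'r) ring_scheme \<Rightarrow> ('a, 'b, 'm) module_scheme \<Rightarrow> ('a, 'c, 'n) module_scheme \<Rightarrow> bool" where
  "mod_isomorphic S U V \<longleftrightarrow> (\<exists>f\<in>mod_hom S U V. bij_betw f (carrier U) (carrier V))"

definition direct_decomp ::
  "('a, 'r) ring_scheme \<Rightarrow> ('a, 'b, 'm) module_scheme \<Rightarrow> 'b set \<Rightarrow> 'b set \<Rightarrow> bool" where
  "direct_decomp S U A B \<longleftrightarrow>
     submodule A S U \<and> submodule B S U \<and> A \<inter> B = {\<zero>\<^bsub>U\<^esub>} \<and> A <+>\<^bsub>U\<^esub> B = carrier U"

definition iso_to_summand ::
  "('a, 'r) ring_scheme \<Rightarrow> ('a, 'b, 'm) module_scheme \<Rightarrow> ('a, 'c, 'n) module_scheme \<Rightarrow> bool" where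
  "iso_to_summand S U V \<longleftrightarrow>
     (\<exists>A B. direct_decomp S V A B \<and> mod_isomorphic S U (V\<lparr>carrier := A\<rparr>))"

definition indecomposable ::
  "('a, 'r) ring_scheme \<Rightarrow> ('a, 'b, 'm) module_scheme \<Rightarrow> bool" where
  "indecomposable S U \<longleftrightarrow>
     carrier U \<noteq> {\<zero>\<^bsub>U\<^esub>} \<and>
     (\<forall>A B. direct_decomp S U A B \<longrightarrow> A = {\<zero>\<^bsub>U\<^esub>} \<or> B = {\<zero>\<^bsub>U\<^esub>})"

definition semisimple ::
  "('a, 'r) ring_scheme \<Rightarrow> ('a, 'b, 'm) module_scheme \<Rightarrow> bool" where
  "semisimple S U \<longleftrightarrow> (\<forall>A. submodule A S U \<longrightarrow> (\<exists>B. direct_decomp S U A B))"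

definition superfluous ::
  "('a, 'r) ring_scheme \<Rightarrow> ('a, 'b, 'm) module_scheme \<Rightarrow> 'b set \<Rightarrow> bool" where
  "superfluous S U K \<longleftrightarrow>
     (\<forall>L. submodule L S U \<and> K <+>\<^bsub>U\<^esub> L = carrier U \<longrightarrow> L = carrier U)"

definition free_module :: "('a, 'r) ring_scheme \<Rightarrow> 'i set \<Rightarrow> ('a, 'i \<Rightarrow> 'a) module" where
  "free_module S I =
     \<lparr>carrier = {f. (\<forall>i\<in>I. f i \<in> carrier S) \<and> (\<forall>i. i \<notin> I \<longrightarrow> f i = \<zero>\<^bsub>S\<^esub>) \<and>
                    finite {i. f i \<noteq> \<zero>\<^bsub>S\<^esub>}},
      mult = undefined, one = undefined,
      ring.zero = (\<lambda>i. \<zero>\<^bsub>S\<^esub>), ring.add = (\<lambda>f g i. f i \<oplus>\<^bsub>S\<^esub> g i),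
      smult = (\<lambda>a f i. a \<otimes>\<^bsub>S\<^esub> f i)\<rparr>"

text \<open>
  The index sets may be restricted to the type of \<open>P\<close>, since a projective module \<open>P\<close> is a
  direct summand of the free module on its own carrier.
\<close>

definition projective :: "('a, 'r) ring_scheme \<Rightarrow> ('a, 'b, 'm) module_scheme \<Rightarrow> bool" where
  "projective S P \<longleftrightarrow>
     left_module S P \<and> (\<exists>I :: 'b set. iso_to_summand S P (free_module S I))"

definition regular_module :: "('a, 'r) ring_scheme \<Rightarrow> ('a, 'a) module" where
  "regular_module S = \<lparr>carrier = carrier S, mult = mult S, one = one S, ring.zero = ring.zero S,
     ring.add = ring.add S,
     smult = mult S\<rparr>"

text \<open>The left \<open>S\<close>-module \<open>S e\<close>; for \<open>S = opp R\<close> this is the right \<open>R\<close>-module \<open>e R\<close>.\<close>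

definition principal_module :: "('a, 'r) ring_scheme \<Rightarrow> 'a \<Rightarrow> ('a, 'a) module" where
  "principal_module S e = (regular_module S)\<lparr>carrier := (\<lambda>x. x \<otimes>\<^bsub>S\<^esub> e) ` carrier S\<rparr>"


section \<open>Perfect rings and basic sets of idempotents\<close>

definition maximal_left_ideal :: "('a, 'r) ring_scheme \<Rightarrow> 'a set \<Rightarrow> bool" where
  "maximal_left_ideal R I \<longleftrightarrow>
     submodule I R (regular_module R) \<and> I \<noteq> carrier R \<and>
     (\<forall>L. submodule L R (regular_module R) \<and> I \<subseteq> L \<longrightarrow> L = I \<or> L = carrier R)"

definition jacobson_radical :: "('a, 'r) ring_scheme \<Rightarrow> 'a set" where
  "jacobson_radical R = carrier R \<inter> \<Inter>{I. maximal_left_ideal R I}"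

primrec initial_prod :: "('a, 'r) ring_scheme \<Rightarrow> (nat \<Rightarrow> 'a) \<Rightarrow> nat \<Rightarrow> 'a" where
  "initial_prod R a 0 = \<one>\<^bsub>R\<^esub>"
| "initial_prod R a (Suc n) = initial_prod R a n \<otimes>\<^bsub>R\<^esub> a n"

definition left_T_nilpotent :: "('a, 'r) ring_scheme \<Rightarrow> 'a set \<Rightarrow> bool" where
  "left_T_nilpotent R A \<longleftrightarrow>
     (\<forall>a. (\<forall>n. a n \<in> A) \<longrightarrow> (\<exists>n. initial_prod R a n = \<zero>\<^bsub>R\<^esub>))"

text \<open>
  This is the definition of left perfect rings in Lam, \<^emph>\<open>A First Course in Noncommutative Rings\<close>,
  Definition 23.17: \<open>R\<close> modulo its radical is semisimple and the radical is left T-nilpotent.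
\<close>

definition left_perfect :: "('a, 'r) ring_scheme \<Rightarrow> bool" where
  "left_perfect R \<longleftrightarrow>
     ring R \<and>
     semisimple (R Quot jacobson_radical R) (regular_module (R Quot jacobson_radical R)) \<and>
     left_T_nilpotent R (jacobson_radical R)"

definition perfect_ring :: "('a, 'r) ring_scheme \<Rightarrow> bool" where
  "perfect_ring R \<longleftrightarrow> left_perfect R \<and> left_perfect (opp R)"

definition is_idempotent :: "('a, 'r) ring_scheme \<Rightarrow> 'a \<Rightarrow> bool" where
  "is_idempotent R e \<longleftrightarrow> e \<in> carrier R \<and> e \<otimes>\<^bsub>R\<^esub> e = e"

definition orthogonal_idempotents :: "('a, 'r) ring_scheme \<Rightarrow> 'a \<Rightarrow> 'a \<Rightarrow> bool" where
  "orthogonal_idempotents R e f \<longleftrightarrow>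
     is_idempotent R e \<and> is_idempotent R f \<and> e \<otimes>\<^bsub>R\<^esub> f = \<zero>\<^bsub>R\<^esub> \<and> f \<otimes>\<^bsub>R\<^esub> e = \<zero>\<^bsub>R\<^esub>"

definition primitive_idempotent :: "('a, 'r) ring_scheme \<Rightarrow> 'a \<Rightarrow> bool" where
  "primitive_idempotent R e \<longleftrightarrow>
     is_idempotent R e \<and> e \<noteq> \<zero>\<^bsub>R\<^esub> \<and>
     (\<forall>f g. orthogonal_idempotents R f g \<and> e = f \<oplus>\<^bsub>R\<^esub> g \<longrightarrow> f = \<zero>\<^bsub>R\<^esub> \<or> g = \<zero>\<^bsub>R\<^esub>)"

text \<open>
  By Kaplansky's theorem an indecomposable projective module over any ring is countably
  generated, hence isomorphic to a summand of the free module on \<open>nat\<close>.  So the type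
  \<open>nat \<Rightarrow> 'a\<close> contains a copy of each indecomposable projective module.
\<close>

definition basic_set :: "('a, 'r) ring_scheme \<Rightarrow> 'a set \<Rightarrow> bool" where
  "basic_set R E \<longleftrightarrow>
     (\<forall>e\<in>E. primitive_idempotent R e) \<and>
     (\<forall>e\<in>E. \<forall>f\<in>E. e \<noteq> f \<longrightarrow> orthogonal_idempotents R e f) \<and>
     (\<forall>P :: ('a, nat \<Rightarrow> 'a) module. projective (opp R) P \<and> indecomposable (opp R) P \<longrightarrow>
        (\<exists>!e. e \<in> E \<and> mod_isomorphic (opp R) P (principal_module (opp R) e))) \<and>
     (\<forall>P :: ('a, nat \<Rightarrow> 'a) module. projective R P \<and> indecomposable R P \<longrightarrow>
        (\<exists>!e. e \<in> E \<and> mod_isomorphic R P (principal_module R e)))"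


section \<open>Projective resolutions\<close>

text \<open>The differential \<open>d n\<close> maps \<open>P (Suc n)\<close> to \<open>P n\<close>, and \<open>\<epsilon>\<close> is the augmentation.\<close>

definition projective_resolution ::
  "('a, 'r) ring_scheme \<Rightarrow> ('a, 'x, 'm) module_scheme \<Rightarrow> (nat \<Rightarrow> ('a, 'p) module) \<Rightarrow>
   (nat \<Rightarrow> 'p \<Rightarrow> 'p) \<Rightarrow> ('p \<Rightarrow> 'x) \<Rightarrow> bool" where
  "projective_resolution S U P d \<epsilon> \<longleftrightarrow>
     (\<forall>n. projective S (P n)) \<and>
     \<epsilon> \<in> mod_hom S (P 0) U \<and> (\<forall>n. d n \<in> mod_hom S (P (Suc n)) (P n)) \<and>
     \<epsilon> ` carrier (P 0) = carrier U \<and>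
     d 0 ` carrier (P (Suc 0)) = {p \<in> carrier (P 0). \<epsilon> p = \<zero>\<^bsub>U\<^esub>} \<and>
     (\<forall>n. d (Suc n) ` carrier (P (Suc (Suc n))) =
            {p \<in> carrier (P (Suc n)). d n p = \<zero>\<^bsub>P n\<^esub>})"

text \<open>Minimality: each \<open>P n\<close> is a projective cover of its image.\<close>

definition minimal_projective_resolution ::
  "('a, 'r) ring_scheme \<Rightarrow> ('a, 'x, 'm) module_scheme \<Rightarrow> (nat \<Rightarrow> ('a, 'p) module) \<Rightarrow>
   (nat \<Rightarrow> 'p \<Rightarrow> 'p) \<Rightarrow> ('p \<Rightarrow> 'x) \<Rightarrow> bool" where
  "minimal_projective_resolution S U P d \<epsilon> \<longleftrightarrow>
     projective_resolution S U P d \<epsilon> \<and>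
     superfluous S (P 0) {p \<in> carrier (P 0). \<epsilon> p = \<zero>\<^bsub>U\<^esub>} \<and>
     (\<forall>n. superfluous S (P (Suc n)) {p \<in> carrier (P (Suc n)). d n p = \<zero>\<^bsub>P n\<^esub>})"

text \<open>
  A type for the terms of resolutions of a module of type \<open>('a, 'x) module\<close>.  The index type
  \<open>('x \<times> 'a) list\<close> is infinite and at least as large as \<open>'x\<close> and \<open>'a\<close>, and so the free module on
  it is not larger than the index type.  Hence every module of that type has a resolution by
  free modules of this type (lemma \<open>projective_resolution_exists\<close> below).  If the projective
  dimension is finite, truncating such a resolution gives one of finite length, and a minimal
  resolution, having summands of these free modules as terms, has an isomorphic copy here.
\<close>

type_synonym ('a, 'x) res_module = "('a, ('x \<times> 'a) list \<Rightarrow> 'a) module"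

definition finite_pd :: "('a, 'r) ring_scheme \<Rightarrow> ('a, 'x, 'm) module_scheme \<Rightarrow> bool" where
  "finite_pd S U \<longleftrightarrow>
     (\<exists>(P :: nat \<Rightarrow> ('a, 'x) res_module) d \<epsilon> n. projective_resolution S U P d \<epsilon> \<and>
        (\<forall>j>n. carrier (P j) = {\<zero>\<^bsub>P j\<^esub>}))"

definition left_supp :: "'a set \<Rightarrow> ('a, 'b, 'm) module_scheme \<Rightarrow> 'a set" where
  "left_supp E M = {e \<in> E. \<exists>x\<in>carrier M. e \<odot>\<^bsub>M\<^esub> x \<noteq> \<zero>\<^bsub>M\<^esub>}"

definition supp_res ::
  "('a, 'r) ring_scheme \<Rightarrow> 'a set \<Rightarrow> (nat \<Rightarrow> ('a, 'p) module) \<Rightarrow> nat \<Rightarrow> 'a set" where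
  "supp_res R E P j = {e \<in> E. iso_to_summand (opp R) (principal_module (opp R) e) (P j)}"

text \<open>
  Minimal projective resolutions are unique up to isomorphism, so the sets \<open>supp_res R E P j\<close>
  do not depend on the choice of \<open>P\<close>; over a perfect ring they always exist.
\<close>

definition strongly_finite_right_pd ::
  "('a, 'r) ring_scheme \<Rightarrow> 'a set \<Rightarrow> ('a, 'b, 'm) bimodule_scheme \<Rightarrow> bool" where
  "strongly_finite_right_pd R E M \<longleftrightarrow>
     finite_pd (opp R) (right_mod M) \<and>
     (\<exists>(P :: nat \<Rightarrow> ('a, 'b) res_module) d \<epsilon>.
        minimal_projective_resolution (opp R) (right_mod M) P d \<epsilon> \<and>
        left_supp E M \<inter> (\<Union>j. supp_res R E P j) = {})"


section \<open>Tensor products and Tor\<close>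

text \<open>
  Abelian groups are written multiplicatively here, as in the library's \<open>free_Abelian_group\<close>.
  In \<open>tensor R U N\<close>, \<open>U\<close> is a right and \<open>N\<close> a left \<open>R\<close>-module; thus \<open>r \<odot>\<^bsub>U\<^esub> x\<close> is \<open>x r\<close>.
\<close>

definition tensor_rels ::
  "('a, 'r) ring_scheme \<Rightarrow> ('a, 'x, 'm) module_scheme \<Rightarrow> ('a, 'y, 'n) module_scheme \<Rightarrow>
   ('x \<times> 'y \<Rightarrow>\<^sub>0 int) set" where
  "tensor_rels R U N = generate (free_Abelian_group (carrier U \<times> carrier N))
     ({frag_of (x \<oplus>\<^bsub>U\<^esub> x', y) - frag_of (x, y) - frag_of (x', y) | x x' y.
         x \<in> carrier U \<and> x' \<in> carrier U \<and> y \<in> carrier N} \<union>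
      {frag_of (x, y \<oplus>\<^bsub>N\<^esub> y') - frag_of (x, y) - frag_of (x, y') | x y y'.
         x \<in> carrier U \<and> y \<in> carrier N \<and> y' \<in> carrier N} \<union>
      {frag_of (r \<odot>\<^bsub>U\<^esub> x, y) - frag_of (x, r \<odot>\<^bsub>N\<^esub> y) | r x y.
         r \<in> carrier R \<and> x \<in> carrier U \<and> y \<in> carrier N})"

definition tensor ::
  "('a, 'r) ring_scheme \<Rightarrow> ('a, 'x, 'm) module_scheme \<Rightarrow> ('a, 'y, 'n) module_scheme \<Rightarrow>
   ('x \<times> 'y \<Rightarrow>\<^sub>0 int) set monoid" where
  "tensor R U N = free_Abelian_group (carrier U \<times> carrier N) Mod tensor_rels R U N"

text \<open>The map \<open>f \<otimes> id\<close> from \<open>tensor R U N\<close> to \<open>tensor R V N\<close> induced by \<open>f\<close> from \<open>U\<close> to \<open>V\<close>.\<close>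

definition tensor_map ::
  "('a, 'r) ring_scheme \<Rightarrow> ('a, 'x', 'm) module_scheme \<Rightarrow> ('a, 'y, 'n) module_scheme \<Rightarrow>
   ('x \<Rightarrow> 'x') \<Rightarrow> ('x \<times> 'y \<Rightarrow>\<^sub>0 int) set \<Rightarrow> ('x' \<times> 'y \<Rightarrow>\<^sub>0 int) set" where
  "tensor_map R V N f C = the_elem
     ((\<lambda>c. tensor_rels R V N #>\<^bsub>free_Abelian_group (carrier V \<times> carrier N)\<^esub>
             frag_extend (\<lambda>(x, n). frag_of (f x, n)) c) ` C)"

definition tensor_cycles ::
  "('a, 'r) ring_scheme \<Rightarrow> (nat \<Rightarrow> ('a, 'p) module) \<Rightarrow> (nat \<Rightarrow> 'p \<Rightarrow> 'p) \<Rightarrow>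
   ('a, 'y, 'n) module_scheme \<Rightarrow> nat \<Rightarrow> ('p \<times> 'y \<Rightarrow>\<^sub>0 int) set set" where
  "tensor_cycles R P d N i = (case i of
       0 \<Rightarrow> carrier (tensor R (P 0) N)
     | Suc k \<Rightarrow> kernel (tensor R (P (Suc k)) N) (tensor R (P k) N) (tensor_map R (P k) N (d k)))"

definition tensor_homology ::
  "('a, 'r) ring_scheme \<Rightarrow> (nat \<Rightarrow> ('a, 'p) module) \<Rightarrow> (nat \<Rightarrow> 'p \<Rightarrow> 'p) \<Rightarrow>
   ('a, 'y, 'n) module_scheme \<Rightarrow> nat \<Rightarrow> ('p \<times> 'y \<Rightarrow>\<^sub>0 int) set set monoid" where
  "tensor_homology R P d N i =
     (tensor R (P i) N)\<lparr>carrier := tensor_cycles R P d N i\<rparr> Mod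
       (tensor_map R (P i) N (d i) ` carrier (tensor R (P (Suc i)) N))"

text \<open>
  \<open>Tor R i U N\<close> is the \<open>i\<close>-th homology of the tensor product of \<open>N\<close> with a chosen projective
  resolution of the right module \<open>U\<close>; up to isomorphism it does not depend on the choice.
\<close>

definition Tor ::
  "('a, 'r) ring_scheme \<Rightarrow> nat \<Rightarrow> ('a, 'x, 'm) module_scheme \<Rightarrow> ('a, 'y, 'n) module_scheme \<Rightarrow>
   ((('x \<times> 'a) list \<Rightarrow> 'a) \<times> 'y \<Rightarrow>\<^sub>0 int) set set monoid" where
  "Tor R i U N =
     (let (P, d, \<epsilon>) = (SOME (P :: nat \<Rightarrow> ('a, 'x) res_module, d, \<epsilon>).
                           projective_resolution (opp R) U P d \<epsilon>)
      in tensor_homology R P d N i)"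

text \<open>
  The \<open>j\<close>-fold tensor power (\<open>j \<ge> 1\<close>) of a bimodule is presented by generators
  \<open>x\<^sub>1 \<otimes> \<dots> \<otimes> x\<^sub>j\<close>, the lists of length \<open>j\<close>, subject to additivity in each factor and balancedness
  between neighbouring factors.  Iterating the binary tensor product would change the
  type in each step.
\<close>

definition tensor_words :: "('a, 'b, 'm) bimodule_scheme \<Rightarrow> nat \<Rightarrow> 'b list set" where
  "tensor_words M j = {w. length w = j \<and> set w \<subseteq> carrier M}"

definition tensor_power_rels ::
  "('a, 'r) ring_scheme \<Rightarrow> ('a, 'b, 'm) bimodule_scheme \<Rightarrow> nat \<Rightarrow> ('b list \<Rightarrow>\<^sub>0 int) set" where
  "tensor_power_rels R M j = generate (free_Abelian_group (tensor_words M j))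
     ({frag_of (u @ [x \<oplus>\<^bsub>M\<^esub> y] @ v) - frag_of (u @ [x] @ v) - frag_of (u @ [y] @ v) | u v x y.
         set u \<subseteq> carrier M \<and> set v \<subseteq> carrier M \<and> x \<in> carrier M \<and> y \<in> carrier M \<and>
         length u + 1 + length v = j} \<union>
      {frag_of (u @ [rsmult M x r, y] @ v) - frag_of (u @ [x, r \<odot>\<^bsub>M\<^esub> y] @ v) | u v x y r.
         set u \<subseteq> carrier M \<and> set v \<subseteq> carrier M \<and> x \<in> carrier M \<and> y \<in> carrier M \<and>
         r \<in> carrier R \<and> length u + 2 + length v = j})"

text \<open>The right module structure on the tensor power acts on the last factor.\<close>

definition tensor_power ::
  "('a, 'r) ring_scheme \<Rightarrow> ('a, 'b, 'm) bimodule_scheme \<Rightarrow> nat \<Rightarrow> ('a, ('b list \<Rightarrow>\<^sub>0 int) set) module"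
  where
  "tensor_power R M j =
     (let F = free_Abelian_group (tensor_words M j); K = tensor_power_rels R M j; T = F Mod K
      in \<lparr>carrier = carrier T, mult = undefined, one = undefined, ring.zero = one T, ring.add = mult T,
          smult = (\<lambda>r C. the_elem
            ((\<lambda>c. K #>\<^bsub>F\<^esub> frag_extend (\<lambda>w. frag_of (butlast w @ [rsmult M (last w) r])) c) ` C))\<rparr>)"

definition right_perfect_bimodule ::
  "('a, 'r) ring_scheme \<Rightarrow> ('a, 'b, 'm) bimodule_scheme \<Rightarrow> bool" where
  "right_perfect_bimodule R M \<longleftrightarrow>
     (\<forall>i\<ge>1. \<forall>j\<ge>1. trivial_group (Tor R i (tensor_power R M j) M)) \<and>
     finite_pd (opp R) (right_mod M)"


section \<open>Existence of resolutions, and tensor powers as modules\<close>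

lemma left_module_free_module:
  assumes "ring S"
  shows "left_module S (free_module S (I :: 'i set))"
proof -
  interpret ring S by fact
  let ?F = "free_module S I"
  have sub: "finite {i. f i \<oplus>\<^bsub>S\<^esub> g i \<noteq> \<zero>\<^bsub>S\<^esub>}"
    if "finite {i. f i \<noteq> \<zero>\<^bsub>S\<^esub>}" "finite {i. g i \<noteq> \<zero>\<^bsub>S\<^esub>}" for f g :: "'i \<Rightarrow> _"
    by (rule finite_subset[OF _ finite_UnI[OF that]]) (auto)
  have subm: "finite {i. a \<otimes>\<^bsub>S\<^esub> f i \<noteq> \<zero>\<^bsub>S\<^esub>}"
    if "a \<in> carrier S" "finite {i. f i \<noteq> \<zero>\<^bsub>S\<^esub>}" for a and f :: "'i \<Rightarrow> _"
    by (rule finite_subset[OF _ that(2)]) (use that(1) in auto)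
  have cl: "f i \<in> carrier S" if "f \<in> carrier ?F" for f i
    using that by (cases "i \<in> I") (auto simp: free_module_def)
  have inv: "\<exists>g\<in>carrier ?F. g \<oplus>\<^bsub>?F\<^esub> f = \<zero>\<^bsub>?F\<^esub>" if "f \<in> carrier ?F" for f
  proof
    show "(\<lambda>i. (\<ominus>\<^bsub>S\<^esub> \<one>\<^bsub>S\<^esub>) \<otimes>\<^bsub>S\<^esub> f i) \<in> carrier ?F"
      using that subm[of "\<ominus>\<^bsub>S\<^esub> \<one>\<^bsub>S\<^esub>" f] by (auto simp: free_module_def)
    show "(\<lambda>i. (\<ominus>\<^bsub>S\<^esub> \<one>\<^bsub>S\<^esub>) \<otimes>\<^bsub>S\<^esub> f i) \<oplus>\<^bsub>?F\<^esub> f = \<zero>\<^bsub>?F\<^esub>"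
      using cl[OF that] by (auto simp: free_module_def l_minus l_neg)
  qed
  have "abelian_group ?F"
  proof (rule abelian_groupI)
    show "f \<oplus>\<^bsub>?F\<^esub> g \<in> carrier ?F" if "f \<in> carrier ?F" "g \<in> carrier ?F" for f g
      using that sub by (auto simp: free_module_def)
    show "\<zero>\<^bsub>?F\<^esub> \<in> carrier ?F" by (auto simp: free_module_def)
    show "f \<oplus>\<^bsub>?F\<^esub> g \<oplus>\<^bsub>?F\<^esub> h = f \<oplus>\<^bsub>?F\<^esub> (g \<oplus>\<^bsub>?F\<^esub> h)"
      if "f \<in> carrier ?F" "g \<in> carrier ?F" "h \<in> carrier ?F" for f g h
      using cl[OF that(1)] cl[OF that(2)] cl[OF that(3)] by (auto simp: free_module_def a_assoc)
    show "f \<oplus>\<^bsub>?F\<^esub> g = g \<oplus>\<^bsub>?F\<^esub> f" if "f \<in> carrier ?F" "g \<in> carrier ?F" for f g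
      using cl[OF that(1)] cl[OF that(2)] by (auto simp: free_module_def a_comm)
    show "\<zero>\<^bsub>?F\<^esub> \<oplus>\<^bsub>?F\<^esub> f = f" if "f \<in> carrier ?F" for f
      using cl[OF that] by (auto simp: free_module_def)
  qed (use inv in auto)
  then show ?thesis
  proof (intro left_module.intro left_module_axioms.intro assms)
    show "a \<odot>\<^bsub>?F\<^esub> f \<in> carrier ?F" if "a \<in> carrier S" "f \<in> carrier ?F" for a f
      using that subm by (auto simp: free_module_def)
    show "(a \<oplus>\<^bsub>S\<^esub> b) \<odot>\<^bsub>?F\<^esub> f = a \<odot>\<^bsub>?F\<^esub> f \<oplus>\<^bsub>?F\<^esub> b \<odot>\<^bsub>?F\<^esub> f"
      if "a \<in> carrier S" "b \<in> carrier S" "f \<in> carrier ?F" for a b f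
      using that(1,2) cl[OF that(3)] by (simp add: free_module_def l_distr)
    show "a \<odot>\<^bsub>?F\<^esub> (f \<oplus>\<^bsub>?F\<^esub> g) = a \<odot>\<^bsub>?F\<^esub> f \<oplus>\<^bsub>?F\<^esub> a \<odot>\<^bsub>?F\<^esub> g"
      if "a \<in> carrier S" "f \<in> carrier ?F" "g \<in> carrier ?F" for a f g
      using that(1) cl[OF that(2)] cl[OF that(3)] by (simp add: free_module_def r_distr)
    show "(a \<otimes>\<^bsub>S\<^esub> b) \<odot>\<^bsub>?F\<^esub> f = a \<odot>\<^bsub>?F\<^esub> (b \<odot>\<^bsub>?F\<^esub> f)"
      if "a \<in> carrier S" "b \<in> carrier S" "f \<in> carrier ?F" for a b f
      using that(1,2) cl[OF that(3)] by (simp add: free_module_def m_assoc)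
    show "\<one>\<^bsub>S\<^esub> \<odot>\<^bsub>?F\<^esub> f = f" if "f \<in> carrier ?F" for f
      using cl[OF that] by (simp add: free_module_def)
  qed
qed

lemma direct_decomp_whole:
  assumes "left_module S U"
  shows "direct_decomp S U (carrier U) {\<zero>\<^bsub>U\<^esub>}"
proof -
  interpret left_module S U by fact
  have 0: "a \<odot>\<^bsub>U\<^esub> \<zero>\<^bsub>U\<^esub> = \<zero>\<^bsub>U\<^esub>" if "a \<in> carrier S" for a
    using that smult_r_distr[of a "\<zero>\<^bsub>U\<^esub>" "\<zero>\<^bsub>U\<^esub>"]
    by (metis M.add.r_cancel_one M.l_zero M.zero_closed left_module.smult_closed left_module_axioms)
  have "submodule (carrier U) S U" "submodule {\<zero>\<^bsub>U\<^esub>} S U"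
    using M.add.triv_subgroup
    by (auto intro!: submodule.intro submodule_axioms.intro M.add.subgroup_self simp: 0)
  then show ?thesis
    by (auto simp: direct_decomp_def set_add_def set_mult_def)
qed

lemma projective_free_module:
  assumes "ring S"
  shows "projective S (free_module S (UNIV :: 'i set))"
proof -
  interpret ring S by fact
  let ?F = "free_module S (UNIV :: 'i set)"
  define D where "D i = (\<lambda>k. if k = i then \<one>\<^bsub>S\<^esub> else \<zero>\<^bsub>S\<^esub>)" for i :: 'i
  define h where "h = (\<lambda>f :: 'i \<Rightarrow> 'a. \<lambda>u. if u \<in> range D then f (inv_into UNIV D u) else \<zero>\<^bsub>S\<^esub>)"
  let ?G = "free_module S (range D)"
  have zero: "a = \<zero>\<^bsub>S\<^esub>" if "\<one>\<^bsub>S\<^esub> = \<zero>\<^bsub>S\<^esub>" "a \<in> carrier S" for a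
    using that by (metis l_null l_one)
  have inj: "inj D" if "\<one>\<^bsub>S\<^esub> \<noteq> \<zero>\<^bsub>S\<^esub>"
    using that by (auto simp: inj_def D_def fun_eq_iff)
  have "h \<in> mod_hom S ?F ?G \<and> bij_betw h (carrier ?F) (carrier ?G)"
  proof (cases "\<one>\<^bsub>S\<^esub> = \<zero>\<^bsub>S\<^esub>")
    case True
    have triv: "carrier (free_module S J) = {\<lambda>i. \<zero>\<^bsub>S\<^esub>}" for J :: "'j set"
    proof -
      have "f = (\<lambda>i. \<zero>\<^bsub>S\<^esub>)" if "f \<in> carrier (free_module S J)" for f
      proof
        show "f i = \<zero>\<^bsub>S\<^esub>" for i
          using that zero[OF True] by (cases "i \<in> J") (simp_all add: free_module_def)
      qed
      then show ?thesis by (auto simp: free_module_def)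
    qed
    have "h (\<lambda>i. \<zero>\<^bsub>S\<^esub>) = (\<lambda>u. \<zero>\<^bsub>S\<^esub>)" by (simp add: h_def fun_eq_iff)
    then show ?thesis
      by (simp add: mod_hom_def bij_betw_def triv) (simp add: free_module_def)
  next
    case False
    note inj = inj[OF False]
    have supp: "{u. h f u \<noteq> \<zero>\<^bsub>S\<^esub>} = D ` {i. f i \<noteq> \<zero>\<^bsub>S\<^esub>}" for f
      by (auto simp: h_def inj_eq[OF inj] inv_f_f[OF inj])
    have "inj_on h (carrier ?F)"
    proof (rule inj_onI, rule ext)
      fix f g i assume "h f = h g"
      then have "h f (D i) = h g (D i)" by simp
      then show "f i = g i" using inj by (simp add: h_def)
    qed
    moreover have "h f \<in> carrier ?G" if "f \<in> carrier ?F" for f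
      using that supp[of f] by (auto simp: free_module_def h_def)
    moreover have "g \<in> h ` carrier ?F" if g: "g \<in> carrier ?G" for g
    proof
      show "g = h (\<lambda>i. g (D i))"
        using g inj by (auto simp: h_def free_module_def fun_eq_iff)
      have "finite (D -` {u. g u \<noteq> \<zero>\<^bsub>S\<^esub>})"
        using g inj by (intro finite_vimageI) (auto simp: free_module_def)
      then show "(\<lambda>i. g (D i)) \<in> carrier ?F"
        using g by (auto simp: free_module_def vimage_def)
    qed
    moreover have "h (f \<oplus>\<^bsub>?F\<^esub> g) = h f \<oplus>\<^bsub>?G\<^esub> h g" for f g
      by (simp add: free_module_def h_def fun_eq_iff)
    moreover have "h (a \<odot>\<^bsub>?F\<^esub> f) = a \<odot>\<^bsub>?G\<^esub> h f" if "a \<in> carrier S" for a f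
      using that by (simp add: free_module_def h_def fun_eq_iff)
    ultimately show ?thesis
      unfolding mod_hom_def bij_betw_def by blast
  qed
  then have iso: "mod_isomorphic S ?F (?G\<lparr>carrier := carrier ?G\<rparr>)"
    unfolding mod_isomorphic_def by auto
  have F: "left_module S ?F" and G: "left_module S ?G"
    by (rule left_module_free_module[OF assms])+
  have "iso_to_summand S ?F ?G"
    unfolding iso_to_summand_def using direct_decomp_whole[OF G] iso by (intro exI conjI)
  then show ?thesis
    unfolding projective_def using F by (intro conjI exI)
qed

lemma free_module_cover:
  fixes g :: "'i \<Rightarrow> 'b" and U :: "('a, 'b, 'm) module_scheme"
  assumes "left_module S U" and K: "submodule K S U" and g: "range g = K"
  shows "\<exists>f\<in>mod_hom S (free_module S (UNIV :: 'i set)) U. f ` carrier (free_module S UNIV) = K"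
proof -
  interpret left_module S U by fact
  interpret K: submodule K S U by fact
  have Kc: "K \<subseteq> carrier U" using K.subset by simp
  let ?F = "free_module S (UNIV :: 'i set)"
  define e where "e f = finsum U (\<lambda>i. f i \<odot>\<^bsub>U\<^esub> g i) {i. f i \<noteq> \<zero>\<^bsub>S\<^esub>}" for f :: "'i \<Rightarrow> 'a"
  have gK [simp]: "g i \<in> K" for i using g by auto
  have gc [simp]: "g i \<in> carrier U" for i using gK Kc by blast
  have z: "\<zero>\<^bsub>S\<^esub> \<odot>\<^bsub>U\<^esub> x = \<zero>\<^bsub>U\<^esub>" if "x \<in> carrier U" for x
    using that smult_l_distr[of "\<zero>\<^bsub>S\<^esub>" "\<zero>\<^bsub>S\<^esub>" x]
    by (metis M.add.r_cancel_one R.l_zero R.zero_closed smult_closed)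
  have z': "a \<odot>\<^bsub>U\<^esub> \<zero>\<^bsub>U\<^esub> = \<zero>\<^bsub>U\<^esub>" if "a \<in> carrier S" for a
    using that smult_r_distr[of a "\<zero>\<^bsub>U\<^esub>" "\<zero>\<^bsub>U\<^esub>"]
    by (metis M.add.r_cancel_one M.l_zero M.zero_closed smult_closed)
  have cl: "f i \<in> carrier S" "finite {i. f i \<noteq> \<zero>\<^bsub>S\<^esub>}" if "f \<in> carrier ?F" for f i
    using that by (auto simp: free_module_def)
  have ext: "e f = finsum U (\<lambda>i. f i \<odot>\<^bsub>U\<^esub> g i) T"
    if "f \<in> carrier ?F" "finite T" "{i. f i \<noteq> \<zero>\<^bsub>S\<^esub>} \<subseteq> T" for f T
    unfolding e_def
    by (rule M.add.finprod_mono_neutral_cong_left[simplified])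
       (use that cl[OF that(1)] z in auto)
  have sm: "a \<odot>\<^bsub>U\<^esub> finsum U t T = finsum U (\<lambda>i. a \<odot>\<^bsub>U\<^esub> t i) T"
    if "finite T" "a \<in> carrier S" "t \<in> T \<rightarrow> carrier U" for a t and T :: "'i set"
    using that
  proof (induction T rule: finite_induct)
    case (insert i T)
    then have "t i \<in> carrier U" "t \<in> T \<rightarrow> carrier U" "(\<lambda>i. a \<odot>\<^bsub>U\<^esub> t i) \<in> T \<rightarrow> carrier U"
      by auto
    then show ?case using insert by (simp add: smult_r_distr M.finsum_closed)
  qed (simp add: z')
  have inK: "e f \<in> K" if f: "f \<in> carrier ?F" for f
  proof -
    have "finsum U (\<lambda>i. f i \<odot>\<^bsub>U\<^esub> g i) T \<in> K" if "finite T" for T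
      using that
    proof (induction T rule: finite_induct)
      case empty show ?case using K.one_closed by simp
    next
      case (insert i T)
      have "f i \<odot>\<^bsub>U\<^esub> g i \<in> K" using cl[OF f] by (intro K.smult_closed) auto
      then show ?case using insert cl[OF f] K.m_closed by simp
    qed
    then show ?thesis using cl[OF f] by (simp add: e_def)
  qed
  have add: "e (f \<oplus>\<^bsub>?F\<^esub> f') = e f \<oplus>\<^bsub>U\<^esub> e f'" if f: "f \<in> carrier ?F" "f' \<in> carrier ?F" for f f'
  proof -
    let ?T = "{i. f i \<noteq> \<zero>\<^bsub>S\<^esub>} \<union> {i. f' i \<noteq> \<zero>\<^bsub>S\<^esub>}"
    have T: "finite ?T" using cl[OF f(1)] cl[OF f(2)] by auto
    interpret F: left_module S ?F by (rule left_module_free_module) (rule R.ring_axioms)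
    have "e (f \<oplus>\<^bsub>?F\<^esub> f') = finsum U (\<lambda>i. (f \<oplus>\<^bsub>?F\<^esub> f') i \<odot>\<^bsub>U\<^esub> g i) ?T"
      by (rule ext[OF F.M.a_closed[OF f] T]) (use f in \<open>auto simp: free_module_def\<close>)
    also have "\<dots> = finsum U (\<lambda>i. f i \<odot>\<^bsub>U\<^esub> g i \<oplus>\<^bsub>U\<^esub> f' i \<odot>\<^bsub>U\<^esub> g i) ?T"
      by (rule M.finsum_cong') (use cl[OF f(1)] cl[OF f(2)] in \<open>auto simp: free_module_def smult_l_distr\<close>)
    also have "\<dots> = e f \<oplus>\<^bsub>U\<^esub> e f'"
      by (subst M.finsum_addf) (use cl[OF f(1)] cl[OF f(2)] f T in \<open>auto simp: ext[of _ ?T]\<close>)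
    finally show ?thesis .
  qed
  have smul: "e (a \<odot>\<^bsub>?F\<^esub> f) = a \<odot>\<^bsub>U\<^esub> e f" if f: "f \<in> carrier ?F" and a: "a \<in> carrier S" for f a
  proof -
    let ?T = "{i. f i \<noteq> \<zero>\<^bsub>S\<^esub>}"
    interpret F: left_module S ?F by (rule left_module_free_module) (rule R.ring_axioms)
    have "e (a \<odot>\<^bsub>?F\<^esub> f) = finsum U (\<lambda>i. (a \<odot>\<^bsub>?F\<^esub> f) i \<odot>\<^bsub>U\<^esub> g i) ?T"
      by (rule ext[OF F.smult_closed[OF a f]]) (use f a cl[OF f] in \<open>auto simp: free_module_def\<close>)
    also have "\<dots> = finsum U (\<lambda>i. a \<odot>\<^bsub>U\<^esub> (f i \<odot>\<^bsub>U\<^esub> g i)) ?T"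
      by (rule M.finsum_cong') (use cl[OF f] a in \<open>auto simp: free_module_def smult_assoc1\<close>)
    also have "\<dots> = a \<odot>\<^bsub>U\<^esub> e f"
      unfolding e_def by (rule sm[symmetric]) (use cl[OF f] a in auto)
    finally show ?thesis .
  qed
  have "x \<in> e ` carrier ?F" if x: "x \<in> K" for x
  proof -
    obtain i where i: "x = g i" using x g by auto
    let ?f = "\<lambda>k. if k = i then \<one>\<^bsub>S\<^esub> else \<zero>\<^bsub>S\<^esub>"
    have f: "?f \<in> carrier ?F" by (auto simp: free_module_def)
    have "e ?f = finsum U (\<lambda>k. ?f k \<odot>\<^bsub>U\<^esub> g k) {i}"
      by (rule ext) (use f in auto)
    also have "\<dots> = x" using i by simp
    finally show ?thesis using f by blast
  qed
  then have "e ` carrier ?F = K" using inK by auto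
  moreover have "e \<in> mod_hom S ?F U"
    using inK Kc add smul by (auto simp: mod_hom_def)
  ultimately show ?thesis by blast
qed

lemma submodule_kernel:
  assumes "left_module S U" "left_module S V" "f \<in> mod_hom S U V"
  shows "submodule {x \<in> carrier U. f x = \<zero>\<^bsub>V\<^esub>} S U"
proof -
  interpret U: left_module S U by fact
  interpret V: left_module S V by fact
  have f: "f \<in> carrier U \<rightarrow> carrier V"
    "\<And>x y. x \<in> carrier U \<Longrightarrow> y \<in> carrier U \<Longrightarrow> f (x \<oplus>\<^bsub>U\<^esub> y) = f x \<oplus>\<^bsub>V\<^esub> f y"
    "\<And>a x. a \<in> carrier S \<Longrightarrow> x \<in> carrier U \<Longrightarrow> f (a \<odot>\<^bsub>U\<^esub> x) = a \<odot>\<^bsub>V\<^esub> f x"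
    using assms(3) by (auto simp: mod_hom_def)
  have "group_hom (add_monoid U) (add_monoid V) f"
    using f by (intro group_hom.intro group_hom_axioms.intro U.M.add.is_group V.M.add.is_group)
      (auto simp: hom_def)
  then have "subgroup {x \<in> carrier U. f x = \<zero>\<^bsub>V\<^esub>} (add_monoid U)"
    using group_hom.subgroup_kernel by (fastforce simp: kernel_def)
  moreover have "a \<odot>\<^bsub>V\<^esub> \<zero>\<^bsub>V\<^esub> = \<zero>\<^bsub>V\<^esub>" if "a \<in> carrier S" for a
    using that V.smult_r_distr[of a "\<zero>\<^bsub>V\<^esub>" "\<zero>\<^bsub>V\<^esub>"]
    by (metis V.M.add.r_cancel_one V.M.l_zero V.M.zero_closed V.smult_closed)
  ultimately show ?thesis
    using f by (auto intro!: submodule.intro submodule_axioms.intro)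
qed


lemma ex_onto_free_module_subset:
  fixes K :: "(('x \<times> 'a) list \<Rightarrow> 'a) set"
  assumes "K \<subseteq> carrier (free_module S UNIV)" "K \<noteq> {}"
  shows "\<exists>g :: ('x \<times> 'a) list \<Rightarrow> _. range g = K"
proof -
  let ?I = "UNIV :: ('x \<times> 'a) list set"
  have inf: "infinite ?I" by (rule infinite_UNIV_listI)
  have "inj_on (\<lambda>f. (\<lambda>i. (i, f i)) ` {i. f i \<noteq> \<zero>\<^bsub>S\<^esub>}) K"
  proof (rule inj_onI, rule ext)
    fix f g i
    assume eq: "(\<lambda>i. (i, f i)) ` {i. f i \<noteq> \<zero>\<^bsub>S\<^esub>} = (\<lambda>i. (i, g i)) ` {i. g i \<noteq> \<zero>\<^bsub>S\<^esub>}"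
    have "f i \<noteq> \<zero>\<^bsub>S\<^esub> \<Longrightarrow> (i, f i) \<in> (\<lambda>i. (i, g i)) ` {i. g i \<noteq> \<zero>\<^bsub>S\<^esub>}"
      "g i \<noteq> \<zero>\<^bsub>S\<^esub> \<Longrightarrow> (i, g i) \<in> (\<lambda>i. (i, f i)) ` {i. f i \<noteq> \<zero>\<^bsub>S\<^esub>}"
      using eq by auto
    then show "f i = g i" by (cases "f i = \<zero>\<^bsub>S\<^esub>"; cases "g i = \<zero>\<^bsub>S\<^esub>") auto
  qed
  moreover have "(\<lambda>f. (\<lambda>i. (i, f i)) ` {i. f i \<noteq> \<zero>\<^bsub>S\<^esub>}) ` K \<subseteq> Fpow (?I \<times> (UNIV :: 'a set))"
    using assms(1) by (auto simp: Fpow_def free_module_def)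
  ultimately have "K \<lesssim> Fpow (?I \<times> (UNIV :: 'a set))"
    unfolding lepoll_def by blast
  also have "Fpow (?I \<times> (UNIV :: 'a set)) \<approx> ?I \<times> (UNIV :: 'a set)"
    using inf by (intro eqpoll_Fpow notI) (drule finite_cartesian_productD1, simp_all)
  also have "?I \<times> (UNIV :: 'a set) \<lesssim> ?I \<times> ?I"
  proof -
    have "inj (\<lambda>a :: 'a. [(undefined :: 'x, a)])" by (auto simp: inj_def)
    then have "(UNIV :: 'a set) \<lesssim> ?I" unfolding lepoll_def by blast
    then show ?thesis by (intro times_lepoll_mono) auto
  qed
  also have "?I \<times> ?I \<approx> ?I"
    unfolding eqpoll_iff_card_of_ordIso using inf by (rule card_of_Times_same_infinite)
  finally obtain h :: "('x \<times> 'a) list \<Rightarrow> _" where h: "K \<subseteq> range h"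
    unfolding lepoll_iff by blast
  obtain k where k: "k \<in> K" using assms(2) by auto
  have "range (\<lambda>i. if h i \<in> K then h i else k) = K"
    using h k by auto
  then show ?thesis by blast
qed

lemma free_module_syzygy:
  fixes S :: "('a, 'r) ring_scheme" and V :: "('a, 'v, 'n) module_scheme"
  defines "F \<equiv> free_module S (UNIV :: ('x \<times> 'a) list set)"
  assumes S: "ring S" and V: "left_module S V" and h: "h \<in> mod_hom S F V"
  shows "\<exists>f\<in>mod_hom S F F. f ` carrier F = {p \<in> carrier F. h p = \<zero>\<^bsub>V\<^esub>}"
proof -
  have F: "left_module S F"
    unfolding F_def by (rule left_module_free_module[OF S])
  have K: "submodule {p \<in> carrier F. h p = \<zero>\<^bsub>V\<^esub>} S F" (is "submodule ?K S F")
    by (rule submodule_kernel[OF F V h])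
  then have "?K \<noteq> {}"
    using subgroup.one_closed[OF submodule.axioms(1)] by force
  moreover have "?K \<subseteq> carrier (free_module S UNIV)" by (auto simp: F_def)
  ultimately obtain k :: "('x \<times> 'a) list \<Rightarrow> _" where k: "range k = ?K"
    by (blast dest: ex_onto_free_module_subset)
  show ?thesis
    using free_module_cover[OF F K k] unfolding F_def .
qed

lemma projective_resolution_exists:
  fixes U :: "('a, 'x, 'm) module_scheme"
  assumes "left_module S U"
  shows "\<exists>(P :: nat \<Rightarrow> ('a, 'x) res_module) d \<epsilon>. projective_resolution S U P d \<epsilon>"
proof -
  interpret U: left_module S U by fact
  define F where "F = free_module S (UNIV :: ('x \<times> 'a) list set)"
  have F: "left_module S F" unfolding F_def by (rule left_module_free_module) (rule U.R.ring_axioms)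
  have proj: "projective S F" unfolding F_def by (rule projective_free_module) (rule U.R.ring_axioms)
  define g where "g l = (if fst (hd l) \<in> carrier U then fst (hd l) else \<zero>\<^bsub>U\<^esub>)" for l :: "('x \<times> 'a) list"
  have "x = g [(x, undefined)]" if "x \<in> carrier U" for x
    using that by (simp add: g_def)
  then have "carrier U \<subseteq> range g" by blast
  moreover have "range g \<subseteq> carrier U" by (auto simp: g_def)
  ultimately have "range g = carrier U" by blast
  then obtain \<epsilon> where \<epsilon>: "\<epsilon> \<in> mod_hom S F U" "\<epsilon> ` carrier F = carrier U"
    using free_module_cover[OF assms, of "carrier U" g] direct_decomp_whole[OF assms]
    unfolding F_def direct_decomp_def by blast
  note step = free_module_syzygy[OF U.R.ring_axioms, where 'x = 'x, folded F_def]
  obtain d0 where d0: "d0 \<in> mod_hom S F F" "d0 ` carrier F = {p \<in> carrier F. \<epsilon> p = \<zero>\<^bsub>U\<^esub>}"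
    using step[OF assms \<epsilon>(1)] by (elim bexE)
  let ?Q = "\<lambda>n f. f \<in> mod_hom S F F \<and> (n = 0 \<longrightarrow> f = d0)"
  have "\<exists>d. \<forall>n. ?Q n (d n) \<and> d (Suc n) ` carrier F = {p \<in> carrier F. d n p = \<zero>\<^bsub>F\<^esub>}"
  proof (rule dependent_nat_choice)
    show "\<exists>f. ?Q 0 f" using d0(1) by simp
    show "\<exists>f'. ?Q (Suc n) f' \<and> f' ` carrier F = {p \<in> carrier F. f p = \<zero>\<^bsub>F\<^esub>}"
      if "?Q n f" for f n
    proof -
      from that obtain f' where "f' \<in> mod_hom S F F" "f' ` carrier F = {p \<in> carrier F. f p = \<zero>\<^bsub>F\<^esub>}"
        using step[OF F, of f] by auto
      then show ?thesis by auto
    qed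
  qed
  then obtain d where d: "\<And>n. ?Q n (d n)"
    "\<And>n. d (Suc n) ` carrier F = {p \<in> carrier F. d n p = \<zero>\<^bsub>F\<^esub>}"
    by blast
  have "projective_resolution S U (\<lambda>_. F) d \<epsilon>"
    unfolding projective_resolution_def
  proof (intro conjI allI)
    have "d 0 = d0" using d(1)[of 0] by simp
    then show "d 0 ` carrier F = {p \<in> carrier F. \<epsilon> p = \<zero>\<^bsub>U\<^esub>}" using d0(2) by simp
  qed (use proj \<epsilon> d in blast)+
  then show ?thesis by blast
qed

lemma left_module_tensor_power:
  assumes M: "is_bimodule R M" and j: "j \<ge> 1"
  shows "left_module (opp R) (tensor_power R M j)"
proof -
  interpret L: left_module R M using M by (simp add: is_bimodule_def)
  interpret Rt: left_module "opp R" "right_mod M" using M by (simp add: is_bimodule_def)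
  have [simp]: "carrier (right_mod M) = carrier M" "x \<oplus>\<^bsub>right_mod M\<^esub> y = x \<oplus>\<^bsub>M\<^esub> y"
    "r \<odot>\<^bsub>right_mod M\<^esub> x = rsmult M x r" for x y r
    by (simp_all add: right_mod_def)
  note rcl = Rt.smult_closed[simplified] and rl = Rt.smult_l_distr[simplified]
    and rr = Rt.smult_r_distr[simplified] and ra = Rt.smult_assoc1[simplified]
    and r1 = Rt.smult_one[simplified]
  have comp: "rsmult M (a \<odot>\<^bsub>M\<^esub> x) b = a \<odot>\<^bsub>M\<^esub> rsmult M x b"
    if "a \<in> carrier R" "b \<in> carrier R" "x \<in> carrier M" for a b x
    using M that by (simp add: is_bimodule_def)
  define W where "W = tensor_words M j"
  define F where "F = free_Abelian_group W"
  define K where "K = tensor_power_rels R M j"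
  define act where "act r w = butlast w @ [rsmult M (last w) r]" for r w
  define h where "h r = frag_extend (\<lambda>w. frag_of (act r w))" for r
  let ?T = "tensor_power R M j"
  have cF: "c \<in> carrier F \<longleftrightarrow> Poly_Mapping.keys c \<subseteq> W" for c by (simp add: F_def)
  interpret F: comm_group F unfolding F_def by (rule abelian_free_Abelian_group)
  have [simp]: "x \<otimes>\<^bsub>F\<^esub> y = x + y" "\<one>\<^bsub>F\<^esub> = 0" for x y by (auto simp: F_def)
  have invF: "inv\<^bsub>F\<^esub> x = - x" if "x \<in> carrier F" for x
    using that by (simp add: F_def)
  define B where "B =
     {frag_of (u @ [x \<oplus>\<^bsub>M\<^esub> y] @ v) - frag_of (u @ [x] @ v) - frag_of (u @ [y] @ v) | u v x y.
         set u \<subseteq> carrier M \<and> set v \<subseteq> carrier M \<and> x \<in> carrier M \<and> y \<in> carrier M \<and>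
         length u + 1 + length v = j} \<union>
      {frag_of (u @ [rsmult M x r, y] @ v) - frag_of (u @ [x, r \<odot>\<^bsub>M\<^esub> y] @ v) | u v x y r.
         set u \<subseteq> carrier M \<and> set v \<subseteq> carrier M \<and> x \<in> carrier M \<and> y \<in> carrier M \<and>
         r \<in> carrier R \<and> length u + 2 + length v = j}"
  have B: "K = generate F B"
    unfolding K_def tensor_power_rels_def F_def W_def B_def ..
  have Badd: "frag_of (u @ [x \<oplus>\<^bsub>M\<^esub> y] @ v) - frag_of (u @ [x] @ v) - frag_of (u @ [y] @ v) \<in> B"
    if "set u \<subseteq> carrier M" "set v \<subseteq> carrier M" "x \<in> carrier M" "y \<in> carrier M"
      "length u + 1 + length v = j" for u v x y
    unfolding B_def using that by blast
  have Bbal: "frag_of (u @ [rsmult M x r, y] @ v) - frag_of (u @ [x, r \<odot>\<^bsub>M\<^esub> y] @ v) \<in> B"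
    if "set u \<subseteq> carrier M" "set v \<subseteq> carrier M" "x \<in> carrier M" "y \<in> carrier M"
      "r \<in> carrier R" "length u + 2 + length v = j" for u v x y r
    unfolding B_def using that by blast
  have Bcases: 
      "(\<exists>u v x y. b = frag_of (u @ [x \<oplus>\<^bsub>M\<^esub> y] @ v) - frag_of (u @ [x] @ v) - frag_of (u @ [y] @ v) \<and>
        set u \<subseteq> carrier M \<and> set v \<subseteq> carrier M \<and> x \<in> carrier M \<and> y \<in> carrier M \<and>
        length u + 1 + length v = j) \<or>
      (\<exists>u v x y r. b = frag_of (u @ [rsmult M x r, y] @ v) - frag_of (u @ [x, r \<odot>\<^bsub>M\<^esub> y] @ v) \<and>
        set u \<subseteq> carrier M \<and> set v \<subseteq> carrier M \<and> x \<in> carrier M \<and> y \<in> carrier M \<and>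
        r \<in> carrier R \<and> length u + 2 + length v = j)" if "b \<in> B" for b
    using that unfolding B_def by (simp only: Un_iff mem_Collect_eq)
  have Bsub: "B \<subseteq> carrier F"
  proof
    fix b assume "b \<in> B"
    have diff: "a - c \<in> carrier F" if "a \<in> carrier F" "c \<in> carrier F" for a c
      using that keys_diff[of a c] unfolding cF by blast
    from Bcases[OF \<open>b \<in> B\<close>] show "b \<in> carrier F"
      by (elim disjE exE conjE; hypsubst; intro diff)
        (auto simp: cF W_def tensor_words_def rcl)
  qed
  have Ksub: "subgroup K F" unfolding B by (rule F.generate_is_subgroup[OF Bsub])
  then interpret K: normal K F
    by (rule F.normal_iff_subgroup[THEN iffD2])
  have Kd: "a - b \<in> K" if "a \<in> K" "b \<in> K" for a b
    using K.m_closed[OF that(1) K.m_inv_closed[OF that(2)]] invF[of b] K.subset that by auto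
  have wact: "act r w \<in> W" if "w \<in> W" "r \<in> carrier R" for r w
    using that j rcl unfolding W_def tensor_words_def act_def
    by (cases w rule: rev_cases) auto
  have hF: "h r c \<in> carrier F" if "c \<in> carrier F" "r \<in> carrier R" for r c
    using that wact keys_frag_extend[of "\<lambda>w. frag_of (act r w)" c] by (fastforce simp: cF h_def)
  have hB: "h r b \<in> B" if b: "b \<in> B" and r: "r \<in> carrier R" for r b
    using Bcases[OF b]
  proof (elim disjE exE conjE)
    fix u v x y assume *: "b = frag_of (u @ [x \<oplus>\<^bsub>M\<^esub> y] @ v) - frag_of (u @ [x] @ v) - frag_of (u @ [y] @ v)"
      "set u \<subseteq> carrier M" "set v \<subseteq> carrier M" "x \<in> carrier M" "y \<in> carrier M" "length u + 1 + length v = j"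
    show ?thesis
    proof (cases v rule: rev_cases)
      case Nil
      then show ?thesis using * Badd[of u "[]" "rsmult M x r" "rsmult M y r"] r
        by (simp add: h_def frag_extend_diff act_def rr rcl)
    next
      case (snoc v' z)
      then show ?thesis using * Badd[of u "v' @ [rsmult M z r]" x y] r
        by (simp add: h_def frag_extend_diff act_def butlast_append rcl)
    qed
  next
    fix u v x y s assume *: "b = frag_of (u @ [rsmult M x s, y] @ v) - frag_of (u @ [x, s \<odot>\<^bsub>M\<^esub> y] @ v)"
      "set u \<subseteq> carrier M" "set v \<subseteq> carrier M" "x \<in> carrier M" "y \<in> carrier M" "s \<in> carrier R"
      "length u + 2 + length v = j"
    show ?thesis
    proof (cases v rule: rev_cases)
      case Nil
      then show ?thesis using * Bbal[of u "[]" x "rsmult M y r" s] r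
        by (simp add: h_def frag_extend_diff act_def butlast_append rcl comp)
    next
      case (snoc v' z)
      then show ?thesis using * Bbal[of u "v' @ [rsmult M z r]" x y s] r
        by (simp add: h_def frag_extend_diff act_def butlast_append rcl)
    qed
  qed
  have hK: "h r k \<in> K" if "k \<in> K" and r: "r \<in> carrier R" for r k
    using that(1) unfolding B
  proof (induction rule: generate.induct)
    case (inv b)
    then have "h r (inv\<^bsub>F\<^esub> b) = inv\<^bsub>F\<^esub> (h r b)"
      using invF[of b] invF[of "h r b"] hF[OF _ r, of b] Bsub by (auto simp: h_def frag_extend_minus)
    then show ?case using inv hB[OF _ r] by (simp add: generate.inv)
  qed (use hB[OF _ r] generate.one[of F] generate.eng[of _ F] in \<open>auto simp: generate.incl h_def frag_extend_add\<close>)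
  have coset: "K #>\<^bsub>F\<^esub> a = K #>\<^bsub>F\<^esub> b" if "a \<in> carrier F" "b \<in> carrier F" "a - b \<in> K" for a b
  proof -
    have "a = (a - b) \<otimes>\<^bsub>F\<^esub> b" by simp
    then have "a \<in> K #>\<^bsub>F\<^esub> b" using that(3) unfolding r_coset_def by blast
    then show ?thesis using F.repr_independence[OF _ that(2) Ksub] by simp
  qed
  have Tc: "carrier ?T = (\<lambda>c. K #>\<^bsub>F\<^esub> c) ` carrier F"
    by (simp add: tensor_power_def Let_def carrier_FactGroup flip: W_def F_def K_def)
  have T0: "\<zero>\<^bsub>?T\<^esub> = K #>\<^bsub>F\<^esub> 0"
    using F.coset_mult_one[OF K.subset]
    by (simp add: tensor_power_def Let_def FactGroup_def flip: W_def F_def K_def)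
  note Tsimps = Tc T0
  have Tadd: "(K #>\<^bsub>F\<^esub> a) \<oplus>\<^bsub>?T\<^esub> (K #>\<^bsub>F\<^esub> b) = K #>\<^bsub>F\<^esub> (a + b)"
    if "a \<in> carrier F" "b \<in> carrier F" for a b
    using K.rcos_sum[OF that]
    by (simp add: tensor_power_def Let_def FactGroup_def flip: W_def F_def K_def)
  have Tsm: "r \<odot>\<^bsub>?T\<^esub> (K #>\<^bsub>F\<^esub> a) = K #>\<^bsub>F\<^esub> h r a"
    if a: "a \<in> carrier F" and r: "r \<in> carrier R" for a r
  proof -
    have "K #>\<^bsub>F\<^esub> h r c = K #>\<^bsub>F\<^esub> h r a" if "c \<in> K #>\<^bsub>F\<^esub> a" for c
    proof -
      from that obtain k where k: "k \<in> K" "c = k + a" by (auto simp: r_coset_def)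
      then have "c \<in> carrier F" using a K.subset F.m_closed[of k a] by auto
      moreover have "h r c - h r a \<in> K"
        using hK[OF k(1) r] by (simp add: k(2) h_def frag_extend_add)
      ultimately show ?thesis using hF[OF _ r] a by (intro coset) simp_all
    qed
    moreover have "K #>\<^bsub>F\<^esub> a \<noteq> {}"
      using F.rcos_self[OF a Ksub] by blast
    ultimately have im: "(\<lambda>c. K #>\<^bsub>F\<^esub> h r c) ` (K #>\<^bsub>F\<^esub> a) = {K #>\<^bsub>F\<^esub> h r a}"
      by (simp add: image_constant_conv cong: image_cong_simp)
    have "r \<odot>\<^bsub>?T\<^esub> C = the_elem ((\<lambda>c. K #>\<^bsub>F\<^esub> h r c) ` C)" for C
      by (simp add: tensor_power_def Let_def h_def act_def flip: W_def F_def K_def)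
    then show ?thesis by (simp add: im)
  qed
  have hadd: "h r (a + b) = h r a + h r b" for r a b by (simp add: h_def frag_extend_add)
  have hsum: "h (r \<oplus>\<^bsub>R\<^esub> s) c - (h r c + h s c) \<in> K"
    if "c \<in> carrier F" and r: "r \<in> carrier R" "s \<in> carrier R" for r s c
    using that(1) unfolding cF
  proof (induction c rule: frag_induction)
    case zero then show ?case using K.one_closed by (simp add: h_def)
  next
    case (one w)
    then obtain w' x where "w = w' @ [x]" "set w' \<subseteq> carrier M" "x \<in> carrier M" "length w' + 1 = j"
      using j by (cases w rule: rev_cases) (auto simp: W_def tensor_words_def)
    then show ?case using Badd[of w' "[]" "rsmult M x r" "rsmult M x s"] r
      by (simp add: B h_def act_def rl rcl generate.incl diff_diff_add)
  next
    case (diff a b)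
    have "h (r \<oplus>\<^bsub>R\<^esub> s) (a - b) - (h r (a - b) + h s (a - b)) =
      (h (r \<oplus>\<^bsub>R\<^esub> s) a - (h r a + h s a)) - (h (r \<oplus>\<^bsub>R\<^esub> s) b - (h r b + h s b))"
      by (simp add: h_def frag_extend_diff)
    then show ?case using Kd[OF diff] by simp
  qed
  have hmult: "h r (h s c) = h (s \<otimes>\<^bsub>R\<^esub> r) c" if "c \<in> carrier F" "r \<in> carrier R" "s \<in> carrier R" for r s c
  proof -
    have "h r (h s c) = frag_extend (\<lambda>w. frag_of (act r (act s w))) c"
      unfolding h_def using frag_extend_compose[of "\<lambda>w. frag_of (act r w)" "act s" c]
      by (simp add: comp_def)
    also have "\<dots> = h (s \<otimes>\<^bsub>R\<^esub> r) c"
      unfolding h_def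
    proof (rule frag_extend_eq)
      fix w assume "w \<in> Poly_Mapping.keys c"
      then have "w \<in> W" using that by (auto simp: cF)
      then have "last w \<in> carrier M" using j by (cases w rule: rev_cases) (auto simp: W_def tensor_words_def)
      then show "frag_of (act r (act s w)) = frag_of (act (s \<otimes>\<^bsub>R\<^esub> r) w)"
        using that by (simp add: act_def ra)
    qed
    finally show ?thesis .
  qed
  have h1: "h \<one>\<^bsub>R\<^esub> c = c" if "c \<in> carrier F" for c
  proof -
    have "h \<one>\<^bsub>R\<^esub> c = frag_extend frag_of c"
      unfolding h_def
    proof (rule frag_extend_eq)
      fix w assume "w \<in> Poly_Mapping.keys c"
      then have "w \<in> W" using that by (auto simp: cF)
      then show "frag_of (act \<one>\<^bsub>R\<^esub> w) = frag_of w"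
        using j r1 by (cases w rule: rev_cases) (auto simp: W_def tensor_words_def act_def)
    qed
    then show ?thesis using frag_expansion[of c] by simp
  qed
  have Fadd: "a + b \<in> carrier F" if "a \<in> carrier F" "b \<in> carrier F" for a b
    using F.m_closed[OF that] by simp
  have "abelian_group ?T"
  proof (rule abelian_groupI)
    show "\<exists>y\<in>carrier ?T. y \<oplus>\<^bsub>?T\<^esub> x = \<zero>\<^bsub>?T\<^esub>" if "x \<in> carrier ?T" for x
    proof -
      from that obtain a where a: "a \<in> carrier F" "x = K #>\<^bsub>F\<^esub> a" by (auto simp: Tsimps)
      then have "- a \<in> carrier F" by (simp add: cF)
      then show ?thesis using a Tadd[of "- a" a] by (auto simp: Tsimps)
    qed
  qed (auto simp: Tsimps Tadd Fadd cF[of 0] add_ac image_iff intro: Fadd)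
  moreover have "ring (opp R)" by (rule Rt.R.ring_axioms)
  moreover have "K #>\<^bsub>F\<^esub> h (r \<oplus>\<^bsub>R\<^esub> s) c = K #>\<^bsub>F\<^esub> (h r c + h s c)"
    if "c \<in> carrier F" "r \<in> carrier R" "s \<in> carrier R" for r s c
    using that by (intro coset hsum hF Fadd) simp_all
  ultimately show ?thesis
    by (intro left_module.intro left_module_axioms.intro)
      (auto simp: Tsimps Tsm Tadd Fadd hF hadd hmult h1)
qed

end

theory Submission
  imports Defs
begin

text \<open>
  Let \<open>P\<close> be a term of the minimal resolution of \<open>M\<close> as a right module, and let \<open>X\<close> be the subgroup of \<open>M\<close>
  generated by all \<open>f(p) m\<close> with \<open>f : P \<rightarrow> \<Gamma>\<close> right linear.  By the dual basis lemma \<open>P \<otimes> M \<noteq> 0\<close> forces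
  \<open>X \<noteq> 0\<close>, and the trace of \<open>P\<close> maps \<open>X\<close> onto itself.  Since the radical \<open>J\<close> is T-nilpotent,
  \<open>J X \<noteq> X\<close>, so some \<open>f(p) x\<close> is not in \<open>J X\<close>.  A maximal left ideal containing \<open>(J X : f(p) x)\<close>
  yields, by semisimplicity of \<open>\<Gamma>/J\<close> and lifting, an idempotent \<open>e\<close> with \<open>e \<Gamma>\<close> local, \<open>e f(p) \<notin> J\<close> and
  \<open>e M \<noteq> 0\<close>.  Then \<open>e \<Gamma>\<close> is a summand of \<open>P\<close>, contradicting that the two supports are disjoint.

  Hence tensoring with \<open>M\<close> kills the whole resolution.  This gives \<open>M \<otimes> M = 0\<close>, and comparing
  resolutions gives \<open>Tor\<^sub>i(M, M) = 0\<close>; the higher tensor powers vanish.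
\<close>

section \<open>Submodules and left ideals\<close>

text \<open>Instead of decomposing \<open>P\<close> into modules e_i \<Gamma>, the proof extracts a
  single summand directly. Neither \<open>P\<close> nor \<open>X\<close> need be finitely generated,
  which is why T-nilpotence stands in for the usual Nakayama lemma. The trace T reproduces
  \<open>X\<close> because a dual basis p = sum of q g(p) gives f(p) = sum of f(q) g(p), that is T =
  T T. Choosing f(p) x outside J X, rather than merely f(p) outside J, ties the two supports
  together: if e f(p) x is not in J X, then e f(p) is not in J, since x is in X, and e M is not
  zero; both conclusions concern the same e. This e comes from lifting and need not belong to
  \<open>E\<close>. It is exchanged for the e' in \<open>E\<close> with e' \<Gamma> isomorphic to e
  \<Gamma>, which preserves being a summand of \<open>P\<close> and acting on M by a nonzero map.
  Finally, \<open>Tor\<close> is computed from an arbitrarily chosen resolution, so the vanishing of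
  P \<otimes> M has to be carried over to that one by a chain homotopy.\<close>

context left_module
begin

lemma smult_r_null: "a \<in> carrier R \<Longrightarrow> a \<odot>\<^bsub>M\<^esub> \<zero>\<^bsub>M\<^esub> = \<zero>\<^bsub>M\<^esub>"
  using smult_r_distr[of a "\<zero>\<^bsub>M\<^esub>" "\<zero>\<^bsub>M\<^esub>"]
  by (metis M.add.r_cancel_one M.l_zero M.zero_closed smult_closed)

lemma smult_l_null: "x \<in> carrier M \<Longrightarrow> \<zero>\<^bsub>R\<^esub> \<odot>\<^bsub>M\<^esub> x = \<zero>\<^bsub>M\<^esub>"
  using smult_l_distr[of "\<zero>\<^bsub>R\<^esub>" "\<zero>\<^bsub>R\<^esub>" x]
  by (metis M.add.r_cancel_one R.l_zero R.zero_closed smult_closed)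

lemma smult_l_minus:
  assumes "a \<in> carrier R" "x \<in> carrier M"
  shows "(\<ominus>\<^bsub>R\<^esub> a) \<odot>\<^bsub>M\<^esub> x = \<ominus>\<^bsub>M\<^esub> (a \<odot>\<^bsub>M\<^esub> x)"
proof -
  have "(\<ominus>\<^bsub>R\<^esub> a) \<odot>\<^bsub>M\<^esub> x \<oplus>\<^bsub>M\<^esub> a \<odot>\<^bsub>M\<^esub> x = \<zero>\<^bsub>M\<^esub>"
    using assms smult_l_distr[of "\<ominus>\<^bsub>R\<^esub> a" a x] by (simp add: R.l_neg smult_l_null)
  then show ?thesis
    using assms by (simp add: M.minus_equality)
qed

text \<open>Negatives are covered by the scalar \<open>\<ominus>\<one>\<close>.\<close>

lemma submodule_iff:
  "submodule L R M \<longleftrightarrow> L \<subseteq> carrier M \<and> \<zero>\<^bsub>M\<^esub> \<in> L \<and> (\<forall>x\<in>L. \<forall>y\<in>L. x \<oplus>\<^bsub>M\<^esub> y \<in> L) \<and>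
     (\<forall>a\<in>carrier R. \<forall>x\<in>L. a \<odot>\<^bsub>M\<^esub> x \<in> L)" (is "_ \<longleftrightarrow> ?r")
proof
  assume "submodule L R M"
  then interpret L: submodule L R M .
  show ?r using L.subset L.one_closed L.m_closed by auto
next
  assume r: ?r
  have inv: "\<ominus>\<^bsub>M\<^esub> x \<in> L" if "x \<in> L" for x
  proof -
    have "x \<in> carrier M" using r that by blast
    then have "\<ominus>\<^bsub>M\<^esub> x = (\<ominus>\<^bsub>R\<^esub> \<one>\<^bsub>R\<^esub>) \<odot>\<^bsub>M\<^esub> x" by (simp add: smult_l_minus)
    then show ?thesis using r that by simp
  qed
  show "submodule L R M"
    by (intro submodule.intro submodule_axioms.intro M.add.subgroupI)
      (use r inv in \<open>auto simp: a_inv_def[symmetric]\<close>)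
qed

end

lemma left_module_regular_module:
  assumes "ring S"
  shows "left_module S (regular_module S)"
proof -
  interpret ring S by fact
  have "abelian_group (regular_module S)"
    by (rule abelian_groupI) (auto simp: regular_module_def a_ac intro: bexI[of _ "\<ominus>\<^bsub>S\<^esub> _"] l_neg)
  then show ?thesis
    by (intro left_module.intro left_module_axioms.intro assms)
      (auto simp: regular_module_def l_distr r_distr m_assoc)
qed

context ring
begin

lemma left_ideal_iff:
  "submodule I R (regular_module R) \<longleftrightarrow> I \<subseteq> carrier R \<and> \<zero> \<in> I \<and> (\<forall>x\<in>I. \<forall>y\<in>I. x \<oplus> y \<in> I) \<and>
     (\<forall>a\<in>carrier R. \<forall>x\<in>I. a \<otimes> x \<in> I)"
  by (subst left_module.submodule_iff[OF left_module_regular_module[OF ring_axioms]])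
    (simp add: regular_module_def)

lemma left_ideal_minus:
  assumes "submodule I R (regular_module R)" "x \<in> I" "y \<in> I"
  shows "x \<ominus> y \<in> I"
proof -
  have I: "x \<in> carrier R" "y \<in> carrier R" "(\<ominus> \<one>) \<otimes> y \<in> I" "\<And>z. z \<in> I \<Longrightarrow> x \<oplus> z \<in> I"
    using assms unfolding left_ideal_iff by auto
  then show ?thesis using I(4)[OF I(3)] by (simp add: l_minus a_minus_def)
qed

lemma left_ideal_one: "submodule I R (regular_module R) \<Longrightarrow> \<one> \<in> I \<Longrightarrow> I = carrier R"
  unfolding left_ideal_iff by (metis r_one subset_antisym subsetI)

lemma proper_left_ideal_in_maximal:
  assumes A: "submodule A R (regular_module R)" "\<one> \<notin> A"
  obtains I where "maximal_left_ideal R I" "A \<subseteq> I"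
proof -
  \<comment> \<open>Properness is expressed by leaving out 1, a condition on one element that passes
    to unions of chains.\<close>
  let ?Z = "{L. submodule L R (regular_module R) \<and> A \<subseteq> L \<and> \<one> \<notin> L}"
  have "\<exists>I\<in>?Z. \<forall>X\<in>?Z. I \<subseteq> X \<longrightarrow> X = I"
  proof (rule subset_Zorn_nonempty)
    show "?Z \<noteq> {}" using A by blast
    fix C assume C: "C \<noteq> {}" "subset.chain ?Z C"
    then have C': "\<And>L. L \<in> C \<Longrightarrow> submodule L R (regular_module R) \<and> A \<subseteq> L \<and> \<one> \<notin> L"
      "\<And>L L'. L \<in> C \<Longrightarrow> L' \<in> C \<Longrightarrow> L \<subseteq> L' \<or> L' \<subseteq> L"
      by (auto simp: subset_chain_def)
    have add: "x \<oplus> y \<in> \<Union>C" if xy: "x \<in> L" "L \<in> C" "y \<in> L'" "L' \<in> C" for x y L L'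
    proof -
      obtain K where "K \<in> C" "x \<in> K" "y \<in> K" using xy C'(2)[of L L'] by blast
      then show ?thesis using C'(1)[of K] unfolding left_ideal_iff by blast
    qed
    have L: "L \<subseteq> carrier R \<and> \<zero> \<in> L \<and> (\<forall>a\<in>carrier R. \<forall>x\<in>L. a \<otimes> x \<in> L)" if "L \<in> C" for L
      using C'(1)[OF that] unfolding left_ideal_iff by simp
    have "\<Union>C \<subseteq> carrier R" "\<zero> \<in> \<Union>C" "\<forall>a\<in>carrier R. \<forall>x\<in>\<Union>C. a \<otimes> x \<in> \<Union>C"
      using L C(1) by blast+
    moreover have "\<forall>x\<in>\<Union>C. \<forall>y\<in>\<Union>C. x \<oplus> y \<in> \<Union>C"
      using add by (intro ballI) (elim UnionE)
    ultimately have "submodule (\<Union>C) R (regular_module R)"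
      unfolding left_ideal_iff by (intro conjI)
    then show "\<Union>C \<in> ?Z" using C(1) C' by blast
  qed
  then obtain I where I: "I \<in> ?Z" "\<forall>X\<in>?Z. I \<subseteq> X \<longrightarrow> X = I" by (elim bexE)
  have "maximal_left_ideal R I"
    unfolding maximal_left_ideal_def
  proof (intro conjI allI impI)
    show "submodule I R (regular_module R)" "I \<noteq> carrier R" using I(1) by auto
    show "L = I \<or> L = carrier R" if L: "submodule L R (regular_module R) \<and> I \<subseteq> L" for L
      using I(1) bspec[OF I(2), of L] L left_ideal_one[of L] by (cases "\<one> \<in> L") auto
  qed
  then show ?thesis using that[of I] I(1) by simp
qed

section \<open>The Jacobson radical\<close>

text \<open>Right multiplication by \<open>r\<close> identifies R modulo this colon ideal with the
  submodule of R/I generated by the class of \<open>r\<close>, which is all of the simple module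
  R/I.\<close>

lemma maximal_left_ideal_quotient:
  assumes I: "maximal_left_ideal R I" and r: "r \<in> carrier R" "r \<notin> I"
  shows "maximal_left_ideal R {x \<in> carrier R. x \<otimes> r \<in> I}" (is "maximal_left_ideal R ?K")
proof -
  have Im: "submodule I R (regular_module R)" "\<And>L. submodule L R (regular_module R) \<Longrightarrow> I \<subseteq> L \<Longrightarrow> L = I \<or> L = carrier R"
    using I unfolding maximal_left_ideal_def by blast+
  have Ic: "I \<subseteq> carrier R" "\<zero> \<in> I" "\<And>x y. x \<in> I \<Longrightarrow> y \<in> I \<Longrightarrow> x \<oplus> y \<in> I"
    "\<And>a x. a \<in> carrier R \<Longrightarrow> x \<in> I \<Longrightarrow> a \<otimes> x \<in> I"
    using Im(1) unfolding left_ideal_iff by blast+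
  have K: "submodule ?K R (regular_module R)"
    unfolding left_ideal_iff using Ic r by (auto simp: l_distr m_assoc)
  moreover have "?K \<noteq> carrier R" using r by (metis (mono_tags, lifting) l_one mem_Collect_eq one_closed)
  moreover have "L = carrier R" if L: "submodule L R (regular_module R)" "?K \<subseteq> L" "L \<noteq> ?K" for L
  proof -
    have Lc: "L \<subseteq> carrier R" "\<zero> \<in> L" "\<And>x y. x \<in> L \<Longrightarrow> y \<in> L \<Longrightarrow> x \<oplus> y \<in> L"
      "\<And>a x. a \<in> carrier R \<Longrightarrow> x \<in> L \<Longrightarrow> a \<otimes> x \<in> L"
      using L(1) unfolding left_ideal_iff by blast+
    obtain l where l: "l \<in> L" "l \<in> carrier R" "l \<otimes> r \<notin> I" using L Lc(1) by blast
    \<comment> \<open>\<open>I + R l r\<close> is strictly larger than the maximal ideal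
      \<open>I\<close>, so it contains \<open>r\<close>, say \<open>r = i + s l r\<close>. Then
      \<open>1 - s l\<close> lies in \<open>?K\<close>, hence in \<open>L\<close>, and adding
      \<open>s l\<close> puts 1 into \<open>L\<close>.\<close>
    define G where "G = {i \<oplus> s \<otimes> (l \<otimes> r) | i s. i \<in> I \<and> s \<in> carrier R}"
    have GI: "i \<oplus> s \<otimes> (l \<otimes> r) \<in> G" if "i \<in> I" "s \<in> carrier R" for i s using that by (auto simp: G_def)
    have "submodule G R (regular_module R)"
      unfolding left_ideal_iff
    proof (intro conjI ballI)
      show "G \<subseteq> carrier R" using Ic(1) l r by (auto simp: G_def)
      show "\<zero> \<in> G" using GI[OF Ic(2) zero_closed] l r by simp
      fix x assume "x \<in> G"
      then obtain i s where x: "x = i \<oplus> s \<otimes> (l \<otimes> r)" "i \<in> I" "i \<in> carrier R" "s \<in> carrier R"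
        using Ic(1) by (auto simp: G_def)
      show "x \<oplus> y \<in> G" if yG: "y \<in> G" for y
      proof -
        obtain i' s' where y: "y = i' \<oplus> s' \<otimes> (l \<otimes> r)" "i' \<in> I" "i' \<in> carrier R" "s' \<in> carrier R"
          using yG Ic(1) by (auto simp: G_def)
        have "x \<oplus> y = (i \<oplus> i') \<oplus> (s \<oplus> s') \<otimes> (l \<otimes> r)"
          using x y l r by algebra
        then show ?thesis using x y by (simp add: GI Ic(3))
      qed
      show "a \<otimes> x \<in> G" if "a \<in> carrier R" for a
      proof -
        have "a \<otimes> x = a \<otimes> i \<oplus> (a \<otimes> s) \<otimes> (l \<otimes> r)"
          using x l r that by algebra
        then show ?thesis using x that by (simp add: GI Ic(4))
      qed
    qed
    moreover have "I \<subseteq> G" using GI[OF _ zero_closed] Ic(1) l r by force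
    moreover have "l \<otimes> r \<in> G" using GI[OF Ic(2) one_closed] l r by simp
    ultimately have "G = carrier R" using Im(2) l by blast
    then have "r \<in> G" using r by simp
    then obtain i s where s: "r = i \<oplus> s \<otimes> (l \<otimes> r)" "i \<in> I" "i \<in> carrier R" "s \<in> carrier R"
      using Ic(1) by (auto simp: G_def)
    have "(\<one> \<ominus> s \<otimes> l) \<otimes> r = r \<ominus> s \<otimes> (l \<otimes> r)" using s(4) l r by algebra
    also have "\<dots> = i" using s(3,4) l r by (subst s(1)) algebra
    finally have "\<one> \<ominus> s \<otimes> l \<in> L" using s l L(2) by auto
    then have "(\<one> \<ominus> s \<otimes> l) \<oplus> s \<otimes> l \<in> L" using Lc l s by blast
    also have "(\<one> \<ominus> s \<otimes> l) \<oplus> s \<otimes> l = \<one>" using s l by algebra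
    finally show ?thesis using L(1) by (rule left_ideal_one[rotated])
  qed
  ultimately show ?thesis unfolding maximal_left_ideal_def by blast
qed

text \<open>The radical is defined by left ideals, so only right multiples \<open>a x\<close> need
  an argument. For a maximal \<open>I\<close> not containing \<open>x\<close>, the product
  \<open>a x\<close> is in \<open>I\<close> when \<open>a\<close> is in the colon ideal of
  \<open>I\<close> by \<open>x\<close>, which is again maximal and so contains the radical.\<close>

lemma ideal_jacobson_radical: "ideal (jacobson_radical R) R"
proof (rule idealI[OF ring_axioms])
  let ?J = "jacobson_radical R"
  have Jmax: "I \<subseteq> carrier R \<and> \<zero> \<in> I \<and> (\<forall>x\<in>I. \<forall>y\<in>I. x \<oplus> y \<in> I) \<and> (\<forall>a\<in>carrier R. \<forall>x\<in>I. a \<otimes> x \<in> I)"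
    if "maximal_left_ideal R I" for I
    using that left_ideal_iff[of I] unfolding maximal_left_ideal_def by simp
  have J: "submodule ?J R (regular_module R)"
    unfolding left_ideal_iff jacobson_radical_def using Jmax by auto
  then show "subgroup ?J (add_monoid R)"
    using submodule.axioms(1)[OF J] by (simp add: subgroup_def regular_module_def a_inv_def m_inv_def)
  show "x \<otimes> a \<in> ?J" if "a \<in> ?J" "x \<in> carrier R" for a x
    using J that unfolding left_ideal_iff by blast
  show "a \<otimes> x \<in> ?J" if a: "a \<in> ?J" and x: "x \<in> carrier R" for a x
  proof -
    have ac: "a \<in> carrier R" using a by (simp add: jacobson_radical_def)
    have "a \<otimes> x \<in> I" if I: "maximal_left_ideal R I" for I
    proof (cases "x \<in> I")
      case True then show ?thesis using Jmax[OF I] ac by blast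
    next
      case False
      show ?thesis using a maximal_left_ideal_quotient[OF I x False] by (auto simp: jacobson_radical_def)
    qed
    then show ?thesis using ac x by (simp add: jacobson_radical_def)
  qed
qed

lemma jacobson_radical_subset_maximal: "maximal_left_ideal R I \<Longrightarrow> jacobson_radical R \<subseteq> I"
  by (auto simp: jacobson_radical_def)

text \<open>With \<open>1 = i + \<epsilon>\<close> along a decomposition \<open>R/J = I/J \<oplus> B\<close>, the product \<open>x \<epsilon>\<close> lies in
  \<open>I/J \<inter> B\<close> for \<open>x\<close> in \<open>I\<close>.\<close>
lemma semisimple_right_unit:
  assumes J: "ideal J R" and ss: "semisimple (R Quot J) (regular_module (R Quot J))"
    and I: "submodule I R (regular_module R)" and JI: "J \<subseteq> I"
  obtains i where "i \<in> I" "\<And>x. x \<in> I \<Longrightarrow> x \<ominus> x \<otimes> i \<in> J"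
proof -
  have Q0: "\<zero>\<^bsub>R Quot J\<^esub> = J" by (simp add: FactRing_def)
  interpret J: ideal J R by fact
  let ?Q = "R Quot J"
  interpret p: ring_hom_ring R ?Q "(+>) J" by (rule J.rcos_ring_hom_ring)
  have Ic: "I \<subseteq> carrier R" "\<zero> \<in> I" "\<And>x y. x \<in> I \<Longrightarrow> y \<in> I \<Longrightarrow> x \<oplus> y \<in> I"
    "\<And>a x. a \<in> carrier R \<Longrightarrow> x \<in> I \<Longrightarrow> a \<otimes> x \<in> I"
    using I unfolding left_ideal_iff by blast+
  have Qc: "\<exists>a\<in>carrier R. q = J +> a" if "q \<in> carrier ?Q" for q
    using that unfolding FactRing_def A_RCOSETS_def' partial_object.simps by blast
  have "submodule ((+>) J ` I) ?Q (regular_module ?Q)"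
    unfolding p.S.left_ideal_iff
  proof (intro conjI ballI)
    show "(+>) J ` I \<subseteq> carrier ?Q" using Ic(1) by auto
    show "\<zero>\<^bsub>?Q\<^esub> \<in> (+>) J ` I" using Ic(2) p.hom_zero by (metis imageI)
    fix q assume "q \<in> (+>) J ` I"
    then obtain x where x: "q = J +> x" "x \<in> I" "x \<in> carrier R" using Ic(1) by auto
    show "q \<oplus>\<^bsub>?Q\<^esub> q' \<in> (+>) J ` I" if q': "q' \<in> (+>) J ` I" for q'
    proof -
      obtain y where y: "q' = J +> y" "y \<in> I" "y \<in> carrier R" using q' Ic(1) by auto
      then have "q \<oplus>\<^bsub>?Q\<^esub> q' = J +> (x \<oplus> y)" using x by simp
      then show ?thesis using x y Ic(3) by blast
    qed
    show "a \<otimes>\<^bsub>?Q\<^esub> q \<in> (+>) J ` I" if "a \<in> carrier ?Q" for a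
    proof -
      obtain y where y: "a = J +> y" "y \<in> carrier R" using Qc \<open>a \<in> _\<close> by auto
      then have "a \<otimes>\<^bsub>?Q\<^esub> q = J +> (y \<otimes> x)" using x by simp
      then show ?thesis using x y Ic(4) by blast
    qed
  qed
  then obtain B where B: "direct_decomp ?Q (regular_module ?Q) ((+>) J ` I) B"
    using ss unfolding semisimple_def by blast
  have "\<one>\<^bsub>?Q\<^esub> \<in> (+>) J ` I <+>\<^bsub>regular_module ?Q\<^esub> B"
    using B unfolding direct_decomp_def by (simp add: regular_module_def)
  then obtain i b where i: "i \<in> I" "b \<in> B" "\<one>\<^bsub>?Q\<^esub> = (J +> i) \<oplus>\<^bsub>?Q\<^esub> b"
    by (auto simp: set_add_def set_mult_def regular_module_def)
  have "submodule B ?Q (regular_module ?Q)" using B unfolding direct_decomp_def by blast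
  then have Bs: "B \<subseteq> carrier ?Q" "\<And>a x. a \<in> carrier ?Q \<Longrightarrow> x \<in> B \<Longrightarrow> a \<otimes>\<^bsub>?Q\<^esub> x \<in> B"
    unfolding p.S.left_ideal_iff by blast+
  have ic: "i \<in> carrier R" and bc: "b \<in> carrier ?Q" using i Ic(1) Bs(1) by auto
  have "c = (a \<oplus>\<^bsub>?Q\<^esub> c) \<ominus>\<^bsub>?Q\<^esub> a" if "a \<in> carrier ?Q" "c \<in> carrier ?Q" for a c
    using that by algebra
  from this[OF p.hom_closed[OF ic] bc] have b: "b = \<one>\<^bsub>?Q\<^esub> \<ominus>\<^bsub>?Q\<^esub> (J +> i)"
    by (simp only: i(3))
  have "x \<ominus> x \<otimes> i \<in> J" if x: "x \<in> I" for x
  proof -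
    have xc: "x \<in> carrier R" using x Ic(1) by blast
    have "x \<ominus> x \<otimes> i = x \<otimes> (\<one> \<ominus> i)" using xc ic by (simp add: a_minus_def r_distr r_minus)
    then have "J +> (x \<ominus> x \<otimes> i) = (J +> x) \<otimes>\<^bsub>?Q\<^esub> (J +> (\<one> \<ominus> i))" using xc ic by simp
    also have "J +> (\<one> \<ominus> i) = \<one>\<^bsub>?Q\<^esub> \<ominus>\<^bsub>?Q\<^esub> (J +> i)"
      using ic by (simp add: a_minus_def)
    also have "(J +> x) \<otimes>\<^bsub>?Q\<^esub> \<dots> \<in> B" using Bs(2)[OF p.hom_closed[OF xc] i(2)] by (simp only: b)
    finally have "J +> (x \<ominus> x \<otimes> i) \<in> B" .
    moreover have "x \<ominus> x \<otimes> i \<in> I" using left_ideal_minus[OF I x Ic(4)[OF xc i(1)]] .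
    moreover have "((+>) J ` I) \<inter> B = {\<zero>\<^bsub>?Q\<^esub>}"
      using B unfolding direct_decomp_def by (simp add: regular_module_def)
    ultimately have "J +> (x \<ominus> x \<otimes> i) = \<zero>\<^bsub>?Q\<^esub>" by blast
    then have "J +> (x \<ominus> x \<otimes> i) = J" by (simp only: Q0)
    then show ?thesis by (rule J.rcos_const_imp_mem[rotated]) (use xc ic in simp)
  qed
  then show ?thesis using that i(1) by blast
qed

section \<open>Lifting idempotents\<close>

text \<open>The inverse is the geometric sum 1 + j + ... + j^(n-1), for which
  \<open>(1 - j) v\<close> telescopes to \<open>1 - j^n\<close>.\<close>

lemma nilpotent_right_inverse:
  assumes j: "j \<in> carrier R" and n: "j [^] (n::nat) = \<zero>"
  obtains v where "v \<in> carrier R" "(\<one> \<ominus> j) \<otimes> v = \<one>"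
proof -
  have "\<exists>v\<in>carrier R. (\<one> \<ominus> j) \<otimes> v = \<one> \<ominus> j [^] k" for k :: nat
  proof (induction k)
    case 0
    show ?case using j by (intro bexI[of _ \<zero>]) (simp_all add: a_minus_def r_neg)
  next
    case (Suc k)
    then obtain v where v: "v \<in> carrier R" "(\<one> \<ominus> j) \<otimes> v = \<one> \<ominus> j [^] k" by blast
    define q where "q = j [^] k"
    have q: "q \<in> carrier R" "j [^] Suc k = j \<otimes> q"
      using j nat_pow_Suc2[OF j, of k] by (simp_all add: q_def)
    have "(\<one> \<ominus> j) \<otimes> (v \<oplus> q) = (\<one> \<ominus> j) \<otimes> v \<oplus> (\<one> \<ominus> j) \<otimes> q"
      using v(1) j q(1) by (simp add: r_distr)
    also have "\<dots> = \<one> \<ominus> j \<otimes> q" unfolding v(2) q_def[symmetric] using j q(1) by algebra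
    finally show ?case using v q by (intro bexI[of _ "v \<oplus> q"]) (simp_all add: q(2))
  qed
  from this[of n] show ?thesis using n that by (auto simp: a_minus_def)
qed

text \<open>For \<open>(a - a\<^sup>2)\<^sup>n = a\<^sup>n (1 - a c) = 0\<close> with \<open>c\<close> commuting with \<open>a\<close>, the element \<open>(a c)\<^sup>n\<close> is
  idempotent.\<close>
lemma lift_idempotent:
  assumes J: "ideal J R" and nil: "\<And>j. j \<in> J \<Longrightarrow> \<exists>n::nat. j [^] n = \<zero>"
    and a: "a \<in> carrier R" "a \<ominus> a \<otimes> a \<in> J"
  obtains e where "is_idempotent R e" "e \<ominus> a \<in> J"
proof -
  have "\<exists>c\<in>carrier R. c \<otimes> a = a \<otimes> c \<and> (a \<ominus> a \<otimes> a) [^] n = a [^] n \<otimes> (\<one> \<ominus> a \<otimes> c)" for n :: nat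
  proof (induction n)
    case 0
    show ?case using a(1) by (intro bexI[of _ \<zero>]) (simp_all add: a_minus_def)
  next
    case (Suc n)
    then obtain c where c: "c \<in> carrier R" "c \<otimes> a = a \<otimes> c"
      "(a \<ominus> a \<otimes> a) [^] n = a [^] n \<otimes> (\<one> \<ominus> a \<otimes> c)" by blast
    define q where "q = a [^] n"
    have q: "q \<in> carrier R" using a(1) by (simp add: q_def)
    \<comment> \<open>Read off from \<open>(1 - a c)(1 - a) = 1 - a (1 + c - a c)\<close>, where
      \<open>c\<close> commutes with \<open>a\<close>.\<close>
    define c' where "c' = \<one> \<oplus> c \<ominus> a \<otimes> c"
    have c': "c' \<in> carrier R" using c a(1) by (simp add: c'_def)
    have "c' \<otimes> a = a \<oplus> c \<otimes> a \<ominus> a \<otimes> (c \<otimes> a)" unfolding c'_def using c(1) a(1) by (simp add: a_minus_def r_distr l_distr r_minus l_minus minus_add m_assoc a_ac r_neg1 r_neg2 r_neg)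
    also have "\<dots> = a \<otimes> c'" unfolding c(2) c'_def using c(1) a(1) by (simp add: a_minus_def r_distr l_distr r_minus l_minus minus_add m_assoc a_ac r_neg1 r_neg2 r_neg)
    finally have comm: "c' \<otimes> a = a \<otimes> c'" .
    have "(a \<ominus> a \<otimes> a) [^] Suc n = q \<otimes> (\<one> \<ominus> a \<otimes> c) \<otimes> (a \<ominus> a \<otimes> a)"
      using c(3) by (simp add: q_def)
    also have "\<dots> = q \<otimes> (a \<ominus> a \<otimes> a \<ominus> a \<otimes> (c \<otimes> a) \<oplus> a \<otimes> (c \<otimes> a) \<otimes> a)"
      using q c(1) a(1) by (simp add: a_minus_def r_distr l_distr r_minus l_minus minus_add m_assoc a_ac r_neg1 r_neg2 r_neg)
    also have "\<dots> = q \<otimes> (a \<ominus> a \<otimes> a \<ominus> a \<otimes> (a \<otimes> c) \<oplus> a \<otimes> (a \<otimes> (c \<otimes> a)))"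
      unfolding c(2) using a(1) c(1) by (simp add: m_assoc c(2))
    also have "\<dots> = q \<otimes> (a \<ominus> a \<otimes> a \<ominus> a \<otimes> (a \<otimes> c) \<oplus> a \<otimes> (a \<otimes> (a \<otimes> c)))"
      by (simp only: c(2))
    also have "\<dots> = q \<otimes> a \<otimes> (\<one> \<ominus> a \<otimes> c')"
      unfolding c'_def using q c(1) a(1) by (simp add: a_minus_def r_distr l_distr r_minus l_minus minus_add m_assoc a_ac r_neg1 r_neg2 r_neg)
    finally show ?case using c' comm by (intro bexI[of _ c']) (simp_all add: q_def)
  qed
  moreover obtain n :: nat where "(a \<ominus> a \<otimes> a) [^] n = \<zero>" using nil[OF a(2)] by blast
  \<comment> \<open>The exponent is made positive because only positive powers of \<open>a\<close>
    agree with \<open>a\<close> modulo \<open>J\<close>, which the comparison of \<open>e\<close>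
    with \<open>a\<close> requires.\<close>
  then have n: "(a \<ominus> a \<otimes> a) [^] Suc n = \<zero>" using a(1) by simp
  ultimately obtain c where c: "c \<in> carrier R" "c \<otimes> a = a \<otimes> c" "a [^] Suc n \<otimes> (\<one> \<ominus> a \<otimes> c) = \<zero>"
    by metis
  define f where "f = a \<otimes> c"
  define b where "b = a [^] Suc n"
  define d where "d = c [^] Suc n"
  have cl: "f \<in> carrier R" "b \<in> carrier R" "d \<in> carrier R" using a c by (auto simp: f_def b_def d_def)
  have "b = b \<otimes> (\<one> \<ominus> f) \<oplus> b \<otimes> f" using cl by (simp add: a_minus_def r_distr l_distr r_minus l_minus minus_add m_assoc a_ac r_neg1 r_neg2 r_neg)
  then have bf: "b \<otimes> f = b" using c(3) cl by (simp add: b_def f_def)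
  have bfk: "b \<otimes> f [^] k = b" for k :: nat
    by (induction k) (use cl bf in \<open>simp_all add: m_assoc[symmetric]\<close>)
  \<comment> \<open>From \<open>b f = b\<close> follows \<open>b e = b\<close>. Since
    \<open>e = b d\<close> and \<open>e\<close> commutes with \<open>d\<close>, this gives
    \<open>e e = b d e = b e d = b d = e\<close>.\<close>
  define e where "e = f [^] Suc n"
  have "f [^] Suc n = b \<otimes> d"
    unfolding f_def b_def d_def by (rule pow_mult_distrib[OF c(2)[symmetric] a(1) c(1)])
  then have e: "e \<in> carrier R" "e = b \<otimes> d" "b \<otimes> e = b"
    using cl bfk[of "Suc n"] by (simp_all only: e_def m_closed)
  have "f \<otimes> c = c \<otimes> f" using a c by (simp add: f_def m_assoc[symmetric])
  then have "f \<otimes> d = d \<otimes> f"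
    using group_commutes_pow[of c f "Suc n"] cl c by (simp add: d_def)
  then have ed: "e \<otimes> d = d \<otimes> e" using group_commutes_pow[of f d "Suc n"] cl by (simp add: e_def)
  have "e = b \<otimes> e \<otimes> d" using e by simp
  also have "\<dots> = b \<otimes> d \<otimes> e" using e(1) cl ed by (simp add: m_assoc)
  finally have "e \<otimes> e = e" by (simp flip: e(2))
  interpret J: ideal J R by fact
  interpret p: ring_hom_ring R "R Quot J" "(+>) J" by (rule J.rcos_ring_hom_ring)
  let ?p = "\<lambda>x. J +> x"
  note eq = quotient_eq_iff_same_a_r_cos[OF J]
  have A: "?p a \<otimes>\<^bsub>R Quot J\<^esub> ?p a = ?p a"
    using eq[of a "a \<otimes> a"] a by simp
  have ak: "?p (a [^] Suc k) = ?p a" for k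
    by (induction k) (use a(1) A in simp_all)
  \<comment> \<open>Modulo \<open>J\<close> the equation \<open>b f = b\<close> reads
    \<open>a f = a\<close>, while \<open>a f = a a c = a c = f\<close>. So \<open>f\<close> is
    congruent to \<open>a\<close>, and hence so is its positive power \<open>e\<close>.\<close>
  have "?p a = ?p b" using ak by (simp only: b_def)
  also have "\<dots> = ?p (b \<otimes> f)" by (simp only: bf)
  also have "\<dots> = ?p b \<otimes>\<^bsub>R Quot J\<^esub> ?p f" using cl by simp
  also have "?p b = ?p a" using ak by (simp only: b_def)
  also have "?p a \<otimes>\<^bsub>R Quot J\<^esub> ?p f = ?p a \<otimes>\<^bsub>R Quot J\<^esub> ?p a \<otimes>\<^bsub>R Quot J\<^esub> ?p c"
    using a(1) c(1) by (simp add: f_def p.S.m_assoc)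
  also have "\<dots> = ?p f" using a(1) c(1) by (simp add: A f_def)
  finally have f: "?p f = ?p a" by simp
  have "?p (f [^] Suc k) = ?p a" for k
    by (induction k) (use cl f A in simp_all)
  then have "e \<ominus> a \<in> J" using eq[of e a] e(1) a(1) by (simp only: e_def)
  then show ?thesis using that[of e] e(1) \<open>e \<otimes> e = e\<close> by (simp add: is_idempotent_def)
qed

lemma left_T_nilpotent_imp_nilpotent:
  assumes "left_T_nilpotent R J" "j \<in> J" "J \<subseteq> carrier R"
  shows "\<exists>n::nat. j [^] n = \<zero>"
proof -
  have "initial_prod R (\<lambda>_. j) n = j [^] n" for n by (induction n) auto
  then show ?thesis using assms unfolding left_T_nilpotent_def by (metis (full_types))
qed


section \<open>Idempotents generating local right ideals\<close>

text \<open>Says that the right ideal \<open>e R\<close> is local, with largest proper submodule \<open>e J\<close>.\<close>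
definition local_idempotent :: "'a \<Rightarrow> bool" where
  "local_idempotent e \<longleftrightarrow> is_idempotent R e \<and> e \<notin> jacobson_radical R \<and>
     (\<forall>y\<in>carrier R. e \<otimes> y \<notin> jacobson_radical R \<longrightarrow> (\<exists>r\<in>carrier R. e \<otimes> y \<otimes> r = e))"

text \<open>Modulo \<open>J\<close> the left ideal \<open>I\<close> has a right unit
  \<open>i\<close>, so \<open>\<epsilon> = 1 - i\<close> is idempotent there with
  \<open>I \<epsilon> = 0\<close>, and \<open>e\<close> lifts it. Maximality of \<open>I\<close>
  concerns left ideals, whereas locality concerns the right ideal \<open>e R\<close>. The passage
  between the sides compares the left annihilator of \<open>\<epsilon> y\<close> with
  \<open>I\<close>.\<close>

lemma ex_local_idempotent:
  assumes lp: "left_perfect R" and I: "maximal_left_ideal R I"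
  obtains e where "local_idempotent e" "e \<notin> I"
proof -
  let ?J = "jacobson_radical R"
  have J: "ideal ?J R" by (rule ideal_jacobson_radical)
  have ss: "semisimple (R Quot ?J) (regular_module (R Quot ?J))" and T: "left_T_nilpotent R ?J"
    using lp by (auto simp: left_perfect_def)
  have Jc: "?J \<subseteq> carrier R" by (auto simp: jacobson_radical_def)
  note nil = left_T_nilpotent_imp_nilpotent[OF T _ Jc]
  note Jl = ideal.I_l_closed[OF J] and Jr = ideal.I_r_closed[OF J]
    and Ja = additive_subgroup.a_closed[OF ideal.axioms(1)[OF J]]
  have JL: "submodule ?J R (regular_module R)"
    unfolding left_ideal_iff using Jc Jl Ja additive_subgroup.zero_closed[OF ideal.axioms(1)[OF J]] by blast
  have Jm: "x \<ominus> y \<in> ?J" if "x \<in> ?J" "y \<in> ?J" for x y by (rule left_ideal_minus[OF JL that])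
  have JI: "?J \<subseteq> I" by (rule jacobson_radical_subset_maximal[OF I])
  have IL: "submodule I R (regular_module R)" and I1: "\<one> \<notin> I"
    and Imax: "\<And>L. submodule L R (regular_module R) \<Longrightarrow> I \<subseteq> L \<Longrightarrow> L = I \<or> L = carrier R"
    using I left_ideal_one[of I] unfolding maximal_left_ideal_def by auto
  have Ic: "I \<subseteq> carrier R" "\<And>x y. x \<in> I \<Longrightarrow> y \<in> I \<Longrightarrow> x \<oplus> y \<in> I"
    using IL unfolding left_ideal_iff by auto
  obtain i where i: "i \<in> I" "\<And>x. x \<in> I \<Longrightarrow> x \<ominus> x \<otimes> i \<in> ?J"
    using semisimple_right_unit[OF J ss IL JI] by blast
  have ic: "i \<in> carrier R" using i(1) Ic(1) by blast
  define \<epsilon> where "\<epsilon> = \<one> \<ominus> i"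
  have \<epsilon>: "\<epsilon> \<in> carrier R" using ic by (simp add: \<epsilon>_def)
  have I\<epsilon>: "x \<otimes> \<epsilon> \<in> ?J" if "x \<in> I" for x
  proof -
    have "x \<in> carrier R" using that Ic(1) by blast
    then have "x \<otimes> \<epsilon> = x \<ominus> x \<otimes> i"
      using ic by (simp add: \<epsilon>_def a_minus_def r_distr r_minus)
    then show ?thesis using i(2)[OF that] by simp
  qed
  have "\<epsilon> \<ominus> \<epsilon> \<otimes> \<epsilon> = i \<otimes> \<epsilon>"
    using ic by (simp add: \<epsilon>_def a_minus_def r_distr l_distr r_minus l_minus) algebra
  then have "\<epsilon> \<ominus> \<epsilon> \<otimes> \<epsilon> \<in> ?J" using I\<epsilon>[OF i(1)] by simp
  then obtain e where e: "is_idempotent R e" and e\<epsilon>: "e \<ominus> \<epsilon> \<in> ?J"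
    using lift_idempotent[OF J nil \<epsilon>] by blast
  have ec: "e \<in> carrier R" "e \<otimes> e = e" using e by (auto simp: is_idempotent_def)
  have eI: "e \<notin> I"
  proof
    assume "e \<in> I"
    then have "i \<oplus> (e \<ominus> (e \<ominus> \<epsilon>)) \<in> I"
      using i(1) e\<epsilon> JI left_ideal_minus[OF IL] Ic(2) by blast
    also have "i \<oplus> (e \<ominus> (e \<ominus> \<epsilon>)) = \<one>"
      using ic ec unfolding \<epsilon>_def by algebra
    finally show False using I1 by simp
  qed
  have "\<exists>r\<in>carrier R. e \<otimes> y \<otimes> r = e" if y: "y \<in> carrier R" and ey: "e \<otimes> y \<notin> ?J" for y
  proof -
    define c where "c = \<epsilon> \<otimes> y"
    have c: "c \<in> carrier R" using \<epsilon> y by (simp add: c_def)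
    have "e \<otimes> y = (e \<ominus> \<epsilon>) \<otimes> y \<oplus> c"
      using \<epsilon> y ec by (simp add: c_def a_minus_def l_distr l_minus) algebra
    then have cJ: "c \<notin> ?J" using ey Ja[OF Jr[OF e\<epsilon> y]] by metis
    \<comment> \<open>The left annihilator of \<open>c\<close> modulo \<open>J\<close> contains
      \<open>I\<close> but not 1, so it is \<open>I\<close>. Thus whatever kills \<open>c\<close>
      from the left modulo \<open>J\<close> also kills \<open>\<epsilon>\<close>.\<close>
    define K where "K = {r \<in> carrier R. r \<otimes> c \<in> ?J}"
    have "submodule K R (regular_module R)"
      using JL c unfolding left_ideal_iff K_def by (simp add: l_distr m_assoc)
    moreover have "I \<subseteq> K"
    proof
      fix x assume "x \<in> I"
      then show "x \<in> K" using Jr[OF I\<epsilon> y, of x] Ic(1) \<epsilon> y by (auto simp: K_def c_def m_assoc)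
    qed
    moreover have "\<one> \<notin> K" using c cJ by (simp add: K_def)
    ultimately have KI: "K = I" using Imax[of K] by auto
    \<comment> \<open>Semisimplicity gives \<open>R c + J\<close> a right unit
      \<open>k = z c + j\<close> modulo \<open>J\<close>. From \<open>c - c k\<close> in
      \<open>J\<close> follows \<open>(1 - c z) c\<close> in \<open>J\<close>, so
      \<open>1 - c z\<close> lies in \<open>K = I\<close>. The factor \<open>z\<close> is the
      inverse of \<open>c\<close> sought on the right, up to \<open>J\<close>.\<close>
    define L where "L = {s \<otimes> c \<oplus> j | s j. s \<in> carrier R \<and> j \<in> ?J}"
    have LI: "s \<otimes> c \<oplus> j \<in> L" if "s \<in> carrier R" "j \<in> ?J" for s j using that by (auto simp: L_def)
    have "submodule L R (regular_module R)"
      unfolding left_ideal_iff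
    proof (intro conjI ballI)
      show "L \<subseteq> carrier R" using Jc c by (auto simp: L_def)
      show "\<zero> \<in> L" using LI[of \<zero> \<zero>] JL c unfolding left_ideal_iff by simp
      fix x assume "x \<in> L"
      then obtain s j where x: "x = s \<otimes> c \<oplus> j" "s \<in> carrier R" "j \<in> ?J" by (auto simp: L_def)
      note xc = x(2) subsetD[OF Jc x(3)]
      show "x \<oplus> z \<in> L" if zL: "z \<in> L" for z
      proof -
        obtain s' j' where z: "z = s' \<otimes> c \<oplus> j'" "s' \<in> carrier R" "j' \<in> ?J" using zL by (auto simp: L_def)
        note zc = z(2) subsetD[OF Jc z(3)]
        have "x \<oplus> z = (s \<oplus> s') \<otimes> c \<oplus> (j \<oplus> j')"
          using xc zc c by (simp add: x(1) z(1) l_distr a_ac)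
        then show ?thesis using LI[of "s \<oplus> s'" "j \<oplus> j'"] x z Ja by simp
      qed
      show "a \<otimes> x \<in> L" if "a \<in> carrier R" for a
      proof -
        have "a \<otimes> x = (a \<otimes> s) \<otimes> c \<oplus> a \<otimes> j"
          using xc c that by (simp add: x(1) r_distr m_assoc)
        then show ?thesis using LI[of "a \<otimes> s" "a \<otimes> j"] x that Jl by simp
      qed
    qed
    moreover have "?J \<subseteq> L"
    proof
      fix j assume "j \<in> ?J"
      then show "j \<in> L" using LI[of \<zero> j] c Jc by auto
    qed
    ultimately obtain k where k: "k \<in> L" "\<And>x. x \<in> L \<Longrightarrow> x \<ominus> x \<otimes> k \<in> ?J"
      using semisimple_right_unit[OF J ss] by blast
    obtain z j where zj: "k = z \<otimes> c \<oplus> j" "z \<in> carrier R" "j \<in> ?J" using k(1) by (auto simp: L_def)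
    note jc = subsetD[OF Jc zj(3)]
    have "c \<in> L" using LI[of \<one> \<zero>] JL c unfolding left_ideal_iff by simp
    then have "(c \<ominus> c \<otimes> k) \<oplus> c \<otimes> j \<in> ?J" using k(2) Jl[OF zj(3) c] Ja by blast
    also have "(c \<ominus> c \<otimes> k) \<oplus> c \<otimes> j = (\<one> \<ominus> c \<otimes> z) \<otimes> c"
      using zj(2) jc c
      by (simp add: zj(1) a_minus_def r_distr l_distr l_minus m_assoc) algebra
    finally have "\<one> \<ominus> c \<otimes> z \<in> K" using c zj(2) by (simp add: K_def)
    then have "(\<one> \<ominus> c \<otimes> z) \<otimes> \<epsilon> \<in> ?J" using I\<epsilon> KI by simp
    \<comment> \<open>All three terms lie in \<open>J\<close>. Since
      \<open>c = \<epsilon> y\<close>, everything with \<open>\<epsilon>\<close> in the leftmost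
      place cancels, leaving the congruence for the true idempotent \<open>e\<close> in place of
      \<open>\<epsilon>\<close>.\<close>
    then have "(e \<ominus> \<epsilon>) \<oplus> (\<one> \<ominus> c \<otimes> z) \<otimes> \<epsilon> \<ominus> (e \<ominus> \<epsilon>) \<otimes> (y \<otimes> z \<otimes> \<epsilon>) \<in> ?J"
      using Ja[OF e\<epsilon>] Jr[OF e\<epsilon>] Jm y zj(2) \<epsilon> by simp
    also have "(e \<ominus> \<epsilon>) \<oplus> (\<one> \<ominus> c \<otimes> z) \<otimes> \<epsilon> \<ominus> (e \<ominus> \<epsilon>) \<otimes> (y \<otimes> z \<otimes> \<epsilon>) = e \<ominus> e \<otimes> y \<otimes> (z \<otimes> \<epsilon>)"
      using ec(1) y zj(2) \<epsilon>
      by (simp add: c_def a_minus_def r_distr l_distr l_minus r_minus m_assoc) algebra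
    finally have jJ: "e \<ominus> e \<otimes> y \<otimes> (z \<otimes> \<epsilon>) \<in> ?J" .
    define r where "r = z \<otimes> \<epsilon>"
    \<comment> \<open>The error is multiplied by \<open>e\<close> on the right so that
      \<open>e y r e = e (1 - j')\<close> holds exactly. A right inverse of \<open>1 - j'\<close>
      then turns the congruence into the required equation.\<close>
    define j' where "j' = (e \<ominus> e \<otimes> y \<otimes> r) \<otimes> e"
    have r: "r \<in> carrier R" using zj(2) \<epsilon> by (simp add: r_def)
    have j': "j' \<in> ?J" "j' \<in> carrier R"
      using jJ Jr ec(1) r y unfolding j'_def r_def[symmetric] by simp_all
    obtain v where v: "v \<in> carrier R" "(\<one> \<ominus> j') \<otimes> v = \<one>"
      using nil[OF j'(1)] nilpotent_right_inverse[OF j'(2)] by metis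
    have ee: "e \<otimes> (e \<otimes> x) = e \<otimes> x" if "x \<in> carrier R" for x
      using ec that by (simp flip: m_assoc)
    have "e \<otimes> y \<otimes> (r \<otimes> e) = e \<otimes> (\<one> \<ominus> j')"
      unfolding j'_def using ec y r
      by (simp add: a_minus_def r_distr l_distr l_minus r_minus m_assoc ee) algebra
    then have "e \<otimes> y \<otimes> (r \<otimes> e) \<otimes> v = e \<otimes> ((\<one> \<ominus> j') \<otimes> v)"
      using ec v j'(2) by (simp add: m_assoc)
    then have "e \<otimes> y \<otimes> (r \<otimes> e \<otimes> v) = e" using ec y r v by (simp add: m_assoc)
    then show ?thesis using r ec v by (intro bexI[of _ "r \<otimes> e \<otimes> v"]) simp_all
  qed
  then have "local_idempotent e"
    using e eI JI unfolding local_idempotent_def by blast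
  then show ?thesis using that eI by blast
qed
end

section \<open>Additive spans\<close>

text \<open>Only sums of elements of \<open>A\<close> are formed. When \<open>A\<close> is closed
  under scalars, negatives come from \<open>\<ominus>\<one>\<close>, and inductions have just two
  cases.\<close>

inductive_set add_span :: "('a, 'b, 'm) module_scheme \<Rightarrow> 'b set \<Rightarrow> 'b set" for U A where
  zero: "\<zero>\<^bsub>U\<^esub> \<in> add_span U A"
| add: "a \<in> A \<Longrightarrow> x \<in> add_span U A \<Longrightarrow> a \<oplus>\<^bsub>U\<^esub> x \<in> add_span U A"

context left_module
begin

lemma add_span_closed:
  assumes "x \<in> add_span M A" "A \<subseteq> carrier M"
  shows "x \<in> carrier M"
  using assms by (induction rule: add_span.induct) auto

lemma add_span_base: "a \<in> A \<Longrightarrow> A \<subseteq> carrier M \<Longrightarrow> a \<in> add_span M A"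
  using add_span.add[of a A "\<zero>\<^bsub>M\<^esub>" M] add_span.zero[of M A] by auto

lemma submodule_add_span:
  assumes A: "A \<subseteq> carrier M" and sm: "\<And>r a. r \<in> carrier R \<Longrightarrow> a \<in> A \<Longrightarrow> r \<odot>\<^bsub>M\<^esub> a \<in> A"
  shows "submodule (add_span M A) R M"
  unfolding submodule_iff
proof (intro conjI ballI)
  show "add_span M A \<subseteq> carrier M" using add_span_closed A by blast
  show "\<zero>\<^bsub>M\<^esub> \<in> add_span M A" by (rule add_span.zero)
  fix x assume x: "x \<in> add_span M A"
  show "x \<oplus>\<^bsub>M\<^esub> y \<in> add_span M A" if y: "y \<in> add_span M A" for y
    using x
  proof induction
    case zero
    then show ?case using add_span_closed[OF y A] y by simp
  next
    case (add a x)
    then show ?case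
      using add_span.add[OF add(1,3)] add_span_closed[OF y A] add_span_closed[OF add(2) A] A
      by (simp add: M.a_assoc subset_iff)
  qed
  show "r \<odot>\<^bsub>M\<^esub> x \<in> add_span M A" if r: "r \<in> carrier R" for r
    using x
  proof induction
    case zero
    then show ?case using r by (simp add: smult_r_null add_span.zero)
  next
    case (add a x)
    then show ?case
      using add_span.add[OF sm[OF r add(1)] add(3)] add_span_closed[OF add(2) A] A r
      by (simp add: smult_r_distr subset_iff)
  qed
qed

end

lemma add_span_mono:
  assumes "x \<in> add_span U A" "A \<subseteq> B"
  shows "x \<in> add_span U B"
  using assms by (induction rule: add_span.induct) (auto intro: add_span.intros)

text \<open>Over a left T-nilpotent set \<open>J\<close>, Nakayama's lemma holds without a finiteness condition.\<close>
lemma left_T_nilpotent_nakayama: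
  assumes N: "left_module R N" and T: "left_T_nilpotent R J" and J: "J \<subseteq> carrier R"
    and X: "X \<subseteq> carrier N" and XJ: "X \<subseteq> add_span N {j \<odot>\<^bsub>N\<^esub> x | j x. j \<in> J \<and> x \<in> X}"
  shows "X \<subseteq> {\<zero>\<^bsub>N\<^esub>}"
proof (rule ccontr)
  interpret N: left_module R N by fact
  let ?Y = "{j \<odot>\<^bsub>N\<^esub> x | j x. j \<in> J \<and> x \<in> X}"
  have Y: "?Y \<subseteq> carrier N" using J X by auto
  assume "\<not> X \<subseteq> {\<zero>\<^bsub>N\<^esub>}"
  then obtain x0 where x0: "x0 \<in> X" "x0 \<noteq> \<zero>\<^bsub>N\<^esub>" by auto
  \<comment> \<open>The state is a product \<open>a\<close> of elements of \<open>J\<close> together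
    with an \<open>x\<close> in \<open>X\<close> such that \<open>a x\<close> is not zero. Writing
    \<open>x\<close> as a sum of terms \<open>j y\<close> yields a nonzero \<open>a j y\<close> and
    the next state \<open>(a j, y)\<close>. New factors enter on the right, as in
    \<open>initial_prod\<close>, so T-nilpotence on the left forbids an infinite run.\<close>
  let ?P = "\<lambda>(a, x). a \<in> carrier R \<and> x \<in> X \<and> a \<odot>\<^bsub>N\<^esub> x \<noteq> \<zero>\<^bsub>N\<^esub>"
  have "\<exists>s. \<forall>n. (?P (s n) \<and> (n = 0 \<longrightarrow> fst (s n) = \<one>\<^bsub>R\<^esub>)) \<and> (\<exists>j\<in>J. fst (s (Suc n)) = fst (s n) \<otimes>\<^bsub>R\<^esub> j)"
  proof (rule dependent_nat_choice)
    show "\<exists>s. ?P s \<and> (0 = (0::nat) \<longrightarrow> fst s = \<one>\<^bsub>R\<^esub>)"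
      using x0 X by (intro exI[of _ "(\<one>\<^bsub>R\<^esub>, x0)"]) auto
    fix s n assume "?P s \<and> (n = (0::nat) \<longrightarrow> fst s = \<one>\<^bsub>R\<^esub>)"
    then obtain a x where s: "s = (a, x)" "a \<in> carrier R" "x \<in> X" "a \<odot>\<^bsub>N\<^esub> x \<noteq> \<zero>\<^bsub>N\<^esub>" by (cases s) auto
    have "\<exists>y\<in>?Y. a \<odot>\<^bsub>N\<^esub> y \<noteq> \<zero>\<^bsub>N\<^esub>"
    proof (rule ccontr)
      assume *: "\<not> ?thesis"
      have "a \<odot>\<^bsub>N\<^esub> y = \<zero>\<^bsub>N\<^esub>" if "y \<in> add_span N ?Y" for y
        using that
      proof induction
        case zero
        then show ?case using s by (simp add: N.smult_r_null)
      next
        case (add b y)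
        then have "b \<in> carrier N" "y \<in> carrier N" "a \<odot>\<^bsub>N\<^esub> b = \<zero>\<^bsub>N\<^esub>"
          using Y N.add_span_closed[OF _ Y] * by blast+
        then show ?case using add s(2) by (simp add: N.smult_r_distr)
      qed
      then show False using s XJ by blast
    qed
    then obtain j y where "j \<in> J" "y \<in> X" "a \<odot>\<^bsub>N\<^esub> (j \<odot>\<^bsub>N\<^esub> y) \<noteq> \<zero>\<^bsub>N\<^esub>" by auto
    then show "\<exists>s'. (?P s' \<and> (Suc n = 0 \<longrightarrow> fst s' = \<one>\<^bsub>R\<^esub>)) \<and> (\<exists>j\<in>J. fst s' = fst s \<otimes>\<^bsub>R\<^esub> j)"
      using s J X by (intro exI[of _ "(a \<otimes>\<^bsub>R\<^esub> j, y)"]) (auto simp: N.smult_assoc1 subset_iff)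
  qed
  then obtain s where *: "\<forall>n. (?P (s n) \<and> (n = 0 \<longrightarrow> fst (s n) = \<one>\<^bsub>R\<^esub>)) \<and>
    (\<exists>j\<in>J. fst (s (Suc n)) = fst (s n) \<otimes>\<^bsub>R\<^esub> j)" by (elim exE)
  then have s: "\<And>n. ?P (s n)" "fst (s 0) = \<one>\<^bsub>R\<^esub>"
    "\<And>n. \<exists>j\<in>J. fst (s (Suc n)) = fst (s n) \<otimes>\<^bsub>R\<^esub> j" by simp_all
  then obtain j where j: "\<And>n. j n \<in> J" "\<And>n. fst (s (Suc n)) = fst (s n) \<otimes>\<^bsub>R\<^esub> j n" by metis
  have "initial_prod R j n = fst (s n)" for n
    by (induction n) (simp_all add: s(2) j(2))
  moreover obtain n where "initial_prod R j n = \<zero>\<^bsub>R\<^esub>"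
    using T j(1) unfolding left_T_nilpotent_def by blast
  ultimately have "fst (s n) = \<zero>\<^bsub>R\<^esub>" by simp
  then show False using s(1)[of n] X N.smult_l_null by (auto simp: case_prod_beta)
qed

section \<open>Homomorphisms and projective modules\<close>

lemma mod_homD:
  assumes "f \<in> mod_hom S U V"
  shows "x \<in> carrier U \<Longrightarrow> f x \<in> carrier V"
    and "x \<in> carrier U \<Longrightarrow> y \<in> carrier U \<Longrightarrow> f (x \<oplus>\<^bsub>U\<^esub> y) = f x \<oplus>\<^bsub>V\<^esub> f y"
    and "a \<in> carrier S \<Longrightarrow> x \<in> carrier U \<Longrightarrow> f (a \<odot>\<^bsub>U\<^esub> x) = a \<odot>\<^bsub>V\<^esub> f x"
  using assms by (auto simp: mod_hom_def)

lemma mod_homI: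
  assumes "\<And>x. x \<in> carrier U \<Longrightarrow> f x \<in> carrier V"
    and "\<And>x y. x \<in> carrier U \<Longrightarrow> y \<in> carrier U \<Longrightarrow> f (x \<oplus>\<^bsub>U\<^esub> y) = f x \<oplus>\<^bsub>V\<^esub> f y"
    and "\<And>a x. a \<in> carrier S \<Longrightarrow> x \<in> carrier U \<Longrightarrow> f (a \<odot>\<^bsub>U\<^esub> x) = a \<odot>\<^bsub>V\<^esub> f x"
  shows "f \<in> mod_hom S U V"
  using assms by (auto simp: mod_hom_def)

lemma mod_hom_zero:
  assumes "left_module S U" "left_module S V" "f \<in> mod_hom S U V"
  shows "f \<zero>\<^bsub>U\<^esub> = \<zero>\<^bsub>V\<^esub>"
proof -
  interpret U: left_module S U by fact
  interpret V: left_module S V by fact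
  have "f \<zero>\<^bsub>U\<^esub> = f (\<zero>\<^bsub>S\<^esub> \<odot>\<^bsub>U\<^esub> \<zero>\<^bsub>U\<^esub>)" by (simp add: U.smult_l_null)
  also have "\<dots> = \<zero>\<^bsub>V\<^esub>" using mod_homD[OF assms(3)] by (simp add: V.smult_l_null)
  finally show ?thesis .
qed

lemma mod_hom_compose:
  assumes "f \<in> mod_hom S U V" "g \<in> mod_hom S V W"
  shows "(\<lambda>x. g (f x)) \<in> mod_hom S U W"
  by (rule mod_homI) (simp_all add: mod_homD[OF assms(1)] mod_homD[OF assms(2)])

lemma mod_hom_add:
  assumes V: "left_module S V" and fg: "f \<in> mod_hom S U V" "g \<in> mod_hom S U V"
  shows "(\<lambda>x. f x \<oplus>\<^bsub>V\<^esub> g x) \<in> mod_hom S U V"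
proof -
  interpret V: left_module S V by fact
  show ?thesis
    by (rule mod_homI) (simp_all add: mod_homD[OF fg(1)] mod_homD[OF fg(2)] V.M.a_ac V.smult_r_distr)
qed

lemma mod_hom_inv_into:
  assumes U: "left_module S U" and f: "f \<in> mod_hom S U V" "bij_betw f (carrier U) (carrier V)"
  shows "inv_into (carrier U) f \<in> mod_hom S V U"
proof -
  interpret U: left_module S U by fact
  let ?g = "inv_into (carrier U) f"
  have im: "f ` carrier U = carrier V" and inj: "inj_on f (carrier U)"
    using f(2) by (auto simp: bij_betw_def)
  have g: "?g y \<in> carrier U" "f (?g y) = y" if "y \<in> carrier V" for y
    using that im by (auto intro: inv_into_into f_inv_into_f)
  have eq: "?g (f x) = x" if "x \<in> carrier U" for x using that inj by simp
  show ?thesis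
  proof (rule mod_homI)
    show "?g x \<in> carrier U" if "x \<in> carrier V" for x using g that by blast
    show "?g (x \<oplus>\<^bsub>V\<^esub> y) = ?g x \<oplus>\<^bsub>U\<^esub> ?g y" if "x \<in> carrier V" "y \<in> carrier V" for x y
      using eq[of "?g x \<oplus>\<^bsub>U\<^esub> ?g y"] g that mod_homD[OF f(1)] by simp
    show "?g (a \<odot>\<^bsub>V\<^esub> x) = a \<odot>\<^bsub>U\<^esub> ?g x" if "a \<in> carrier S" "x \<in> carrier V" for a x
      using eq[of "a \<odot>\<^bsub>U\<^esub> ?g x"] g that mod_homD[OF f(1)] by simp
  qed
qed

lemma mod_isomorphic_sym:
  assumes "left_module S U" "mod_isomorphic S U V"
  shows "mod_isomorphic S V U"
  using assms mod_hom_inv_into bij_betw_inv_into unfolding mod_isomorphic_def by metis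

lemma mod_isomorphic_trans:
  assumes "mod_isomorphic S U V" "mod_isomorphic S V W"
  shows "mod_isomorphic S U W"
proof -
  obtain f g where "f \<in> mod_hom S U V" "bij_betw f (carrier U) (carrier V)"
    "g \<in> mod_hom S V W" "bij_betw g (carrier V) (carrier W)"
    using assms unfolding mod_isomorphic_def by blast
  then show ?thesis
    using mod_hom_compose[of f S U V g W] bij_betw_trans[of f _ _ g]
    unfolding mod_isomorphic_def comp_def by blast
qed

lemma iso_to_summand_cong:
  assumes "mod_isomorphic S U V" "iso_to_summand S V W"
  shows "iso_to_summand S U W"
  using assms mod_isomorphic_trans unfolding iso_to_summand_def by blast

lemma left_module_submodule:
  assumes "left_module S U" "submodule A S U"
  shows "left_module S (U\<lparr>carrier := A\<rparr>)"
proof -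
  interpret U: left_module S U by fact
  have A: "A \<subseteq> carrier U" "\<zero>\<^bsub>U\<^esub> \<in> A" "\<And>x y. x \<in> A \<Longrightarrow> y \<in> A \<Longrightarrow> x \<oplus>\<^bsub>U\<^esub> y \<in> A"
    "\<And>a x. a \<in> carrier S \<Longrightarrow> x \<in> A \<Longrightarrow> a \<odot>\<^bsub>U\<^esub> x \<in> A"
    using assms(2) unfolding U.submodule_iff by auto
  have "\<exists>y\<in>A. y \<oplus>\<^bsub>U\<^esub> x = \<zero>\<^bsub>U\<^esub>" if x: "x \<in> A" for x
  proof
    have xc: "x \<in> carrier U" using x A by blast
    show "(\<ominus>\<^bsub>S\<^esub> \<one>\<^bsub>S\<^esub>) \<odot>\<^bsub>U\<^esub> x \<in> A" using x A(4) by simp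
    show "(\<ominus>\<^bsub>S\<^esub> \<one>\<^bsub>S\<^esub>) \<odot>\<^bsub>U\<^esub> x \<oplus>\<^bsub>U\<^esub> x = \<zero>\<^bsub>U\<^esub>"
      using xc by (simp add: U.smult_l_minus U.M.l_neg)
  qed
  then have "abelian_group (U\<lparr>carrier := A\<rparr>)"
    using A by (intro abelian_groupI) (auto simp: U.M.a_ac subset_iff)
  then show ?thesis
    using A by (intro left_module.intro left_module_axioms.intro U.R.ring_axioms)
      (auto simp: U.smult_l_distr U.smult_r_distr U.smult_assoc1 subset_iff)
qed

lemma direct_decomp_projection:
  assumes V: "left_module S V" and AB: "direct_decomp S V A B"
  obtains \<pi> where "\<pi> \<in> mod_hom S V (V\<lparr>carrier := A\<rparr>)" "\<And>a. a \<in> A \<Longrightarrow> \<pi> a = a"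
proof -
  interpret V: left_module S V by fact
  have sub: "submodule A S V" "submodule B S V" and AB0: "A \<inter> B = {\<zero>\<^bsub>V\<^esub>}"
    and sum: "A <+>\<^bsub>V\<^esub> B = carrier V"
    using AB by (auto simp: direct_decomp_def)
  have A: "A \<subseteq> carrier V" "\<zero>\<^bsub>V\<^esub> \<in> A" "\<And>x y. x \<in> A \<Longrightarrow> y \<in> A \<Longrightarrow> x \<oplus>\<^bsub>V\<^esub> y \<in> A"
    "\<And>a x. a \<in> carrier S \<Longrightarrow> x \<in> A \<Longrightarrow> a \<odot>\<^bsub>V\<^esub> x \<in> A"
    and B: "B \<subseteq> carrier V" "\<zero>\<^bsub>V\<^esub> \<in> B" "\<And>x y. x \<in> B \<Longrightarrow> y \<in> B \<Longrightarrow> x \<oplus>\<^bsub>V\<^esub> y \<in> B"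
    "\<And>a x. a \<in> carrier S \<Longrightarrow> x \<in> B \<Longrightarrow> a \<odot>\<^bsub>V\<^esub> x \<in> B"
    using sub unfolding V.submodule_iff by auto
  have neg: "\<ominus>\<^bsub>V\<^esub> x = (\<ominus>\<^bsub>S\<^esub> \<one>\<^bsub>S\<^esub>) \<odot>\<^bsub>V\<^esub> x" if "x \<in> carrier V" for x
    using that by (simp add: V.smult_l_minus)
  have uniq: "a = a'" if "a \<in> A" "a' \<in> A" "b \<in> B" "b' \<in> B" "a \<oplus>\<^bsub>V\<^esub> b = a' \<oplus>\<^bsub>V\<^esub> b'" for a a' b b'
  proof -
    have c: "a \<in> carrier V" "a' \<in> carrier V" "b \<in> carrier V" "b' \<in> carrier V" using that A B by auto
    have "a \<ominus>\<^bsub>V\<^esub> a' = (a \<oplus>\<^bsub>V\<^esub> b) \<oplus>\<^bsub>V\<^esub> \<ominus>\<^bsub>V\<^esub> b \<oplus>\<^bsub>V\<^esub> \<ominus>\<^bsub>V\<^esub> a'"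
      using c by (simp add: a_minus_def V.M.a_assoc V.M.r_neg)
    also have "\<dots> = \<ominus>\<^bsub>V\<^esub> a' \<oplus>\<^bsub>V\<^esub> (a' \<oplus>\<^bsub>V\<^esub> (b' \<oplus>\<^bsub>V\<^esub> \<ominus>\<^bsub>V\<^esub> b))"
      unfolding that(5) using c by (simp add: V.M.a_ac)
    also have "\<dots> = b' \<ominus>\<^bsub>V\<^esub> b" using c by (simp add: a_minus_def V.M.r_neg1)
    finally have eq: "a \<ominus>\<^bsub>V\<^esub> a' = b' \<ominus>\<^bsub>V\<^esub> b" .
    have "a \<ominus>\<^bsub>V\<^esub> a' \<in> A" using A(3)[OF that(1) A(4)[OF _ that(2)]] c by (simp add: a_minus_def neg)
    moreover have "b' \<ominus>\<^bsub>V\<^esub> b \<in> B" using B(3)[OF that(4) B(4)[OF _ that(3)]] c by (simp add: a_minus_def neg)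
    ultimately have "a \<ominus>\<^bsub>V\<^esub> a' = \<zero>\<^bsub>V\<^esub>" using AB0 eq by auto
    moreover have "a = (a \<ominus>\<^bsub>V\<^esub> a') \<oplus>\<^bsub>V\<^esub> a'" using c by (simp add: a_minus_def V.M.a_assoc V.M.l_neg)
    ultimately show ?thesis using c by simp
  qed
  have "\<exists>a\<in>A. \<exists>b\<in>B. x = a \<oplus>\<^bsub>V\<^esub> b" if "x \<in> carrier V" for x
    using that unfolding sum[symmetric] by (auto simp: set_add_def set_mult_def)
  then obtain \<pi> \<rho> where pr: "\<And>x. x \<in> carrier V \<Longrightarrow> \<pi> x \<in> A" "\<And>x. x \<in> carrier V \<Longrightarrow> \<rho> x \<in> B"
    "\<And>x. x \<in> carrier V \<Longrightarrow> x = \<pi> x \<oplus>\<^bsub>V\<^esub> \<rho> x" by metis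
  have pc: "\<pi> x \<in> carrier V" "\<rho> x \<in> carrier V" if "x \<in> carrier V" for x using pr that A B by auto
  have eqI: "\<pi> x = a" if "a \<in> A" "b \<in> B" "x = a \<oplus>\<^bsub>V\<^esub> b" for x a b
  proof -
    have x: "x \<in> carrier V" using that A B by auto
    then show ?thesis using uniq[OF pr(1)[OF x] that(1) pr(2)[OF x] that(2)] pr(3)[OF x] that(3) by simp
  qed
  have "\<pi> \<in> mod_hom S V (V\<lparr>carrier := A\<rparr>)"
  proof (rule mod_homI)
    fix x assume x: "x \<in> carrier V"
    show "\<pi> x \<in> carrier (V\<lparr>carrier := A\<rparr>)" using pr x by simp
    show "\<pi> (x \<oplus>\<^bsub>V\<^esub> y) = \<pi> x \<oplus>\<^bsub>V\<lparr>carrier := A\<rparr>\<^esub> \<pi> y" if y: "y \<in> carrier V" for y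
    proof -
      have "(\<pi> x \<oplus>\<^bsub>V\<^esub> \<rho> x) \<oplus>\<^bsub>V\<^esub> (\<pi> y \<oplus>\<^bsub>V\<^esub> \<rho> y) = (\<pi> x \<oplus>\<^bsub>V\<^esub> \<pi> y) \<oplus>\<^bsub>V\<^esub> (\<rho> x \<oplus>\<^bsub>V\<^esub> \<rho> y)"
        using pc x y by (simp add: V.M.a_ac)
      then have "x \<oplus>\<^bsub>V\<^esub> y = (\<pi> x \<oplus>\<^bsub>V\<^esub> \<pi> y) \<oplus>\<^bsub>V\<^esub> (\<rho> x \<oplus>\<^bsub>V\<^esub> \<rho> y)"
        using pr(3)[OF x] pr(3)[OF y] by simp
      then show ?thesis using eqI A(3) B(3) pr x y by simp
    qed
    show "\<pi> (a \<odot>\<^bsub>V\<^esub> x) = a \<odot>\<^bsub>V\<lparr>carrier := A\<rparr>\<^esub> \<pi> x" if a: "a \<in> carrier S" for a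
    proof -
      have "a \<odot>\<^bsub>V\<^esub> x = a \<odot>\<^bsub>V\<^esub> \<pi> x \<oplus>\<^bsub>V\<^esub> a \<odot>\<^bsub>V\<^esub> \<rho> x"
        using pr(3)[OF x] V.smult_r_distr[OF a pc[OF x]] by simp
      then show ?thesis using eqI A(4) B(4) pr x a by simp
    qed
  qed
  moreover have "\<pi> a = a" if "a \<in> A" for a using eqI[of a "\<zero>\<^bsub>V\<^esub>" a] that A B by auto
  ultimately show ?thesis using that by blast
qed

text \<open>A split monomorphism gives the decomposition of \<open>V\<close> into the image of
  \<open>s\<close> and the kernel of \<open>t\<close>, with
  \<open>v = s (t v) + (v - s (t v))\<close>.\<close>

lemma iso_to_summandI:
  assumes U: "left_module S U" and V: "left_module S V"
    and s: "s \<in> mod_hom S U V" and t: "t \<in> mod_hom S V U" and ts: "\<And>u. u \<in> carrier U \<Longrightarrow> t (s u) = u"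
  shows "iso_to_summand S U V"
proof -
  interpret U: left_module S U by fact
  interpret V: left_module S V by fact
  let ?A = "s ` carrier U" and ?B = "{v \<in> carrier V. t v = \<zero>\<^bsub>U\<^esub>}"
  have A: "submodule ?A S V"
    unfolding V.submodule_iff
  proof (intro conjI ballI)
    show "?A \<subseteq> carrier V" using mod_homD(1)[OF s] by blast
    show "\<zero>\<^bsub>V\<^esub> \<in> ?A" using mod_hom_zero[OF U V s] by (metis U.M.zero_closed imageI)
    fix x assume "x \<in> ?A"
    then obtain u where u: "u \<in> carrier U" "x = s u" by blast
    show "x \<oplus>\<^bsub>V\<^esub> y \<in> ?A" if "y \<in> ?A" for y
      using that u mod_homD(2)[OF s] U.M.a_closed by (metis (no_types, lifting) image_iff)
    show "a \<odot>\<^bsub>V\<^esub> x \<in> ?A" if "a \<in> carrier S" for a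
      using that u mod_homD(3)[OF s] U.smult_closed by (metis image_eqI)
  qed
  have B: "submodule ?B S V" by (rule submodule_kernel[OF V U t])
  have "?A \<inter> ?B = {\<zero>\<^bsub>V\<^esub>}"
    using ts mod_hom_zero[OF U V s] mod_hom_zero[OF V U t] by force
  moreover have "?A <+>\<^bsub>V\<^esub> ?B = carrier V"
  proof
    show "?A <+>\<^bsub>V\<^esub> ?B \<subseteq> carrier V" using mod_homD(1)[OF s] by (auto simp: set_add_def set_mult_def)
    show "carrier V \<subseteq> ?A <+>\<^bsub>V\<^esub> ?B"
    proof
      fix v assume v: "v \<in> carrier V"
      define u where "u = t v"
      have u: "u \<in> carrier U" using v mod_homD(1)[OF t] by (simp add: u_def)
      have su: "s u \<in> carrier V" using u mod_homD(1)[OF s] by simp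
      define b where "b = v \<oplus>\<^bsub>V\<^esub> s ((\<ominus>\<^bsub>S\<^esub> \<one>\<^bsub>S\<^esub>) \<odot>\<^bsub>U\<^esub> u)"
      have b: "b = v \<ominus>\<^bsub>V\<^esub> s u" "b \<in> carrier V"
        using u su v mod_homD(3)[OF s, of _ u] by (simp_all add: b_def a_minus_def V.smult_l_minus)
      have "t b = u \<oplus>\<^bsub>U\<^esub> (\<ominus>\<^bsub>S\<^esub> \<one>\<^bsub>S\<^esub>) \<odot>\<^bsub>U\<^esub> u"
        unfolding b_def using u v mod_homD[OF t] mod_homD(1)[OF s] ts by (simp add: u_def)
      also have "\<dots> = \<zero>\<^bsub>U\<^esub>" using u by (simp add: U.smult_l_minus U.M.r_neg)
      finally have "b \<in> ?B" using b by simp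
      moreover have "v = s u \<oplus>\<^bsub>V\<^esub> b" using su v by (simp add: b a_minus_def V.M.a_ac V.M.r_neg2 V.M.r_neg1 V.M.r_neg)
      ultimately show "v \<in> ?A <+>\<^bsub>V\<^esub> ?B" using u by (auto simp: set_add_def set_mult_def)
    qed
  qed
  ultimately have "direct_decomp S V ?A ?B" using A B unfolding direct_decomp_def by blast
  moreover have "mod_isomorphic S U (V\<lparr>carrier := ?A\<rparr>)"
    unfolding mod_isomorphic_def
  proof
    show "s \<in> mod_hom S U (V\<lparr>carrier := ?A\<rparr>)"
      by (rule mod_homI) (simp_all add: mod_homD[OF s])
    show "bij_betw s (carrier U) (carrier (V\<lparr>carrier := ?A\<rparr>))"
      by (auto simp: bij_betw_def intro: inj_on_inverseI[where g = t] ts)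
  qed
  ultimately show ?thesis unfolding iso_to_summand_def by blast
qed

section \<open>Free modules, dual bases and the lifting property\<close>

definition free_unit :: "('a, 'r) ring_scheme \<Rightarrow> 'i \<Rightarrow> 'i \<Rightarrow> 'a" where
  "free_unit S i = (\<lambda>k. if k = i then \<one>\<^bsub>S\<^esub> else \<zero>\<^bsub>S\<^esub>)"

lemma free_unit_closed:
  assumes "ring S" "i \<in> I"
  shows "free_unit S i \<in> carrier (free_module S I)"
proof -
  interpret ring S by fact
  show ?thesis
    using assms(2) by (auto simp: free_module_def free_unit_def)
qed

lemma free_module_add_span:
  assumes "ring S" and u: "u \<in> carrier (free_module S I)"
  shows "u \<in> add_span (free_module S I) {u i \<odot>\<^bsub>free_module S I\<^esub> free_unit S i | i. i \<in> I}"
proof -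
  interpret ring S by fact
  let ?F = "free_module S I" and ?T = "{i. u i \<noteq> \<zero>\<^bsub>S\<^esub>}"
  have u': "\<And>i. i \<in> I \<Longrightarrow> u i \<in> carrier S" "\<And>i. i \<notin> I \<Longrightarrow> u i = \<zero>\<^bsub>S\<^esub>" "finite ?T"
    using u by (auto simp: free_module_def)
  have "(\<lambda>k. if k \<in> T then u k else \<zero>\<^bsub>S\<^esub>) \<in> add_span ?F {u i \<odot>\<^bsub>?F\<^esub> free_unit S i | i. i \<in> I}"
    if "finite T" "T \<subseteq> I" for T
    using that
  proof (induction T rule: finite_induct)
    case empty
    have "(\<lambda>k. if k \<in> {} then u k else \<zero>\<^bsub>S\<^esub>) = \<zero>\<^bsub>?F\<^esub>" by (simp add: free_module_def)
    then show ?case by (simp only: add_span.zero)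
  next
    case (insert i T)
    have "(\<lambda>k. if k \<in> insert i T then u k else \<zero>\<^bsub>S\<^esub>) =
        u i \<odot>\<^bsub>?F\<^esub> free_unit S i \<oplus>\<^bsub>?F\<^esub> (\<lambda>k. if k \<in> T then u k else \<zero>\<^bsub>S\<^esub>)"
      using insert u' by (auto simp: free_module_def free_unit_def fun_eq_iff subset_iff)
    then show ?case using insert by (auto intro: add_span.add)
  qed
  from this[OF u'(3)] show ?thesis
  proof -
    have "?T \<subseteq> I" using u'(2) by auto
    moreover have "(\<lambda>k. if k \<in> ?T then u k else \<zero>\<^bsub>S\<^esub>) = u" by auto
    ultimately show ?thesis using \<open>?T \<subseteq> I \<Longrightarrow> _\<close> by simp
  qed
qed

lemma add_span_image:
  assumes U: "left_module S U" and V: "left_module S V" and f: "f \<in> mod_hom S U V"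
    and x: "x \<in> add_span U A" and A: "A \<subseteq> carrier U"
  shows "f x \<in> add_span V (f ` A)"
  using x
proof induction
  case zero
  then show ?case by (simp add: mod_hom_zero[OF U V f] add_span.zero)
next
  case (add a x)
  then have "f (a \<oplus>\<^bsub>U\<^esub> x) = f a \<oplus>\<^bsub>V\<^esub> f x"
    using A left_module.add_span_closed[OF U _ A] mod_homD(2)[OF f] by blast
  then show ?case using add by (auto intro: add_span.add)
qed

lemma mod_hom_eq_on_add_span:
  assumes U: "left_module S U" and V: "left_module S V" and f: "f \<in> mod_hom S U V" and g: "g \<in> mod_hom S U V"
    and x: "x \<in> add_span U A" and A: "A \<subseteq> carrier U" "\<And>a. a \<in> A \<Longrightarrow> f a = g a"
  shows "f x = g x"
  using x
proof induction
  case zero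
  then show ?case by (simp add: mod_hom_zero[OF U V f] mod_hom_zero[OF U V g])
next
  case (add a x)
  then have "a \<in> carrier U" "x \<in> carrier U" "f a = g a"
    using A left_module.add_span_closed[OF U _ A(1)] by blast+
  then show ?case using add mod_homD(2)[OF f] mod_homD(2)[OF g] by simp
qed

lemma free_module_hom:
  fixes I :: "'i set"
  assumes U: "left_module S U" and x: "\<And>i. i \<in> I \<Longrightarrow> x i \<in> carrier U"
  obtains h where "h \<in> mod_hom S (free_module S I) U" "\<And>i. i \<in> I \<Longrightarrow> h (free_unit S i) = x i"
proof -
  interpret U: left_module S U by fact
  let ?F = "free_module S I"
  interpret F: left_module S ?F by (rule left_module_free_module[OF U.R.ring_axioms])
  define h where "h u = finsum U (\<lambda>i. u i \<odot>\<^bsub>U\<^esub> x i) {i. u i \<noteq> \<zero>\<^bsub>S\<^esub>}" for u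
  have cl: "u i \<in> carrier S" "finite {i. u i \<noteq> \<zero>\<^bsub>S\<^esub>}" "u i \<noteq> \<zero>\<^bsub>S\<^esub> \<Longrightarrow> i \<in> I"
    if "u \<in> carrier ?F" for u i
    using that by (cases "i \<in> I"; auto simp: free_module_def)+
  have tm: "u i \<odot>\<^bsub>U\<^esub> x i \<in> carrier U" if "u \<in> carrier ?F" "i \<in> I" for u i
    using cl(1)[OF that(1)] x that(2) by simp
  \<comment> \<open>Supports of sums and scalar multiples may shrink. Evaluating over any finite set
    containing the support lets all terms share one index set.\<close>
  have ext: "h u = finsum U (\<lambda>i. u i \<odot>\<^bsub>U\<^esub> x i) T"
    if u: "u \<in> carrier ?F" and T: "finite T" "{i. u i \<noteq> \<zero>\<^bsub>S\<^esub>} \<subseteq> T" "T \<subseteq> I" for u T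
    unfolding h_def
    by (rule U.M.add.finprod_mono_neutral_cong_left[simplified])
      (use T tm[OF u] x in \<open>auto simp: U.smult_l_null subset_iff\<close>)
  have "h \<in> mod_hom S ?F U"
  proof (rule mod_homI)
    fix u assume u: "u \<in> carrier ?F"
    let ?T = "{i. u i \<noteq> \<zero>\<^bsub>S\<^esub>}"
    have T: "finite ?T" "?T \<subseteq> I" using cl[OF u] by auto
    have eu: "h u = finsum U (\<lambda>i. u i \<odot>\<^bsub>U\<^esub> x i) ?T" by (simp add: h_def)
    have t: "(\<lambda>i. u i \<odot>\<^bsub>U\<^esub> x i) \<in> ?T \<rightarrow> carrier U" using T tm[OF u] by auto
    show "h u \<in> carrier U" unfolding eu by (rule U.M.finsum_closed[OF t])
    show "h (u \<oplus>\<^bsub>?F\<^esub> v) = h u \<oplus>\<^bsub>U\<^esub> h v" if v: "v \<in> carrier ?F" for v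
    proof -
      let ?W = "?T \<union> {i. v i \<noteq> \<zero>\<^bsub>S\<^esub>}"
      have W: "finite ?W" "?W \<subseteq> I" using cl[OF u] cl[OF v] by auto
      have "h (u \<oplus>\<^bsub>?F\<^esub> v) = finsum U (\<lambda>i. (u \<oplus>\<^bsub>?F\<^esub> v) i \<odot>\<^bsub>U\<^esub> x i) ?W"
        by (rule ext[OF F.M.a_closed[OF u v] W(1) _ W(2)]) (auto simp: free_module_def)
      also have "\<dots> = finsum U (\<lambda>i. u i \<odot>\<^bsub>U\<^esub> x i \<oplus>\<^bsub>U\<^esub> v i \<odot>\<^bsub>U\<^esub> x i) ?W"
      proof (rule U.M.finsum_cong')
        fix i assume i: "i \<in> ?W"
        then have "x i \<in> carrier U" using W x by blast
        then show "(u \<oplus>\<^bsub>?F\<^esub> v) i \<odot>\<^bsub>U\<^esub> x i = u i \<odot>\<^bsub>U\<^esub> x i \<oplus>\<^bsub>U\<^esub> v i \<odot>\<^bsub>U\<^esub> x i"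
          using cl[OF u] cl[OF v] by (simp add: free_module_def U.smult_l_distr)
      qed (use W tm[OF u] tm[OF v] in auto)
      also have "\<dots> = finsum U (\<lambda>i. u i \<odot>\<^bsub>U\<^esub> x i) ?W \<oplus>\<^bsub>U\<^esub> finsum U (\<lambda>i. v i \<odot>\<^bsub>U\<^esub> x i) ?W"
        by (rule U.M.finsum_addf) (use W tm[OF u] tm[OF v] in auto)
      also have "\<dots> = h u \<oplus>\<^bsub>U\<^esub> h v"
        using ext[OF u W(1) _ W(2)] ext[OF v W(1) _ W(2)] by simp
      finally show ?thesis .
    qed
    show "h (a \<odot>\<^bsub>?F\<^esub> u) = a \<odot>\<^bsub>U\<^esub> h u" if a: "a \<in> carrier S" for a
    proof -
      have sm: "finsum U (\<lambda>i. a \<odot>\<^bsub>U\<^esub> t i) T = a \<odot>\<^bsub>U\<^esub> finsum U t T"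
        if "finite T" "t \<in> T \<rightarrow> carrier U" for t and T :: "'i set"
        using that
      proof (induction T rule: finite_induct)
        case (insert i T)
        then have "t i \<in> carrier U" "t \<in> T \<rightarrow> carrier U" "(\<lambda>i. a \<odot>\<^bsub>U\<^esub> t i) \<in> T \<rightarrow> carrier U"
          using a by auto
        then show ?case using insert a by (simp add: U.smult_r_distr U.M.finsum_closed)
      qed (simp add: a U.smult_r_null)
      have "h (a \<odot>\<^bsub>?F\<^esub> u) = finsum U (\<lambda>i. (a \<odot>\<^bsub>?F\<^esub> u) i \<odot>\<^bsub>U\<^esub> x i) ?T"
        by (rule ext[OF F.smult_closed[OF a u] T(1) _ T(2)]) (use a in \<open>auto simp: free_module_def\<close>)
      also have "\<dots> = finsum U (\<lambda>i. a \<odot>\<^bsub>U\<^esub> (u i \<odot>\<^bsub>U\<^esub> x i)) ?T"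
      proof (rule U.M.finsum_cong')
        fix i assume i: "i \<in> ?T"
        then have "x i \<in> carrier U" using T x by blast
        then show "(a \<odot>\<^bsub>?F\<^esub> u) i \<odot>\<^bsub>U\<^esub> x i = a \<odot>\<^bsub>U\<^esub> (u i \<odot>\<^bsub>U\<^esub> x i)"
          using cl[OF u] a by (simp add: free_module_def U.smult_assoc1)
      qed (use T tm[OF u] a in auto)
      also have "\<dots> = a \<odot>\<^bsub>U\<^esub> h u" unfolding eu by (rule sm[OF T(1) t])
      finally show ?thesis .
    qed
  qed
  moreover have "h (free_unit S i) = x i" if i: "i \<in> I" for i
  proof -
    have "h (free_unit S i) = finsum U (\<lambda>k. free_unit S i k \<odot>\<^bsub>U\<^esub> x k) {i}"
      by (rule ext[OF free_unit_closed[OF U.R.ring_axioms i]]) (use i in \<open>auto simp: free_unit_def\<close>)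
    also have "\<dots> = x i" using i x by (simp add: free_unit_def)
    finally show ?thesis .
  qed
  ultimately show ?thesis using that by blast
qed

text \<open>Composes the projection onto the summand with the inverse of the isomorphism. All later
  arguments use this retraction of a free module instead of the decomposition.\<close>

lemma projective_retract:
  fixes P :: "('a, 'b, 'm) module_scheme"
  assumes "projective S P"
  obtains I :: "'b set" and j \<pi> where "j \<in> mod_hom S P (free_module S I)"
    "\<pi> \<in> mod_hom S (free_module S I) P" "\<And>p. p \<in> carrier P \<Longrightarrow> \<pi> (j p) = p"
proof -
  have P: "left_module S P" using assms by (simp add: projective_def)
  interpret P: left_module S P by fact
  obtain I :: "'b set" and A B where AB: "direct_decomp S (free_module S I) A B"
    and iso: "mod_isomorphic S P ((free_module S I)\<lparr>carrier := A\<rparr>)"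
    using assms unfolding projective_def iso_to_summand_def by blast
  let ?F = "free_module S I"
  have F: "left_module S ?F" by (rule left_module_free_module[OF P.R.ring_axioms])
  have A: "A \<subseteq> carrier ?F"
    using AB unfolding direct_decomp_def left_module.submodule_iff[OF F] by simp
  obtain \<phi> where \<phi>: "\<phi> \<in> mod_hom S P (?F\<lparr>carrier := A\<rparr>)" "bij_betw \<phi> (carrier P) A"
    using iso unfolding mod_isomorphic_def by auto
  obtain \<rho> where \<rho>: "\<rho> \<in> mod_hom S ?F (?F\<lparr>carrier := A\<rparr>)" "\<And>a. a \<in> A \<Longrightarrow> \<rho> a = a"
    using direct_decomp_projection[OF F AB] by blast
  have inv: "inv_into (carrier P) \<phi> \<in> mod_hom S (?F\<lparr>carrier := A\<rparr>) P"
    using mod_hom_inv_into[OF P \<phi>(1)] \<phi>(2) by simp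
  have "\<phi> \<in> mod_hom S P ?F"
    using mod_homD[OF \<phi>(1)] A by (intro mod_homI) auto
  moreover have "inv_into (carrier P) \<phi> (\<rho> (\<phi> p)) = p" if "p \<in> carrier P" for p
    using that mod_homD(1)[OF \<phi>(1)] \<rho>(2) \<phi>(2) by (simp add: bij_betw_def)
  ultimately show ?thesis using that mod_hom_compose[OF \<rho>(1) inv] by blast
qed

text \<open>Apply \<open>\<pi>\<close> to the expansion of \<open>j p\<close> in the standard basis.
  The functionals \<open>f\<close> are the coordinates of \<open>j\<close>, and the \<open>q\<close>
  are the images of basis vectors. For \<open>S = opp R\<close> this is the expansion of
  \<open>p\<close> as a sum of \<open>q f(p)\<close>.\<close>

lemma projective_dual_basis:
  fixes P :: "('a, 'b, 'm) module_scheme"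
  assumes P: "projective S P" and p: "p \<in> carrier P"
  shows "p \<in> add_span P {f p \<odot>\<^bsub>P\<^esub> q | f q. f \<in> mod_hom S P (regular_module S) \<and> q \<in> carrier P}"
proof -
  have PM: "left_module S P" using P by (simp add: projective_def)
  interpret P: left_module S P by fact
  obtain I :: "'b set" and j \<pi> where j: "j \<in> mod_hom S P (free_module S I)"
    and \<pi>: "\<pi> \<in> mod_hom S (free_module S I) P" and \<pi>j: "\<And>p. p \<in> carrier P \<Longrightarrow> \<pi> (j p) = p"
    by (rule projective_retract[OF P]) (rule that)
  let ?F = "free_module S I"
  have F: "left_module S ?F" by (rule left_module_free_module[OF P.R.ring_axioms])
  have jc: "j p i \<in> carrier S" if "p \<in> carrier P" for p i
    using mod_homD(1)[OF j that] by (cases "i \<in> I") (auto simp: free_module_def)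
  have coord: "(\<lambda>p. j p i) \<in> mod_hom S P (regular_module S)" for i
    by (rule mod_homI) (simp_all add: regular_module_def jc mod_homD[OF j] free_module_def)
  let ?A = "{j p i \<odot>\<^bsub>?F\<^esub> free_unit S i | i. i \<in> I}"
  have unit: "free_unit S i \<in> carrier ?F" if "i \<in> I" for i
    by (rule free_unit_closed[OF P.R.ring_axioms that])
  have "\<pi> (j p) \<in> add_span P (\<pi> ` ?A)"
  proof (rule add_span_image[OF F PM \<pi>])
    show "j p \<in> add_span ?F ?A"
      by (rule free_module_add_span[OF P.R.ring_axioms mod_homD(1)[OF j p]])
    show "?A \<subseteq> carrier ?F" using unit jc[OF p] left_module.smult_closed[OF F] by blast
  qed
  moreover have "\<pi> ` ?A \<subseteq> {f p \<odot>\<^bsub>P\<^esub> q | f q. f \<in> mod_hom S P (regular_module S) \<and> q \<in> carrier P}"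
  proof
    fix y assume "y \<in> \<pi> ` ?A"
    then obtain i where i: "i \<in> I" "y = \<pi> (j p i \<odot>\<^bsub>?F\<^esub> free_unit S i)" by blast
    then have "y = j p i \<odot>\<^bsub>P\<^esub> \<pi> (free_unit S i)" "\<pi> (free_unit S i) \<in> carrier P"
      using mod_homD[OF \<pi>] unit jc[OF p] by auto
    then show "y \<in> {f p \<odot>\<^bsub>P\<^esub> q | f q. f \<in> mod_hom S P (regular_module S) \<and> q \<in> carrier P}"
      using coord[of i] by (intro CollectI exI[of _ "\<lambda>p. j p i"] exI[of _ "\<pi> (free_unit S i)"] conjI)
  qed
  ultimately show ?thesis unfolding \<pi>j[OF p] by (rule add_span_mono)
qed

text \<open>Preimages are chosen for the values of \<open>f \<pi>\<close> on basis vectors and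
  extended linearly. Asking only that \<open>f\<close> take values in the image of \<open>g\<close>,
  which need not be all of \<open>Y\<close>, suits complexes, where these images are
  kernels.\<close>

lemma projective_lift:
  fixes P :: "('a, 'b, 'm) module_scheme"
  assumes P: "projective S P" and X: "left_module S X" and Y: "left_module S Y"
    and f: "f \<in> mod_hom S P Y" and g: "g \<in> mod_hom S X Y"
    and fg: "\<And>p. p \<in> carrier P \<Longrightarrow> f p \<in> g ` carrier X"
  obtains h where "h \<in> mod_hom S P X" "\<And>p. p \<in> carrier P \<Longrightarrow> g (h p) = f p"
proof -
  have PM: "left_module S P" using P by (simp add: projective_def)
  interpret P: left_module S P by fact
  obtain I :: "'b set" and j \<pi> where j: "j \<in> mod_hom S P (free_module S I)"
    and \<pi>: "\<pi> \<in> mod_hom S (free_module S I) P" and \<pi>j: "\<And>p. p \<in> carrier P \<Longrightarrow> \<pi> (j p) = p"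
    by (rule projective_retract[OF P]) (rule that)
  let ?F = "free_module S I"
  have F: "left_module S ?F" by (rule left_module_free_module[OF P.R.ring_axioms])
  have unit: "free_unit S i \<in> carrier ?F" if "i \<in> I" for i
    by (rule free_unit_closed[OF P.R.ring_axioms that])
  have "\<forall>i\<in>I. \<exists>x. x \<in> carrier X \<and> g x = f (\<pi> (free_unit S i))"
    using fg mod_homD(1)[OF \<pi>] unit by (metis imageE)
  from bchoice[OF this] obtain x where "\<forall>i\<in>I. x i \<in> carrier X \<and> g (x i) = f (\<pi> (free_unit S i))"
    by (elim exE)
  then have x: "x i \<in> carrier X" "g (x i) = f (\<pi> (free_unit S i))" if "i \<in> I" for i
    using that by simp_all
  obtain h where h: "h \<in> mod_hom S ?F X" "\<And>i. i \<in> I \<Longrightarrow> h (free_unit S i) = x i"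
    by (rule free_module_hom[where I = I and x = x, OF X x(1)]) (assumption, rule that)
  have "g (h u) = f (\<pi> u)" if u: "u \<in> carrier ?F" for u
  proof (rule mod_hom_eq_on_add_span[OF F Y mod_hom_compose[OF h(1) g] mod_hom_compose[OF \<pi> f]
        free_module_add_span[OF P.R.ring_axioms u]])
    have uc: "u i \<in> carrier S" if "i \<in> I" for i using u that by (auto simp: free_module_def)
    show "{u i \<odot>\<^bsub>?F\<^esub> free_unit S i | i. i \<in> I} \<subseteq> carrier ?F"
      using unit uc left_module.smult_closed[OF F] by blast
    show "g (h a) = f (\<pi> a)" if a: "a \<in> {u i \<odot>\<^bsub>?F\<^esub> free_unit S i | i. i \<in> I}" for a
    proof -
      obtain i where i: "i \<in> I" "a = u i \<odot>\<^bsub>?F\<^esub> free_unit S i" using a by blast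
      then show ?thesis
        using uc[OF i(1)] unit[OF i(1)] h(2)[OF i(1)] x[OF i(1)]
        by (simp add: mod_homD[OF h(1)] mod_homD[OF g] mod_homD[OF \<pi>] mod_homD[OF f])
    qed
  qed
  then have "g (h (j p)) = f p" if "p \<in> carrier P" for p
    using that mod_homD(1)[OF j] \<pi>j by simp
  then show ?thesis by (rule that[OF mod_hom_compose[OF j h(1)]])
qed

section \<open>Tensoring a projective module to zero\<close>

lemma regular_module_opp_simps [simp]:
  "carrier (regular_module (opp R)) = carrier R"
  "x \<oplus>\<^bsub>regular_module (opp R)\<^esub> y = x \<oplus>\<^bsub>R\<^esub> y"
  "r \<odot>\<^bsub>regular_module (opp R)\<^esub> x = x \<otimes>\<^bsub>R\<^esub> r"
  "\<zero>\<^bsub>regular_module (opp R)\<^esub> = \<zero>\<^bsub>R\<^esub>"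
  by (simp_all add: regular_module_def)

lemma principal_module_opp_simps [simp]:
  "carrier (principal_module (opp R) e) = (\<lambda>x. e \<otimes>\<^bsub>R\<^esub> x) ` carrier R"
  "x \<oplus>\<^bsub>principal_module (opp R) e\<^esub> y = x \<oplus>\<^bsub>R\<^esub> y"
  "r \<odot>\<^bsub>principal_module (opp R) e\<^esub> x = x \<otimes>\<^bsub>R\<^esub> r"
  "\<zero>\<^bsub>principal_module (opp R) e\<^esub> = \<zero>\<^bsub>R\<^esub>"
  by (simp_all add: principal_module_def regular_module_def)

text \<open>This is the core of the argument: a functional on \<open>P\<close> with values not
  annihilating \<open>N\<close> is converted into a local idempotent that is detected both by
  \<open>P\<close> and by \<open>N\<close>.\<close>

lemma ex_local_idempotent_trace:
  fixes P :: "('a, 'b, 'm) module_scheme"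
  assumes lp: "left_perfect R" and P: "projective (opp R) P" and N: "left_module R N"
    and nz: "f0 \<in> mod_hom (opp R) P (regular_module (opp R))" "p0 \<in> carrier P" "n0 \<in> carrier N"
      "f0 p0 \<odot>\<^bsub>N\<^esub> n0 \<noteq> \<zero>\<^bsub>N\<^esub>"
  shows "\<exists>e f q x. ring.local_idempotent R e \<and> f \<in> mod_hom (opp R) P (regular_module (opp R)) \<and>
    q \<in> carrier P \<and> e \<otimes>\<^bsub>R\<^esub> f q \<notin> jacobson_radical R \<and> x \<in> carrier N \<and> e \<odot>\<^bsub>N\<^esub> x \<noteq> \<zero>\<^bsub>N\<^esub>"
proof -
  interpret N: left_module R N by fact
  have PM: "left_module (opp R) P" using P by (simp add: projective_def)
  have reg: "left_module (opp R) (regular_module (opp R))"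
    by (rule left_module_regular_module) (rule left_module.axioms(1)[OF PM])
  let ?H = "mod_hom (opp R) P (regular_module (opp R))" and ?J = "jacobson_radical R"
  have Hc: "f p \<in> carrier R" if "f \<in> ?H" "p \<in> carrier P" for f p
    using mod_homD(1)[OF that] by simp
  \<comment> \<open>\<open>X\<close> is T N, where T is the trace ideal of \<open>P\<close>, the
    span of all values \<open>f p\<close>. The set \<open>X'\<close> is already closed under
    scalars, because \<open>f\<close> followed by left multiplication by \<open>r\<close> is again
    right linear.\<close>
  define X' where "X' = {f p \<odot>\<^bsub>N\<^esub> n | f p n. f \<in> ?H \<and> p \<in> carrier P \<and> n \<in> carrier N}"
  define X where "X = add_span N X'"
  have X'I: "f p \<odot>\<^bsub>N\<^esub> n \<in> X'" if "f \<in> ?H" "p \<in> carrier P" "n \<in> carrier N" for f p n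
    unfolding X'_def using that by blast
  have X'c: "X' \<subseteq> carrier N" using Hc by (auto simp: X'_def)
  have X'X: "x \<in> X" if "x \<in> X'" for x unfolding X_def by (rule N.add_span_base[OF that X'c])
  have "r \<odot>\<^bsub>N\<^esub> a \<in> X'" if r: "r \<in> carrier R" and a: "a \<in> X'" for r a
  proof -
    obtain f p n where a: "a = f p \<odot>\<^bsub>N\<^esub> n" "f \<in> ?H" "p \<in> carrier P" "n \<in> carrier N"
      using a unfolding X'_def by blast
    have "(\<lambda>p. r \<otimes>\<^bsub>R\<^esub> f p) \<in> ?H"
      by (rule mod_homI) (simp_all add: r Hc[OF a(2)] mod_homD[OF a(2)] N.R.r_distr N.R.m_assoc)
    from X'I[OF this a(3,4)] show ?thesis using a r Hc[OF a(2,3)] by (simp add: N.smult_assoc1)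
  qed
  then have Xs: "submodule X R N" unfolding X_def by (rule N.submodule_add_span[OF X'c])
  then have Xc: "X \<subseteq> carrier N" unfolding N.submodule_iff by blast
  define Y where "Y = {j \<odot>\<^bsub>N\<^esub> x | j x. j \<in> ?J \<and> x \<in> X}"
  have J: "ideal ?J R" by (rule N.R.ideal_jacobson_radical)
  have Jc: "?J \<subseteq> carrier R" by (auto simp: jacobson_radical_def)
  have Yc: "Y \<subseteq> carrier N" using Jc Xc by (auto simp: Y_def)
  have "r \<odot>\<^bsub>N\<^esub> a \<in> Y" if r: "r \<in> carrier R" and a: "a \<in> Y" for r a
  proof -
    obtain j x where a: "a = j \<odot>\<^bsub>N\<^esub> x" "j \<in> ?J" "x \<in> X" using a unfolding Y_def by blast
    then have "r \<odot>\<^bsub>N\<^esub> a = (r \<otimes>\<^bsub>R\<^esub> j) \<odot>\<^bsub>N\<^esub> x" using r Jc Xc by (simp add: N.smult_assoc1 subset_iff)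
    then show ?thesis using ideal.I_l_closed[OF J a(2) r] a(3) unfolding Y_def by blast
  qed
  then have JXs: "submodule (add_span N Y) R N" by (rule N.submodule_add_span[OF Yc])
  then have JX: "\<zero>\<^bsub>N\<^esub> \<in> add_span N Y"
    "\<And>x y. x \<in> add_span N Y \<Longrightarrow> y \<in> add_span N Y \<Longrightarrow> x \<oplus>\<^bsub>N\<^esub> y \<in> add_span N Y"
    "\<And>a x. a \<in> carrier R \<Longrightarrow> x \<in> add_span N Y \<Longrightarrow> a \<odot>\<^bsub>N\<^esub> x \<in> add_span N Y"
    unfolding N.submodule_iff by simp_all
  \<comment> \<open>Otherwise T X is contained in J X. As T X is all of \<open>X\<close>, Nakayama
    forces \<open>X = 0\<close>, against the given nonzero \<open>f0 p0 n0\<close>.\<close>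
  have "\<exists>f\<in>?H. \<exists>p\<in>carrier P. \<exists>x\<in>X. f p \<odot>\<^bsub>N\<^esub> x \<notin> add_span N Y"
  proof (rule ccontr)
    assume "\<not> ?thesis"
    then have in_JX: "f p \<odot>\<^bsub>N\<^esub> x \<in> add_span N Y" if "f \<in> ?H" "p \<in> carrier P" "x \<in> X" for f p x
      using that by blast
    have X'JX: "f p \<odot>\<^bsub>N\<^esub> n \<in> add_span N Y" if f: "f \<in> ?H" and p: "p \<in> carrier P" and n: "n \<in> carrier N" for f p n
    proof -
      \<comment> \<open>Idempotence of the trace: expanding \<open>p\<close> by a dual basis writes
        \<open>f(p) n\<close> as a sum of \<open>f(q) (g(p) n)\<close>, where \<open>g(p) n\<close>
        is already in \<open>X\<close>.\<close>
      let ?A = "{g p \<odot>\<^bsub>P\<^esub> q | g q. g \<in> ?H \<and> q \<in> carrier P}"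
      have Ac: "?A \<subseteq> carrier P"
        using Hc[OF _ p] left_module.smult_closed[OF PM] by auto
      have "f q \<odot>\<^bsub>N\<^esub> n \<in> add_span N Y" if "q \<in> add_span P ?A" for q
        using that
      proof induction
        case zero
        show ?case using mod_hom_zero[OF PM reg f] n JX(1) by (simp add: N.smult_l_null)
      next
        case (add a y)
        then obtain g q where a: "a = g p \<odot>\<^bsub>P\<^esub> q" "g \<in> ?H" "q \<in> carrier P" by blast
        have "f a = f q \<otimes>\<^bsub>R\<^esub> g p" using mod_homD(3)[OF f _ a(3)] Hc[OF a(2) p] a(1) by simp
        then have "f a \<odot>\<^bsub>N\<^esub> n = f q \<odot>\<^bsub>N\<^esub> (g p \<odot>\<^bsub>N\<^esub> n)"
          using Hc[OF f a(3)] Hc[OF a(2) p] n by (simp add: N.smult_assoc1)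
        also have "\<dots> \<in> add_span N Y" by (rule in_JX[OF f a(3) X'X[OF X'I[OF a(2) p n]]])
        finally have fa: "f a \<odot>\<^bsub>N\<^esub> n \<in> add_span N Y" .
        have c: "a \<in> carrier P" "y \<in> carrier P"
          using add Ac left_module.add_span_closed[OF PM _ Ac] by blast+
        have "f (a \<oplus>\<^bsub>P\<^esub> y) \<odot>\<^bsub>N\<^esub> n = f a \<odot>\<^bsub>N\<^esub> n \<oplus>\<^bsub>N\<^esub> f y \<odot>\<^bsub>N\<^esub> n"
          using mod_homD(2)[OF f c] Hc[OF f c(1)] Hc[OF f c(2)] n by (simp add: N.smult_l_distr)
        then show ?case using JX(2)[OF fa add(3)] by simp
      qed
      then show ?thesis using projective_dual_basis[OF P p] by blast
    qed
    have "x \<in> add_span N Y" if "x \<in> X" for x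
      using that unfolding X_def
    proof induction
      case zero
      show ?case by (rule JX(1))
    next
      case (add a x)
      then have "a \<in> add_span N Y" using X'JX unfolding X'_def by blast
      then show ?case using add(3) by (rule JX(2))
    qed
    then have "X \<subseteq> {\<zero>\<^bsub>N\<^esub>}"
      using left_T_nilpotent_nakayama[OF N _ Jc Xc] lp unfolding left_perfect_def Y_def by blast
    then show False using X'X[OF X'I[OF nz(1-3)]] nz(4) by blast
  qed
  then obtain f p x where f: "f \<in> ?H" "p \<in> carrier P" "x \<in> X" "f p \<odot>\<^bsub>N\<^esub> x \<notin> add_span N Y" by blast
  define t where "t = f p"
  have t: "t \<in> carrier R" "x \<in> carrier N" using Hc f Xc by (auto simp: t_def)
  \<comment> \<open>The annihilator of \<open>t x\<close> modulo J X. An \<open>e\<close> outside a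
    maximal left ideal containing \<open>A\<close> satisfies \<open>e t x\<close> not in J X, and
    both remaining claims follow from this.\<close>
  define A where "A = {r \<in> carrier R. r \<odot>\<^bsub>N\<^esub> (t \<odot>\<^bsub>N\<^esub> x) \<in> add_span N Y}"
  have "submodule A R (regular_module R)"
    unfolding N.R.left_ideal_iff A_def using t JX
    by (auto simp: N.smult_l_null N.smult_l_distr N.smult_assoc1)
  moreover have "\<one>\<^bsub>R\<^esub> \<notin> A" using f t by (simp add: A_def t_def)
  ultimately obtain I where I: "maximal_left_ideal R I" "A \<subseteq> I"
    by (rule N.R.proper_left_ideal_in_maximal)
  obtain e where e: "ring.local_idempotent R e" "e \<notin> I"
    by (rule N.R.ex_local_idempotent[OF lp I(1)])
  have ec: "e \<in> carrier R"
    using e(1) by (simp add: N.R.local_idempotent_def is_idempotent_def)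
  have etx: "e \<odot>\<^bsub>N\<^esub> (t \<odot>\<^bsub>N\<^esub> x) \<notin> add_span N Y" using e(2) I(2) ec by (auto simp: A_def)
  have "e \<otimes>\<^bsub>R\<^esub> t \<notin> ?J"
  proof
    assume "e \<otimes>\<^bsub>R\<^esub> t \<in> ?J"
    then have "(e \<otimes>\<^bsub>R\<^esub> t) \<odot>\<^bsub>N\<^esub> x \<in> Y" using f(3) unfolding Y_def by blast
    then show False using etx N.add_span_base[OF _ Yc] t ec by (simp add: N.smult_assoc1)
  qed
  moreover have "e \<odot>\<^bsub>N\<^esub> (t \<odot>\<^bsub>N\<^esub> x) \<noteq> \<zero>\<^bsub>N\<^esub>" using etx JX(1) by auto
  ultimately show ?thesis using e(1) f(1,2) t by (metis t_def N.smult_closed)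
qed

section \<open>Principal summands and their representatives in a basic set\<close>

lemma left_module_principal_module_opp:
  assumes R: "ring R" and S: "ring (opp R)" and e: "e \<in> carrier R"
  shows "left_module (opp R) (principal_module (opp R) e)"
proof -
  interpret ring R by fact
  have "submodule ((\<lambda>x. x \<otimes>\<^bsub>opp R\<^esub> e) ` carrier (opp R)) (opp R) (regular_module (opp R))"
    unfolding left_module.submodule_iff[OF left_module_regular_module[OF S]]
    using e by (auto simp: image_iff m_assoc r_distr[symmetric] intro: bexI[of _ "\<zero>\<^bsub>R\<^esub>"])
  from left_module_submodule[OF left_module_regular_module[OF S] this]
  show ?thesis unfolding principal_module_def .
qed

text \<open>Locality provides \<open>r\<close> with \<open>e f(q) r = e\<close>, so
  \<open>w = q r\<close> satisfies \<open>e f(w) = e\<close>. The maps x to w x and p to e f(p) then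
  split, as \<open>e f(w x) = e x = x\<close> on \<open>e R\<close>.\<close>

lemma local_idempotent_summand:
  assumes R: "ring R" and P: "left_module (opp R) P" and e: "ring.local_idempotent R e"
    and f: "f \<in> mod_hom (opp R) P (regular_module (opp R))" and q: "q \<in> carrier P"
    and efq: "e \<otimes>\<^bsub>R\<^esub> f q \<notin> jacobson_radical R"
  shows "iso_to_summand (opp R) (principal_module (opp R) e) P"
proof -
  interpret ring R by fact
  interpret P: left_module "opp R" P by fact
  have ec: "e \<in> carrier R" "e \<otimes>\<^bsub>R\<^esub> e = e" using e by (auto simp: local_idempotent_def is_idempotent_def)
  have fc: "f p \<in> carrier R" if "p \<in> carrier P" for p using mod_homD(1)[OF f that] by simp
  obtain r where r: "r \<in> carrier R" "e \<otimes>\<^bsub>R\<^esub> f q \<otimes>\<^bsub>R\<^esub> r = e"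
    using e efq fc[OF q] unfolding local_idempotent_def by blast
  define w where "w = r \<odot>\<^bsub>P\<^esub> q"
  have w: "w \<in> carrier P" "e \<otimes>\<^bsub>R\<^esub> f w = e"
    using r q P.smult_closed[of r q] mod_homD(3)[OF f _ q, of r] ec fc[OF q]
    by (simp_all add: w_def m_assoc)
  let ?U = "principal_module (opp R) e"
  have c: "x \<in> carrier R" "e \<otimes>\<^bsub>R\<^esub> x = x" if "x \<in> carrier ?U" for x
    using that ec by (auto simp flip: m_assoc)
  show ?thesis
  proof (rule iso_to_summandI[OF left_module_principal_module_opp[OF R P.R.ring_axioms ec(1)] P])
    show "(\<lambda>x. x \<odot>\<^bsub>P\<^esub> w) \<in> mod_hom (opp R) ?U P"
    proof (rule mod_homI)
      show "x \<odot>\<^bsub>P\<^esub> w \<in> carrier P" if "x \<in> carrier ?U" for x using c[OF that] w by simp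
      show "(x \<oplus>\<^bsub>?U\<^esub> y) \<odot>\<^bsub>P\<^esub> w = x \<odot>\<^bsub>P\<^esub> w \<oplus>\<^bsub>P\<^esub> y \<odot>\<^bsub>P\<^esub> w"
        if "x \<in> carrier ?U" "y \<in> carrier ?U" for x y
        using c[OF that(1)] c[OF that(2)] w P.smult_l_distr[of x y w] by simp
      show "(a \<odot>\<^bsub>?U\<^esub> x) \<odot>\<^bsub>P\<^esub> w = a \<odot>\<^bsub>P\<^esub> (x \<odot>\<^bsub>P\<^esub> w)"
        if "a \<in> carrier (opp R)" "x \<in> carrier ?U" for a x
        using c[OF that(2)] that(1) w P.smult_assoc1[of a x w] by simp
    qed
    show "(\<lambda>p. e \<otimes>\<^bsub>R\<^esub> f p) \<in> mod_hom (opp R) P ?U"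
      using ec fc by (intro mod_homI) (auto simp: mod_homD[OF f] r_distr m_assoc)
    show "e \<otimes>\<^bsub>R\<^esub> f (u \<odot>\<^bsub>P\<^esub> w) = u" if "u \<in> carrier ?U" for u
      using c[OF that] w(2) mod_homD(3)[OF f _ w(1), of u] fc[OF w(1)] ec by (simp flip: m_assoc)
  qed
qed

text \<open>An isomorphism makes \<open>e\<close> factor through \<open>e'\<close>: with
  \<open>e = \<chi>(u)\<close> and \<open>u = e' u\<close>, linearity gives
  \<open>e = \<chi>(e') e' u\<close>. If \<open>e x\<close> is not zero, then neither is
  \<open>e' (u x)\<close>.\<close>

lemma principal_module_isomorphic_nonzero:
  assumes N: "left_module R N" and S: "ring (opp R)"
    and e: "is_idempotent R e" and e': "is_idempotent R e'"
    and iso: "mod_isomorphic (opp R) (principal_module (opp R) e') (principal_module (opp R) e)"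
    and x: "x \<in> carrier N" "e \<odot>\<^bsub>N\<^esub> x \<noteq> \<zero>\<^bsub>N\<^esub>"
  shows "\<exists>y\<in>carrier N. e' \<odot>\<^bsub>N\<^esub> y \<noteq> \<zero>\<^bsub>N\<^esub>"
proof -
  interpret N: left_module R N by fact
  let ?U = "principal_module (opp R) e'" and ?V = "principal_module (opp R) e"
  have c: "e \<in> carrier R" "e \<otimes>\<^bsub>R\<^esub> e = e" "e' \<in> carrier R" "e' \<otimes>\<^bsub>R\<^esub> e' = e'"
    using e e' by (auto simp: is_idempotent_def)
  obtain \<chi> where \<chi>: "\<chi> \<in> mod_hom (opp R) ?U ?V" "bij_betw \<chi> (carrier ?U) (carrier ?V)"
    using iso unfolding mod_isomorphic_def by blast
  have "e \<in> carrier ?V" "e' \<in> carrier ?U" using c by (auto simp: image_iff intro: bexI[of _ e] bexI[of _ e'])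
  then obtain u where u: "u \<in> carrier ?U" "e = \<chi> u" using \<chi>(2) unfolding bij_betw_def by blast
  have uc: "u \<in> carrier R" "e' \<otimes>\<^bsub>R\<^esub> u = u" using u(1) c by (auto simp flip: N.R.m_assoc)
  have a: "\<chi> e' \<in> carrier R" using mod_homD(1)[OF \<chi>(1) \<open>e' \<in> carrier ?U\<close>] c by auto
  have "e = \<chi> e' \<otimes>\<^bsub>R\<^esub> u"
    using mod_homD(3)[OF \<chi>(1) _ \<open>e' \<in> carrier ?U\<close>, of u] uc u(2) by simp
  then have "e = \<chi> e' \<otimes>\<^bsub>R\<^esub> (e' \<otimes>\<^bsub>R\<^esub> u)" by (simp only: uc(2))
  then have "e \<odot>\<^bsub>N\<^esub> x = \<chi> e' \<odot>\<^bsub>N\<^esub> (e' \<odot>\<^bsub>N\<^esub> (u \<odot>\<^bsub>N\<^esub> x))"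
    using a c uc(1) x by (simp add: N.smult_assoc1)
  then have "e' \<odot>\<^bsub>N\<^esub> (u \<odot>\<^bsub>N\<^esub> x) \<noteq> \<zero>\<^bsub>N\<^esub>" using x(2) a by (auto simp: N.smult_r_null)
  then show ?thesis using uc x by blast
qed

text \<open>The definition of a basic set quantifies over modules of type \<open>nat \<Rightarrow> 'a\<close> only, so \<open>e R\<close> is
  copied into the free module of rank one inside that type.\<close>
lemma basic_set_local_idempotent:
  fixes R :: "('a, 'r) ring_scheme"
  assumes R: "ring R" and S: "ring (opp R)" and E: "basic_set R E" and e: "ring.local_idempotent R e"
  obtains e' where "e' \<in> E"
    "mod_isomorphic (opp R) (principal_module (opp R) e') (principal_module (opp R) e)"
proof -
  interpret ring R by fact
  let ?S = "opp R" and ?J = "jacobson_radical R"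
  let ?U = "principal_module ?S e"
  have eJ: "e \<notin> ?J" and ey: "\<And>y. y \<in> carrier R \<Longrightarrow> e \<otimes>\<^bsub>R\<^esub> y \<notin> ?J \<Longrightarrow> \<exists>r\<in>carrier R. e \<otimes>\<^bsub>R\<^esub> y \<otimes>\<^bsub>R\<^esub> r = e"
    and ec: "e \<in> carrier R" "e \<otimes>\<^bsub>R\<^esub> e = e"
    using e by (auto simp: local_idempotent_def is_idempotent_def)
  note Jadd = additive_subgroup.a_closed[OF ideal.axioms(1)[OF ideal_jacobson_radical]]
  have e0: "e \<noteq> \<zero>\<^bsub>R\<^esub>"
    using eJ additive_subgroup.zero_closed[OF ideal.axioms(1)[OF ideal_jacobson_radical]] by auto
  have UM: "left_module ?S ?U" by (rule left_module_principal_module_opp[OF R S ec(1)])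
  have c: "x \<in> carrier R" "e \<otimes>\<^bsub>R\<^esub> x = x" if "x \<in> carrier ?U" for x
    using that ec by (auto simp flip: m_assoc)
  have eU: "e \<in> carrier ?U" using ec by (auto simp: image_iff intro: bexI[of _ e])
  \<comment> \<open>Ring elements are placed at index 0, so that \<open>e R\<close> becomes a module
    of functions on \<open>nat\<close>.\<close>
  define \<iota> where "\<iota> x = (\<lambda>n::nat. if n = 0 then x else \<zero>\<^bsub>R\<^esub>)" for x
  let ?G = "free_module ?S {0::nat}"
  have GM: "left_module ?S ?G" by (rule left_module_free_module[OF S])
  have \<iota>hom: "\<iota> \<in> mod_hom ?S ?U ?G"
  proof (rule mod_homI)
    show "\<iota> x \<in> carrier ?G" if "x \<in> carrier ?U" for x
      using c[OF that] by (auto simp: \<iota>_def free_module_def)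
    show "\<iota> (x \<oplus>\<^bsub>?U\<^esub> y) = \<iota> x \<oplus>\<^bsub>?G\<^esub> \<iota> y" for x y
      by (auto simp: \<iota>_def free_module_def)
    show "\<iota> (a \<odot>\<^bsub>?U\<^esub> x) = a \<odot>\<^bsub>?G\<^esub> \<iota> x" if "a \<in> carrier ?S" for a x
      using that by (auto simp: \<iota>_def free_module_def)
  qed
  have \<iota>inj: "\<iota> x = \<iota> y \<longleftrightarrow> x = y" for x y by (auto simp: \<iota>_def fun_eq_iff)
  have \<iota>0: "\<iota> x 0 = x" for x by (simp add: \<iota>_def)
  define P where "P = ?G\<lparr>carrier := \<iota> ` carrier ?U\<rparr>"
  have "submodule (\<iota> ` carrier ?U) ?S ?G"
    unfolding left_module.submodule_iff[OF GM]
  proof (intro conjI ballI)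
    show "\<iota> ` carrier ?U \<subseteq> carrier ?G" using mod_homD(1)[OF \<iota>hom] by blast
    have "\<zero>\<^bsub>?U\<^esub> \<in> carrier ?U" by (rule abelian_groupE(2)[OF left_module.axioms(2)[OF UM]])
    then show "\<zero>\<^bsub>?G\<^esub> \<in> \<iota> ` carrier ?U" using mod_hom_zero[OF UM GM \<iota>hom] by (metis imageI)
    fix u assume "u \<in> \<iota> ` carrier ?U"
    then obtain x where x: "x \<in> carrier ?U" "u = \<iota> x" by blast
    show "u \<oplus>\<^bsub>?G\<^esub> v \<in> \<iota> ` carrier ?U" if v: "v \<in> \<iota> ` carrier ?U" for v
    proof -
      obtain y where y: "y \<in> carrier ?U" "v = \<iota> y" using v by blast
      have "x \<oplus>\<^bsub>?U\<^esub> y \<in> carrier ?U"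
        by (rule abelian_groupE(1)[OF left_module.axioms(2)[OF UM] x(1) y(1)])
      then show ?thesis using mod_homD(2)[OF \<iota>hom x(1) y(1)] x y by (metis imageI)
    qed
    show "a \<odot>\<^bsub>?G\<^esub> u \<in> \<iota> ` carrier ?U" if "a \<in> carrier ?S" for a
      using mod_homD(3)[OF \<iota>hom that x(1)] left_module.smult_closed[OF UM that x(1)] x(2) by (metis imageI)
  qed
  then have PM: "left_module ?S P" unfolding P_def by (rule left_module_submodule[OF GM])
  have Pc: "carrier P = \<iota> ` carrier ?U" by (simp add: P_def)
  have Padd: "\<iota> x \<oplus>\<^bsub>P\<^esub> \<iota> y = \<iota> (x \<oplus>\<^bsub>R\<^esub> y)" and Psm: "a \<in> carrier R \<Longrightarrow> a \<odot>\<^bsub>P\<^esub> \<iota> x = \<iota> (x \<otimes>\<^bsub>R\<^esub> a)"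
    and P0: "\<zero>\<^bsub>P\<^esub> = \<iota> \<zero>\<^bsub>R\<^esub>" for a x y
    by (auto simp: P_def free_module_def \<iota>_def)
  have iso: "mod_isomorphic ?S ?U P"
    unfolding mod_isomorphic_def
  proof
    show "\<iota> \<in> mod_hom ?S ?U P"
      by (rule mod_homI) (auto simp: Pc Padd Psm)
    show "bij_betw \<iota> (carrier ?U) (carrier P)" by (auto simp: bij_betw_def inj_on_def Pc \<iota>inj)
  qed
  \<comment> \<open>The definition of \<open>projective\<close> takes indices from the element type
    of \<open>P\<close>, here \<open>nat \<Rightarrow> 'a\<close>. Rank one needs a single index,
    and any function serves.\<close>
  define k :: "nat \<Rightarrow> 'a" where "k = (\<lambda>_. undefined)"
  let ?F = "free_module ?S {k}"
  have "iso_to_summand ?S P ?F"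
  proof (rule iso_to_summandI[OF PM left_module_free_module[OF S]])
    show "(\<lambda>u i. if i = k then u 0 else \<zero>\<^bsub>R\<^esub>) \<in> mod_hom ?S P ?F"
    proof (rule mod_homI)
      fix u assume "u \<in> carrier P"
      then obtain x where x: "x \<in> carrier ?U" "u = \<iota> x" unfolding Pc by blast
      have "finite {i. (if i = k then x else \<zero>\<^bsub>R\<^esub>) \<noteq> \<zero>\<^bsub>R\<^esub>}"
        by (rule finite_subset[of _ "{k}"]) auto
      then show "(\<lambda>i. if i = k then u 0 else \<zero>\<^bsub>R\<^esub>) \<in> carrier ?F"
        using c(1)[OF x(1)] x(2) by (simp add: free_module_def \<iota>0)
      show "(\<lambda>i. if i = k then (u \<oplus>\<^bsub>P\<^esub> v) 0 else \<zero>\<^bsub>R\<^esub>) =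
          (\<lambda>i. if i = k then u 0 else \<zero>\<^bsub>R\<^esub>) \<oplus>\<^bsub>?F\<^esub> (\<lambda>i. if i = k then v 0 else \<zero>\<^bsub>R\<^esub>)"
        if "v \<in> carrier P" for v
        using that x(2) unfolding Pc by (auto simp: Padd \<iota>0 free_module_def)
      show "(\<lambda>i. if i = k then (a \<odot>\<^bsub>P\<^esub> u) 0 else \<zero>\<^bsub>R\<^esub>) =
          a \<odot>\<^bsub>?F\<^esub> (\<lambda>i. if i = k then u 0 else \<zero>\<^bsub>R\<^esub>)"
        if "a \<in> carrier ?S" for a
        using that x(2) by (auto simp: Psm \<iota>0 free_module_def)
    qed
    show "(\<lambda>w. \<iota> (e \<otimes>\<^bsub>R\<^esub> w k)) \<in> mod_hom ?S ?F P"
      by (rule mod_homI) (use ec in \<open>auto simp: Pc Padd Psm \<iota>inj free_module_def r_distr m_assoc\<close>)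
    show "\<iota> (e \<otimes>\<^bsub>R\<^esub> (if k = k then u 0 else \<zero>\<^bsub>R\<^esub>)) = u" if u: "u \<in> carrier P" for u
    proof -
      obtain x where x: "x \<in> carrier ?U" "u = \<iota> x" using u unfolding Pc by blast
      show ?thesis unfolding x(2) using c(2)[OF x(1)] by (simp only: \<iota>0 if_True refl)
    qed
  qed
  then have "projective ?S P" using PM unfolding projective_def by blast
  moreover have "indecomposable ?S P"
    unfolding indecomposable_def
  proof (intro conjI allI impI)
    have "\<iota> e \<in> carrier P" "\<iota> e \<noteq> \<zero>\<^bsub>P\<^esub>" using eU e0 by (simp_all only: Pc P0 \<iota>inj imageI not_False_eq_True)
    then show "carrier P \<noteq> {\<zero>\<^bsub>P\<^esub>}" by blast
    fix A B assume AB: "direct_decomp ?S P A B"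
    have sub: "submodule A ?S P" "submodule B ?S P" and int: "A \<inter> B = {\<zero>\<^bsub>P\<^esub>}" and sum: "A <+>\<^bsub>P\<^esub> B = carrier P"
      using AB by (auto simp: direct_decomp_def)
    have Ac: "A \<subseteq> carrier P" "\<And>a x. a \<in> carrier R \<Longrightarrow> x \<in> A \<Longrightarrow> a \<odot>\<^bsub>P\<^esub> x \<in> A"
      and Bc: "B \<subseteq> carrier P" "\<And>a x. a \<in> carrier R \<Longrightarrow> x \<in> B \<Longrightarrow> a \<odot>\<^bsub>P\<^esub> x \<in> B"
      using sub unfolding left_module.submodule_iff[OF PM] by auto
    \<comment> \<open>By locality a submodule with an element outside \<open>J\<close> contains
      \<open>e\<close> and is everything. When \<open>e = a + b\<close> along a decomposition,
      \<open>a\<close> and \<open>b\<close> cannot both be in \<open>J\<close>, so one summand is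
      the whole and the other is zero.\<close>
    have gen: "L = carrier P"
      if L: "L \<subseteq> carrier P" "\<And>a x. a \<in> carrier R \<Longrightarrow> x \<in> L \<Longrightarrow> a \<odot>\<^bsub>P\<^esub> x \<in> L"
        and x: "x \<in> carrier ?U" "\<iota> x \<in> L" "x \<notin> ?J" for L x
    proof -
      obtain r where r: "r \<in> carrier R" "x \<otimes>\<^bsub>R\<^esub> r = e" using ey[of x] c[OF x(1)] x(3) by auto
      have eL: "\<iota> e \<in> L" using L(2)[OF r(1) x(2)] Psm[OF r(1)] r(2) by simp
      have "\<iota> y \<in> L" if y: "y \<in> carrier ?U" for y
        using L(2)[OF c(1)[OF y] eL] Psm[OF c(1)[OF y]] c(2)[OF y] by simp
      then show ?thesis using L(1) unfolding Pc by blast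
    qed
    have "\<iota> e \<in> A <+>\<^bsub>P\<^esub> B" unfolding sum Pc using eU by blast
    then obtain u v where "u \<in> A" "v \<in> B" "\<iota> e = u \<oplus>\<^bsub>P\<^esub> v" by (auto simp: set_add_def set_mult_def)
    moreover obtain a b where "a \<in> carrier ?U" "u = \<iota> a" "b \<in> carrier ?U" "v = \<iota> b"
      using Ac(1) Bc(1) calculation unfolding Pc by blast
    ultimately have ab: "a \<in> carrier ?U" "\<iota> a \<in> A" "b \<in> carrier ?U" "\<iota> b \<in> B" "e = a \<oplus>\<^bsub>R\<^esub> b"
      by (simp_all only: Padd \<iota>inj)
    show "A = {\<zero>\<^bsub>P\<^esub>} \<or> B = {\<zero>\<^bsub>P\<^esub>}"
    proof (cases "a \<in> ?J")
      case True
      then have "b \<notin> ?J" using Jadd ab(5) eJ by blast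
      then have "B = carrier P" using gen[OF Bc ab(3,4)] by simp
      then show ?thesis using int Ac(1) by blast
    next
      case False
      then have "A = carrier P" using gen[OF Ac ab(1,2)] by simp
      then show ?thesis using int Bc(1) by blast
    qed
  qed
  ultimately have "\<exists>!e'. e' \<in> E \<and> mod_isomorphic ?S P (principal_module ?S e')"
    using E unfolding basic_set_def by simp
  then obtain e' where "e' \<in> E" "mod_isomorphic ?S P (principal_module ?S e')" by blast
  then show ?thesis
    using that mod_isomorphic_sym[OF UM mod_isomorphic_trans[OF iso]] by blast
qed

section \<open>Comparison of projective resolutions\<close>

lemma mod_hom_minus:
  assumes V: "left_module S V" and f: "f \<in> mod_hom S U V" and g: "g \<in> mod_hom S U V"
  shows "(\<lambda>x. f x \<ominus>\<^bsub>V\<^esub> g x) \<in> mod_hom S U V"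
proof -
  interpret V: left_module S V by fact
  have "(\<lambda>x. (\<ominus>\<^bsub>S\<^esub> \<one>\<^bsub>S\<^esub>) \<odot>\<^bsub>V\<^esub> g x) \<in> mod_hom S U V"
  proof (rule mod_homI)
    fix a x assume ax: "a \<in> carrier S" "x \<in> carrier U"
    then have "(\<ominus>\<^bsub>S\<^esub> \<one>\<^bsub>S\<^esub>) \<odot>\<^bsub>V\<^esub> (a \<odot>\<^bsub>V\<^esub> g x) = a \<odot>\<^bsub>V\<^esub> ((\<ominus>\<^bsub>S\<^esub> \<one>\<^bsub>S\<^esub>) \<odot>\<^bsub>V\<^esub> g x)"
      using mod_homD(1)[OF g] by (simp flip: V.smult_assoc1 add: V.R.l_minus V.R.r_minus)
    then show "(\<ominus>\<^bsub>S\<^esub> \<one>\<^bsub>S\<^esub>) \<odot>\<^bsub>V\<^esub> g (a \<odot>\<^bsub>U\<^esub> x) = a \<odot>\<^bsub>V\<^esub> ((\<ominus>\<^bsub>S\<^esub> \<one>\<^bsub>S\<^esub>) \<odot>\<^bsub>V\<^esub> g x)"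
      using ax by (simp add: mod_homD[OF g])
  qed (simp_all add: mod_homD[OF g] V.smult_r_distr)
  from mod_hom_add[OF V f this]
  have h: "(\<lambda>x. f x \<oplus>\<^bsub>V\<^esub> (\<ominus>\<^bsub>S\<^esub> \<one>\<^bsub>S\<^esub>) \<odot>\<^bsub>V\<^esub> g x) \<in> mod_hom S U V" .
  have eq: "f x \<oplus>\<^bsub>V\<^esub> (\<ominus>\<^bsub>S\<^esub> \<one>\<^bsub>S\<^esub>) \<odot>\<^bsub>V\<^esub> g x = f x \<ominus>\<^bsub>V\<^esub> g x" if "x \<in> carrier U" for x
    using that mod_homD(1)[OF g] by (simp add: a_minus_def V.smult_l_minus)
  show ?thesis
  proof (rule mod_homI)
    fix x assume x: "x \<in> carrier U"
    show "f x \<ominus>\<^bsub>V\<^esub> g x \<in> carrier V" using x mod_homD(1)[OF f] mod_homD(1)[OF g] by simp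
    show "f (x \<oplus>\<^bsub>U\<^esub> y) \<ominus>\<^bsub>V\<^esub> g (x \<oplus>\<^bsub>U\<^esub> y) = (f x \<ominus>\<^bsub>V\<^esub> g x) \<oplus>\<^bsub>V\<^esub> (f y \<ominus>\<^bsub>V\<^esub> g y)" if y: "y \<in> carrier U" for y
      using x y mod_homD[OF f] mod_homD[OF g] by (simp add: a_minus_def V.M.minus_add V.M.a_ac)
    show "f (a \<odot>\<^bsub>U\<^esub> x) \<ominus>\<^bsub>V\<^esub> g (a \<odot>\<^bsub>U\<^esub> x) = a \<odot>\<^bsub>V\<^esub> (f x \<ominus>\<^bsub>V\<^esub> g x)" if a: "a \<in> carrier S" for a
      using mod_homD(3)[OF h a x] eq[OF x] mod_homD[OF f] mod_homD[OF g] a x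
      by (simp add: a_minus_def V.smult_l_minus)
  qed
qed

lemma projective_resolutionD:
  assumes "projective_resolution S U P d \<epsilon>"
  shows "projective S (P n)" "left_module S (P n)"
    and "\<epsilon> \<in> mod_hom S (P 0) U" "d n \<in> mod_hom S (P (Suc n)) (P n)"
    and "\<epsilon> ` carrier (P 0) = carrier U"
    and "d 0 ` carrier (P (Suc 0)) = {p \<in> carrier (P 0). \<epsilon> p = \<zero>\<^bsub>U\<^esub>}"
    and "d (Suc n) ` carrier (P (Suc (Suc n))) = {p \<in> carrier (P (Suc n)). d n p = \<zero>\<^bsub>P n\<^esub>}"
  using assms by (simp_all add: projective_resolution_def projective_def)

lemma projective_resolution_dd:
  assumes "projective_resolution S U P d \<epsilon>" "x \<in> carrier (P (Suc (Suc n)))"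
  shows "d n (d (Suc n) x) = \<zero>\<^bsub>P n\<^esub>"
  using projective_resolutionD(7)[OF assms(1), of n] assms(2) by blast

lemma projective_resolution_comparison:
  assumes U: "left_module S U" and P: "projective_resolution S U P d \<epsilon>"
    and Q: "projective_resolution S U Q d' \<epsilon>'"
  shows "\<exists>f. (\<forall>n. f n \<in> mod_hom S (P n) (Q n)) \<and> (\<forall>x\<in>carrier (P 0). \<epsilon>' (f 0 x) = \<epsilon> x) \<and>
    (\<forall>n. \<forall>x\<in>carrier (P (Suc n)). d' n (f (Suc n) x) = f n (d n x))"
proof -
  note Pd = projective_resolutionD[OF P] and Qd = projective_resolutionD[OF Q]
  \<comment> \<open>The last clause is the invariant that keeps the recursion going:
    \<open>f d\<close> takes values in the image of \<open>d'\<close>, which is what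
    \<open>projective_lift\<close> asks for in order to build the next map.\<close>
  let ?I = "\<lambda>n f. f \<in> mod_hom S (P n) (Q n) \<and> (n = 0 \<longrightarrow> (\<forall>x\<in>carrier (P 0). \<epsilon>' (f x) = \<epsilon> x)) \<and>
    (\<forall>x\<in>carrier (P (Suc n)). f (d n x) \<in> d' n ` carrier (Q (Suc n)))"
  have "\<exists>f. \<forall>n. ?I n (f n) \<and> (\<forall>x\<in>carrier (P (Suc n)). d' n (f (Suc n) x) = f n (d n x))"
  proof (rule dependent_nat_choice)
    obtain f where f: "f \<in> mod_hom S (P 0) (Q 0)" "\<And>p. p \<in> carrier (P 0) \<Longrightarrow> \<epsilon>' (f p) = \<epsilon> p"
      using projective_lift[OF Pd(1) Qd(2) U Pd(3) Qd(3)] mod_homD(1)[OF Pd(3)] Qd(5) by metis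
    have "f (d 0 x) \<in> d' 0 ` carrier (Q (Suc 0))" if "x \<in> carrier (P (Suc 0))" for x
    proof -
      have "d 0 x \<in> d 0 ` carrier (P (Suc 0))" using that by blast
      then have "d 0 x \<in> carrier (P 0)" "\<epsilon> (d 0 x) = \<zero>\<^bsub>U\<^esub>" unfolding Pd(6) by auto
      then show ?thesis unfolding Qd(6) using f mod_homD(1)[OF f(1)] by simp
    qed
    then show "\<exists>f. ?I 0 f" using f by blast
    fix f n assume I: "?I n f"
    then have f: "f \<in> mod_hom S (P n) (Q n)" by blast
    obtain f' where f': "f' \<in> mod_hom S (P (Suc n)) (Q (Suc n))"
      "\<And>x. x \<in> carrier (P (Suc n)) \<Longrightarrow> d' n (f' x) = f (d n x)"
      using projective_lift[OF Pd(1) Qd(2) Qd(2) mod_hom_compose[OF Pd(4) f] Qd(4)] I by metis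
    have "f' (d (Suc n) x) \<in> d' (Suc n) ` carrier (Q (Suc (Suc n)))" if x: "x \<in> carrier (P (Suc (Suc n)))" for x
    proof -
      have dx: "d (Suc n) x \<in> carrier (P (Suc n))" by (rule mod_homD(1)[OF Pd(4) x])
      have "d' n (f' (d (Suc n) x)) = \<zero>\<^bsub>Q n\<^esub>"
        using f'(2)[OF dx] projective_resolution_dd[OF P x] mod_hom_zero[OF Pd(2) Qd(2) f] by simp
      then show ?thesis unfolding Qd(7) using mod_homD(1)[OF f'(1) dx] by simp
    qed
    then show "\<exists>f'. ?I (Suc n) f' \<and> (\<forall>x\<in>carrier (P (Suc n)). d' n (f' x) = f (d n x))"
      using f' by (intro exI[of _ f']) simp
  qed
  then obtain f where "\<forall>n. ?I n (f n) \<and> (\<forall>x\<in>carrier (P (Suc n)). d' n (f (Suc n) x) = f n (d n x))"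
    by (elim exE)
  then show ?thesis by (intro exI[of _ f]) simp
qed

text \<open>The maps \<open>s\<close> are lifted degree by degree: \<open>\<phi> - s d\<close> is
  killed by the differential, so by exactness it takes values in the image of the next one. The
  start is that \<open>\<phi> 0\<close> takes values in the kernel of
  \<open>\<epsilon>\<close>.\<close>

lemma projective_resolution_homotopy:
  assumes U: "left_module S U" and Q: "projective_resolution S U Q d \<epsilon>"
    and \<phi>: "\<And>n. \<phi> n \<in> mod_hom S (Q n) (Q n)"
    and \<phi>d: "\<And>n x. x \<in> carrier (Q (Suc n)) \<Longrightarrow> d n (\<phi> (Suc n) x) = \<phi> n (d n x)"
    and \<phi>\<epsilon>: "\<And>x. x \<in> carrier (Q 0) \<Longrightarrow> \<epsilon> (\<phi> 0 x) = \<zero>\<^bsub>U\<^esub>"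
  shows "\<exists>s. (\<forall>n. s n \<in> mod_hom S (Q n) (Q (Suc n))) \<and>
    (\<forall>n. \<forall>x\<in>carrier (Q (Suc n)). d (Suc n) (s (Suc n) x) = \<phi> (Suc n) x \<ominus>\<^bsub>Q (Suc n)\<^esub> s n (d n x))"
proof -
  note Qd = projective_resolutionD[OF Q]
  \<comment> \<open>The condition \<open>d s d = \<phi> d\<close> says that
    \<open>\<phi> - s d\<close> one degree higher lands in the kernel of \<open>d\<close>. It has
    the same form for all n: in positive degrees \<open>d s\<close> differs from
    \<open>\<phi>\<close> by a term that vanishes on the image of \<open>d\<close>.\<close>
  let ?I = "\<lambda>n s. s \<in> mod_hom S (Q n) (Q (Suc n)) \<and> (\<forall>x\<in>carrier (Q (Suc n)). d n (s (d n x)) = \<phi> n (d n x))"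
  have "\<exists>s. \<forall>n. ?I n (s n) \<and>
    (\<forall>x\<in>carrier (Q (Suc n)). d (Suc n) (s (Suc n) x) = \<phi> (Suc n) x \<ominus>\<^bsub>Q (Suc n)\<^esub> s n (d n x))"
  proof (rule dependent_nat_choice)
    have "\<phi> 0 p \<in> d 0 ` carrier (Q (Suc 0))" if "p \<in> carrier (Q 0)" for p
      unfolding Qd(6) using that \<phi>\<epsilon> mod_homD(1)[OF \<phi>] by simp
    then obtain s where s: "s \<in> mod_hom S (Q 0) (Q (Suc 0))" "\<And>p. p \<in> carrier (Q 0) \<Longrightarrow> d 0 (s p) = \<phi> 0 p"
      using projective_lift[OF Qd(1) Qd(2) Qd(2) \<phi> Qd(4)] by metis
    then show "\<exists>s. ?I 0 s" using mod_homD(1)[OF Qd(4)] by (intro exI[of _ s]) blast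
    fix s n assume I: "?I n s"
    then have s: "s \<in> mod_hom S (Q n) (Q (Suc n))" by blast
    interpret Qn: left_module S "Q n" by (rule Qd(2))
    interpret Qs: left_module S "Q (Suc n)" by (rule Qd(2))
    have h: "(\<lambda>x. \<phi> (Suc n) x \<ominus>\<^bsub>Q (Suc n)\<^esub> s (d n x)) \<in> mod_hom S (Q (Suc n)) (Q (Suc n))"
      by (rule mod_hom_minus[OF Qd(2) \<phi> mod_hom_compose[OF Qd(4) s]])
    have "\<phi> (Suc n) x \<ominus>\<^bsub>Q (Suc n)\<^esub> s (d n x) \<in> d (Suc n) ` carrier (Q (Suc (Suc n)))"
      if x: "x \<in> carrier (Q (Suc n))" for x
    proof -
      have c: "\<phi> (Suc n) x \<in> carrier (Q (Suc n))" "d n x \<in> carrier (Q n)" "s (d n x) \<in> carrier (Q (Suc n))"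
        "\<phi> n (d n x) \<in> carrier (Q n)"
        using x mod_homD(1)[OF \<phi>] mod_homD(1)[OF Qd(4)] mod_homD(1)[OF s] by auto
      have "\<phi> (Suc n) x \<ominus>\<^bsub>Q (Suc n)\<^esub> s (d n x) = \<phi> (Suc n) x \<oplus>\<^bsub>Q (Suc n)\<^esub> (\<ominus>\<^bsub>S\<^esub> \<one>\<^bsub>S\<^esub>) \<odot>\<^bsub>Q (Suc n)\<^esub> s (d n x)"
        using c by (simp add: a_minus_def Qs.smult_l_minus)
      then have "d n (\<phi> (Suc n) x \<ominus>\<^bsub>Q (Suc n)\<^esub> s (d n x)) =
          d n (\<phi> (Suc n) x) \<oplus>\<^bsub>Q n\<^esub> (\<ominus>\<^bsub>S\<^esub> \<one>\<^bsub>S\<^esub>) \<odot>\<^bsub>Q n\<^esub> d n (s (d n x))"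
        using c by (simp add: mod_homD[OF Qd(4)])
      also have "\<dots> = \<phi> n (d n x) \<oplus>\<^bsub>Q n\<^esub> (\<ominus>\<^bsub>S\<^esub> \<one>\<^bsub>S\<^esub>) \<odot>\<^bsub>Q n\<^esub> \<phi> n (d n x)"
        using \<phi>d[OF x] I x by simp
      also have "\<dots> = \<zero>\<^bsub>Q n\<^esub>" using c by (simp add: Qn.smult_l_minus Qn.M.r_neg)
      finally show ?thesis unfolding Qd(7) using c by simp
    qed
    then obtain s' where s': "s' \<in> mod_hom S (Q (Suc n)) (Q (Suc (Suc n)))"
      "\<And>x. x \<in> carrier (Q (Suc n)) \<Longrightarrow> d (Suc n) (s' x) = \<phi> (Suc n) x \<ominus>\<^bsub>Q (Suc n)\<^esub> s (d n x)"
      using projective_lift[OF Qd(1) Qd(2) Qd(2) h Qd(4)] by metis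
    have "d (Suc n) (s' (d (Suc n) x)) = \<phi> (Suc n) (d (Suc n) x)" if x: "x \<in> carrier (Q (Suc (Suc n)))" for x
    proof -
      have c: "d (Suc n) x \<in> carrier (Q (Suc n))" by (rule mod_homD(1)[OF Qd(4) x])
      have "s (d n (d (Suc n) x)) = \<zero>\<^bsub>Q (Suc n)\<^esub>"
        using projective_resolution_dd[OF Q x] mod_hom_zero[OF Qd(2) Qd(2) s] by simp
      then show ?thesis using s'(2)[OF c] mod_homD(1)[OF \<phi> c] by (simp add: a_minus_def)
    qed
    then show "\<exists>s'. ?I (Suc n) s' \<and>
      (\<forall>x\<in>carrier (Q (Suc n)). d (Suc n) (s' x) = \<phi> (Suc n) x \<ominus>\<^bsub>Q (Suc n)\<^esub> s (d n x))"
      using s' by (intro exI[of _ s']) simp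
  qed
  then obtain s where "\<forall>n. ?I n (s n) \<and>
    (\<forall>x\<in>carrier (Q (Suc n)). d (Suc n) (s (Suc n) x) = \<phi> (Suc n) x \<ominus>\<^bsub>Q (Suc n)\<^esub> s n (d n x))"
    by (elim exE)
  then show ?thesis by (intro exI[of _ s]) simp
qed

text \<open>The identity of one resolution is homotopic to an endomorphism that factors through any other.\<close>
lemma projective_resolution_factor:
  assumes U: "left_module S U" and P: "projective_resolution S U P d \<epsilon>"
    and Q: "projective_resolution S U Q d' \<epsilon>'"
  obtains f g s where "\<And>n. f n \<in> mod_hom S (Q n) (P n)" "\<And>n. g n \<in> mod_hom S (P n) (Q n)"
    "\<And>n. s n \<in> mod_hom S (Q n) (Q (Suc n))"
    "\<And>n x. x \<in> carrier (Q (Suc n)) \<Longrightarrow>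
      x = g (Suc n) (f (Suc n) x) \<oplus>\<^bsub>Q (Suc n)\<^esub> (d' (Suc n) (s (Suc n) x) \<oplus>\<^bsub>Q (Suc n)\<^esub> s n (d' n x))"
proof -
  note Pd = projective_resolutionD[OF P] and Qd = projective_resolutionD[OF Q]
  interpret U: left_module S U by fact
  from projective_resolution_comparison[OF U Q P] obtain f where
    "(\<forall>n. f n \<in> mod_hom S (Q n) (P n)) \<and> (\<forall>x\<in>carrier (Q 0). \<epsilon> (f 0 x) = \<epsilon>' x) \<and>
    (\<forall>n. \<forall>x\<in>carrier (Q (Suc n)). d n (f (Suc n) x) = f n (d' n x))" by (elim exE)
  then have f: "\<And>n. f n \<in> mod_hom S (Q n) (P n)" "\<And>x. x \<in> carrier (Q 0) \<Longrightarrow> \<epsilon> (f 0 x) = \<epsilon>' x"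
    "\<And>n x. x \<in> carrier (Q (Suc n)) \<Longrightarrow> d n (f (Suc n) x) = f n (d' n x)" by simp_all
  from projective_resolution_comparison[OF U P Q] obtain g where
    "(\<forall>n. g n \<in> mod_hom S (P n) (Q n)) \<and> (\<forall>x\<in>carrier (P 0). \<epsilon>' (g 0 x) = \<epsilon> x) \<and>
    (\<forall>n. \<forall>x\<in>carrier (P (Suc n)). d' n (g (Suc n) x) = g n (d n x))" by (elim exE)
  then have g: "\<And>n. g n \<in> mod_hom S (P n) (Q n)" "\<And>x. x \<in> carrier (P 0) \<Longrightarrow> \<epsilon>' (g 0 x) = \<epsilon> x"
    "\<And>n x. x \<in> carrier (P (Suc n)) \<Longrightarrow> d' n (g (Suc n) x) = g n (d n x)" by simp_all
  have gf: "(\<lambda>x. g n (f n x)) \<in> mod_hom S (Q n) (Q n)" for n by (rule mod_hom_compose[OF f(1) g(1)])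
  \<comment> \<open>Both \<open>g f\<close> and the identity lie over the identity of
    \<open>U\<close>, so their difference lies over zero and is null-homotopic.\<close>
  define \<phi> where "\<phi> n = (\<lambda>x. x \<ominus>\<^bsub>Q n\<^esub> g n (f n x))" for n
  have id: "(\<lambda>x. x) \<in> mod_hom S (Q n) (Q n)" for n by (rule mod_homI) simp_all
  have \<phi>: "\<phi> n \<in> mod_hom S (Q n) (Q n)" for n
    unfolding \<phi>_def by (rule mod_hom_minus[OF Qd(2) id gf])
  have hminus: "h (x \<ominus>\<^bsub>V\<^esub> y) = h x \<ominus>\<^bsub>W\<^esub> h y"
    if h: "h \<in> mod_hom S V W" and V: "left_module S V" and W: "left_module S W" and xy: "x \<in> carrier V" "y \<in> carrier V"
    for h V W x y
  proof -
    interpret V: left_module S V by fact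
    interpret W: left_module S W by fact
    have "x \<ominus>\<^bsub>V\<^esub> y = x \<oplus>\<^bsub>V\<^esub> (\<ominus>\<^bsub>S\<^esub> \<one>\<^bsub>S\<^esub>) \<odot>\<^bsub>V\<^esub> y" using xy by (simp add: a_minus_def V.smult_l_minus)
    then show ?thesis using xy by (simp add: mod_homD[OF h] a_minus_def W.smult_l_minus)
  qed
  have "\<exists>s. (\<forall>n. s n \<in> mod_hom S (Q n) (Q (Suc n))) \<and>
    (\<forall>n. \<forall>x\<in>carrier (Q (Suc n)). d' (Suc n) (s (Suc n) x) = \<phi> (Suc n) x \<ominus>\<^bsub>Q (Suc n)\<^esub> s n (d' n x))"
  proof (rule projective_resolution_homotopy[OF U Q \<phi>])
    show "d' n (\<phi> (Suc n) x) = \<phi> n (d' n x)" if x: "x \<in> carrier (Q (Suc n))" for n x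
      using hminus[OF Qd(4) Qd(2) Qd(2) x mod_homD(1)[OF gf x]] g(3)[OF mod_homD(1)[OF f(1) x]] f(3)[OF x]
      by (simp add: \<phi>_def)
    show "\<epsilon>' (\<phi> 0 x) = \<zero>\<^bsub>U\<^esub>" if x: "x \<in> carrier (Q 0)" for x
      using hminus[OF Qd(3) Qd(2) U x mod_homD(1)[OF gf x]] g(2)[OF mod_homD(1)[OF f(1) x]] f(2)[OF x]
        mod_homD(1)[OF Qd(3) x]
      by (simp add: \<phi>_def a_minus_def U.M.r_neg)
  qed
  then obtain s where "(\<forall>n. s n \<in> mod_hom S (Q n) (Q (Suc n))) \<and>
    (\<forall>n. \<forall>x\<in>carrier (Q (Suc n)). d' (Suc n) (s (Suc n) x) = \<phi> (Suc n) x \<ominus>\<^bsub>Q (Suc n)\<^esub> s n (d' n x))"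
    by (elim exE)
  then have s: "\<And>n. s n \<in> mod_hom S (Q n) (Q (Suc n))"
    "\<And>n x. x \<in> carrier (Q (Suc n)) \<Longrightarrow> d' (Suc n) (s (Suc n) x) = \<phi> (Suc n) x \<ominus>\<^bsub>Q (Suc n)\<^esub> s n (d' n x)" by simp_all
  have "x = g (Suc n) (f (Suc n) x) \<oplus>\<^bsub>Q (Suc n)\<^esub> (d' (Suc n) (s (Suc n) x) \<oplus>\<^bsub>Q (Suc n)\<^esub> s n (d' n x))"
    if x: "x \<in> carrier (Q (Suc n))" for n x
  proof -
    interpret Qn: left_module S "Q (Suc n)" by (rule Qd(2))
    have c: "g (Suc n) (f (Suc n) x) \<in> carrier (Q (Suc n))" "s n (d' n x) \<in> carrier (Q (Suc n))"
      using mod_homD(1)[OF gf x] mod_homD(1)[OF s(1) mod_homD(1)[OF Qd(4) x]] by simp_all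
    have *: "a = b \<oplus>\<^bsub>Q (Suc n)\<^esub> ((a \<ominus>\<^bsub>Q (Suc n)\<^esub> b) \<ominus>\<^bsub>Q (Suc n)\<^esub> c \<oplus>\<^bsub>Q (Suc n)\<^esub> c)"
      if "a \<in> carrier (Q (Suc n))" "b \<in> carrier (Q (Suc n))" "c \<in> carrier (Q (Suc n))" for a b c
    proof -
      have "b \<oplus>\<^bsub>Q (Suc n)\<^esub> ((a \<ominus>\<^bsub>Q (Suc n)\<^esub> b) \<ominus>\<^bsub>Q (Suc n)\<^esub> c \<oplus>\<^bsub>Q (Suc n)\<^esub> c) = b \<oplus>\<^bsub>Q (Suc n)\<^esub> (a \<ominus>\<^bsub>Q (Suc n)\<^esub> b)"
        using that by (simp add: a_minus_def Qn.M.a_assoc Qn.M.l_neg)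
      also have "\<dots> = a" using that by (simp add: a_minus_def Qn.M.a_lcomm Qn.M.r_neg)
      finally show ?thesis by simp
    qed
    show ?thesis using *[OF x c] s(2)[OF x] by (simp add: \<phi>_def)
  qed
  then show ?thesis using that[of f g s] f(1) g(1) s(1) by simp
qed

section \<open>Tensor products\<close>

lemma free_Abelian_group_carrier_iff: "c \<in> carrier (free_Abelian_group S) \<longleftrightarrow> Poly_Mapping.keys c \<subseteq> S"
  by simp

lemma free_Abelian_group_coset_eq_iff:
  assumes K: "subgroup K (free_Abelian_group W)"
    and a: "a \<in> carrier (free_Abelian_group W)" and b: "b \<in> carrier (free_Abelian_group W)"
  shows "K #>\<^bsub>free_Abelian_group W\<^esub> a = K #>\<^bsub>free_Abelian_group W\<^esub> b \<longleftrightarrow> a - b \<in> K"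
proof
  let ?F = "free_Abelian_group W"
  interpret F: group ?F by simp
  { assume "K #>\<^bsub>?F\<^esub> a = K #>\<^bsub>?F\<^esub> b"
    then have "a \<in> K #>\<^bsub>?F\<^esub> b" using F.rcos_self[OF a K] by simp
    then show "a - b \<in> K" by (auto simp: r_coset_def) }
  { assume "a - b \<in> K"
    then have "a \<in> K #>\<^bsub>?F\<^esub> b" unfolding r_coset_def by (auto intro!: bexI[of _ "a - b"])
    then show "K #>\<^bsub>?F\<^esub> a = K #>\<^bsub>?F\<^esub> b" using F.repr_independence[OF _ b K] by simp }
qed

lemma free_Abelian_group_subgroup_add:
  assumes "subgroup K (free_Abelian_group W)" "a \<in> K" "b \<in> K"
  shows "a + b \<in> K"
  using subgroup.m_closed[OF assms] by simp

lemma free_Abelian_group_subgroup_uminus: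
  assumes "subgroup K (free_Abelian_group W)" "a \<in> K"
  shows "- a \<in> K"
proof -
  have "a \<in> carrier (free_Abelian_group W)" using subgroup.subset[OF assms(1)] assms(2) by blast
  then show ?thesis using subgroup.m_inv_closed[OF assms] by simp
qed

lemma free_Abelian_group_subgroup_diff:
  assumes "subgroup K (free_Abelian_group W)" "a \<in> K" "b \<in> K"
  shows "a - b \<in> K"
  using free_Abelian_group_subgroup_add[OF assms(1,2) free_Abelian_group_subgroup_uminus[OF assms(1,3)]] by simp

lemma free_Abelian_group_subgroup_zero: "subgroup K (free_Abelian_group W) \<Longrightarrow> 0 \<in> K"
  using subgroup.one_closed[of K "free_Abelian_group W"] by simp

text \<open>Reduces well-definedness of an additive extension modulo relations to its values on the
  generating relations.\<close>

lemma frag_extend_generate_subset: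
  assumes B: "B \<subseteq> carrier (free_Abelian_group W)" and K: "subgroup K (free_Abelian_group W')"
    and h: "\<And>b. b \<in> B \<Longrightarrow> frag_extend t b \<in> K" and x: "x \<in> generate (free_Abelian_group W) B"
  shows "frag_extend t x \<in> K"
  using x
proof induction
  case one
  then show ?case using free_Abelian_group_subgroup_zero[OF K] by simp
next
  case (incl b)
  then show ?case by (rule h)
next
  case (inv b)
  then have "inv\<^bsub>free_Abelian_group W\<^esub> b = - b" using B by auto
  then show ?case using free_Abelian_group_subgroup_uminus[OF K h[OF inv]] by (simp add: frag_extend_minus)
next
  case (eng a b)
  then show ?case using free_Abelian_group_subgroup_add[OF K] by (simp add: frag_extend_add)
qed

text \<open>The map on formal sums that \<open>tensor_map\<close> applies to representatives.
  Computing with it avoids cosets.\<close>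

definition frag_map :: "('x \<Rightarrow> 'z) \<Rightarrow> ('x \<times> 'y \<Rightarrow>\<^sub>0 int) \<Rightarrow> ('z \<times> 'y \<Rightarrow>\<^sub>0 int)" where
  "frag_map f = frag_extend (\<lambda>(x, n). frag_of (f x, n))"

lemma frag_map_simps [simp]:
  "frag_map f 0 = 0" "frag_map f (frag_of (x, n)) = frag_of (f x, n)"
  "frag_map f (a - b) = frag_map f a - frag_map f b" "frag_map f (a + b) = frag_map f a + frag_map f b"
  by (simp_all add: frag_map_def frag_extend_diff frag_extend_add)

lemma frag_map_closed:
  assumes f: "\<And>x. x \<in> A \<Longrightarrow> f x \<in> B" and c: "c \<in> carrier (free_Abelian_group (A \<times> N))"
  shows "frag_map f c \<in> carrier (free_Abelian_group (B \<times> N))"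
  using c unfolding free_Abelian_group_carrier_iff
proof (induction c rule: frag_induction)
  case (one x)
  then show ?case using f by (cases x) auto
next
  case (diff a b)
  then show ?case using keys_diff[of "frag_map f a" "frag_map f b"] by auto
qed simp

section \<open>Balanced tensor products computed on representatives\<close>

locale tensor_pair = U: left_module "opp R" U + N: left_module R N
  for R :: "('a, 'r) ring_scheme" and U :: "('a, 'x, 'm) module_scheme" and N :: "('a, 'y, 'n) module_scheme"
begin

abbreviation "F \<equiv> free_Abelian_group (carrier U \<times> carrier N)"
abbreviation "K \<equiv> tensor_rels R U N"

definition rel_gens :: "('x \<times> 'y \<Rightarrow>\<^sub>0 int) set" where
  "rel_gens = {frag_of (x \<oplus>\<^bsub>U\<^esub> x', y) - frag_of (x, y) - frag_of (x', y) | x x' y.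
         x \<in> carrier U \<and> x' \<in> carrier U \<and> y \<in> carrier N} \<union>
      {frag_of (x, y \<oplus>\<^bsub>N\<^esub> y') - frag_of (x, y) - frag_of (x, y') | x y y'.
         x \<in> carrier U \<and> y \<in> carrier N \<and> y' \<in> carrier N} \<union>
      {frag_of (r \<odot>\<^bsub>U\<^esub> x, y) - frag_of (x, r \<odot>\<^bsub>N\<^esub> y) | r x y.
         r \<in> carrier R \<and> x \<in> carrier U \<and> y \<in> carrier N}"

lemma rels_eq: "K = generate F rel_gens"
  by (simp add: tensor_rels_def rel_gens_def)

lemma rel_gens_cases:
  assumes "b \<in> rel_gens"
  obtains
    (l) x x' y where "b = frag_of (x \<oplus>\<^bsub>U\<^esub> x', y) - frag_of (x, y) - frag_of (x', y)"
      "x \<in> carrier U" "x' \<in> carrier U" "y \<in> carrier N"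
  | (r) x y y' where "b = frag_of (x, y \<oplus>\<^bsub>N\<^esub> y') - frag_of (x, y) - frag_of (x, y')"
      "x \<in> carrier U" "y \<in> carrier N" "y' \<in> carrier N"
  | (b) r x y where "b = frag_of (r \<odot>\<^bsub>U\<^esub> x, y) - frag_of (x, r \<odot>\<^bsub>N\<^esub> y)"
      "r \<in> carrier R" "x \<in> carrier U" "y \<in> carrier N"
proof -
  from assms show ?thesis
    unfolding rel_gens_def Un_iff mem_Collect_eq
    by (elim disjE exE conjE) ((rule l; assumption), (rule r; assumption), (rule b; assumption))
qed

lemma rel_gens_closed: "rel_gens \<subseteq> carrier F"
proof
  fix b assume "b \<in> rel_gens"
  have diff: "a - c \<in> carrier F" if "a \<in> carrier F" "c \<in> carrier F" for a c
    using that keys_diff[of a c] unfolding free_Abelian_group_carrier_iff by blast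
  show "b \<in> carrier F"
    using \<open>b \<in> rel_gens\<close> by (cases rule: rel_gens_cases; hypsubst; intro diff) auto
qed

lemma subgroup_rels: "subgroup K F"
  unfolding rels_eq by (rule group.generate_is_subgroup[OF group_free_Abelian_group rel_gens_closed])

lemma rels_closed: "K \<subseteq> carrier F"
  by (rule subgroup.subset[OF subgroup_rels])

lemmas rels_add = free_Abelian_group_subgroup_add[OF subgroup_rels]
  and rels_diff = free_Abelian_group_subgroup_diff[OF subgroup_rels]
  and rels_uminus = free_Abelian_group_subgroup_uminus[OF subgroup_rels]
  and rels_zero = free_Abelian_group_subgroup_zero[OF subgroup_rels]

lemma rels_l: "x \<in> carrier U \<Longrightarrow> x' \<in> carrier U \<Longrightarrow> y \<in> carrier N \<Longrightarrow>
    frag_of (x \<oplus>\<^bsub>U\<^esub> x', y) - frag_of (x, y) - frag_of (x', y) \<in> K"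
  and rels_r: "x \<in> carrier U \<Longrightarrow> y \<in> carrier N \<Longrightarrow> y' \<in> carrier N \<Longrightarrow>
    frag_of (x, y \<oplus>\<^bsub>N\<^esub> y') - frag_of (x, y) - frag_of (x, y') \<in> K"
  and rels_b: "r \<in> carrier R \<Longrightarrow> x \<in> carrier U \<Longrightarrow> y \<in> carrier N \<Longrightarrow>
    frag_of (r \<odot>\<^bsub>U\<^esub> x, y) - frag_of (x, r \<odot>\<^bsub>N\<^esub> y) \<in> K"
proof -
  have gen: "b \<in> K" if "b \<in> rel_gens" for b unfolding rels_eq using that by (rule generate.incl)
  show "frag_of (x \<oplus>\<^bsub>U\<^esub> x', y) - frag_of (x, y) - frag_of (x', y) \<in> K"
    if "x \<in> carrier U" "x' \<in> carrier U" "y \<in> carrier N"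
    by (rule gen) (use that in \<open>unfold rel_gens_def, blast\<close>)
  show "frag_of (x, y \<oplus>\<^bsub>N\<^esub> y') - frag_of (x, y) - frag_of (x, y') \<in> K"
    if "x \<in> carrier U" "y \<in> carrier N" "y' \<in> carrier N"
    by (rule gen) (use that in \<open>unfold rel_gens_def, blast\<close>)
  show "frag_of (r \<odot>\<^bsub>U\<^esub> x, y) - frag_of (x, r \<odot>\<^bsub>N\<^esub> y) \<in> K"
    if "r \<in> carrier R" "x \<in> carrier U" "y \<in> carrier N"
    by (rule gen) (use that in \<open>unfold rel_gens_def, blast\<close>)
qed

text \<open>Additivity for 0 + 0 leaves exactly the negative of this generator.\<close>

lemma rels_zero_l: "y \<in> carrier N \<Longrightarrow> frag_of (\<zero>\<^bsub>U\<^esub>, y) \<in> K"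
  using rels_uminus[OF rels_l[of "\<zero>\<^bsub>U\<^esub>" "\<zero>\<^bsub>U\<^esub>" y]] by simp

lemma rels_zero_r: "x \<in> carrier U \<Longrightarrow> frag_of (x, \<zero>\<^bsub>N\<^esub>) \<in> K"
  using rels_uminus[OF rels_r[of x "\<zero>\<^bsub>N\<^esub>" "\<zero>\<^bsub>N\<^esub>"]] by simp

text \<open>The inclusion \<open>carrier F \<subseteq> K\<close> is the form in which the vanishing
  of a tensor product is passed between the lemmas.\<close>

lemma carrier_subset_rels:
  assumes "\<And>x y. x \<in> carrier U \<Longrightarrow> y \<in> carrier N \<Longrightarrow> frag_of (x, y) \<in> K"
  shows "carrier F \<subseteq> K"
proof
  fix c assume "c \<in> carrier F"
  then show "c \<in> K"
    unfolding free_Abelian_group_carrier_iff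
    by (induction c rule: frag_induction) (use assms rels_zero rels_diff in auto)
qed

lemma comm_group_tensor: "comm_group (tensor R U N)"
  unfolding tensor_def by (rule comm_group.abelian_FactGroup[OF abelian_free_Abelian_group subgroup_rels])

lemma carrier_tensor: "carrier (tensor R U N) = (\<lambda>c. K #>\<^bsub>F\<^esub> c) ` carrier F"
  by (simp add: tensor_def carrier_FactGroup)

lemma one_tensor: "\<one>\<^bsub>tensor R U N\<^esub> = K #>\<^bsub>F\<^esub> 0"
  using group.coset_mult_one[OF group_free_Abelian_group rels_closed] by (simp add: tensor_def FactGroup_def)

lemma mult_tensor:
  assumes "a \<in> carrier F" "b \<in> carrier F"
  shows "(K #>\<^bsub>F\<^esub> a) \<otimes>\<^bsub>tensor R U N\<^esub> (K #>\<^bsub>F\<^esub> b) = K #>\<^bsub>F\<^esub> (a + b)"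
proof -
  have "K \<lhd> F"
    by (rule comm_group.normal_iff_subgroup[OF abelian_free_Abelian_group, THEN iffD2, OF subgroup_rels])
  from normal.rcos_sum[OF this assms] show ?thesis by (simp add: tensor_def FactGroup_def)
qed

lemma coset_eq_iff: "a \<in> carrier F \<Longrightarrow> b \<in> carrier F \<Longrightarrow> K #>\<^bsub>F\<^esub> a = K #>\<^bsub>F\<^esub> b \<longleftrightarrow> a - b \<in> K"
  by (rule free_Abelian_group_coset_eq_iff[OF subgroup_rels])

lemma trivial_tensor:
  assumes "carrier F \<subseteq> K"
  shows "trivial_group (tensor R U N)"
proof -
  interpret T: comm_group "tensor R U N" by (rule comm_group_tensor)
  have "K #>\<^bsub>F\<^esub> c = \<one>\<^bsub>tensor R U N\<^esub>" if "c \<in> carrier F" for c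
    unfolding one_tensor by (rule coset_eq_iff[THEN iffD2]) (use that assms in auto)
  then have "carrier (tensor R U N) \<subseteq> {\<one>\<^bsub>tensor R U N\<^esub>}" by (auto simp: carrier_tensor)
  then show ?thesis by (simp add: T.trivial_group_subset)
qed

end

lemma rels_frag_map:
  assumes "left_module (opp R) U" "left_module (opp R) V" "left_module R N"
    and f: "f \<in> mod_hom (opp R) U V" and a: "a \<in> tensor_rels R U N"
  shows "frag_map f a \<in> tensor_rels R V N"
proof -
  interpret U: tensor_pair R U N by (intro tensor_pair.intro assms)
  interpret V: tensor_pair R V N by (intro tensor_pair.intro assms)
  note f' = mod_homD[OF f]
  show ?thesis
    using a unfolding frag_map_def U.rels_eq
  proof (rule frag_extend_generate_subset[OF U.rel_gens_closed V.subgroup_rels, rotated])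
    fix b assume "b \<in> U.rel_gens"
    then have "frag_map f b \<in> tensor_rels R V N"
    proof (cases rule: U.rel_gens_cases)
      case (l x x' y)
      then show ?thesis using V.rels_l[of "f x" "f x'" y] f' by simp
    next
      case (r x y y')
      then show ?thesis using V.rels_r[of "f x" y y'] f' by simp
    next
      case (b r x y)
      then show ?thesis using V.rels_b[of r "f x" y] f' by simp
    qed
    then show "frag_extend (\<lambda>(x, n). frag_of (f x, n)) b \<in> tensor_rels R V N"
      by (simp only: frag_map_def)
  qed
qed

text \<open>\<open>tensor_map\<close> selects the element of a set of cosets. That set is a
  singleton because \<open>frag_map f\<close> carries relations to relations.\<close>

lemma tensor_map_coset:
  assumes "left_module (opp R) U" "left_module (opp R) V" "left_module R N"
    and f: "f \<in> mod_hom (opp R) U V" and a: "a \<in> carrier (free_Abelian_group (carrier U \<times> carrier N))"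
  shows "tensor_map R V N f (tensor_rels R U N #>\<^bsub>free_Abelian_group (carrier U \<times> carrier N)\<^esub> a) =
    tensor_rels R V N #>\<^bsub>free_Abelian_group (carrier V \<times> carrier N)\<^esub> frag_map f a"
proof -
  interpret U: tensor_pair R U N by (intro tensor_pair.intro assms)
  interpret V: tensor_pair R V N by (intro tensor_pair.intro assms)
  let ?C = "U.K #>\<^bsub>U.F\<^esub> a"
  have "V.K #>\<^bsub>V.F\<^esub> frag_map f c = V.K #>\<^bsub>V.F\<^esub> frag_map f a" if c: "c \<in> ?C" for c
  proof -
    obtain k where k: "k \<in> U.K" "c = k + a" using c by (auto simp: r_coset_def)
    have "k \<in> carrier U.F" using k(1) U.rels_closed by blast
    then have "c \<in> carrier U.F"
      using a keys_add[of k a] unfolding k(2) free_Abelian_group_carrier_iff by blast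
    moreover have "frag_map f c - frag_map f a \<in> V.K"
      using rels_frag_map[OF assms(1-4) k(1)] k(2) by simp
    ultimately show ?thesis
      using V.coset_eq_iff frag_map_closed[of "carrier U" f "carrier V"] mod_homD(1)[OF f] a by blast
  qed
  moreover have "a \<in> ?C" using group.rcos_self[OF group_free_Abelian_group a U.subgroup_rels] .
  ultimately have "(\<lambda>c. V.K #>\<^bsub>V.F\<^esub> frag_map f c) ` ?C = {V.K #>\<^bsub>V.F\<^esub> frag_map f a}" by blast
  then show ?thesis by (simp add: tensor_map_def flip: frag_map_def)
qed

text \<open>With a dual basis, p \<otimes> n is the sum of q f(p) \<otimes> n = q \<otimes> f(p) n,
  and every f(p) n is zero by hypothesis.\<close>

lemma carrier_subset_tensor_rels:
  assumes P: "projective (opp R) P" and N: "left_module R N"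
    and nil: "\<And>f p n. f \<in> mod_hom (opp R) P (regular_module (opp R)) \<Longrightarrow> p \<in> carrier P \<Longrightarrow>
      n \<in> carrier N \<Longrightarrow> f p \<odot>\<^bsub>N\<^esub> n = \<zero>\<^bsub>N\<^esub>"
  shows "carrier (free_Abelian_group (carrier P \<times> carrier N)) \<subseteq> tensor_rels R P N"
proof -
  have PM: "left_module (opp R) P" using P by (simp add: projective_def)
  interpret T: tensor_pair R P N by (intro tensor_pair.intro PM N)
  show ?thesis
  proof (rule T.carrier_subset_rels)
    fix p n assume p: "p \<in> carrier P" and n: "n \<in> carrier N"
    let ?A = "{f p \<odot>\<^bsub>P\<^esub> q | f q. f \<in> mod_hom (opp R) P (regular_module (opp R)) \<and> q \<in> carrier P}"
    have Ac: "?A \<subseteq> carrier P" using mod_homD(1)[of _ "opp R" P "regular_module (opp R)", OF _ p] by auto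
    have "frag_of (q, n) \<in> T.K" if "q \<in> add_span P ?A" for q
      using that
    proof induction
      case zero
      show ?case by (rule T.rels_zero_l[OF n])
    next
      case (add a x)
      then obtain f q where a: "a = f p \<odot>\<^bsub>P\<^esub> q" "f \<in> mod_hom (opp R) P (regular_module (opp R))" "q \<in> carrier P"
        by blast
      have fp: "f p \<in> carrier R" using mod_homD(1)[OF a(2) p] by simp
      have "frag_of (a, n) - frag_of (q, \<zero>\<^bsub>N\<^esub>) \<in> T.K"
        using T.rels_b[OF fp a(3) n] nil[OF a(2) p n] by (simp add: a(1))
      from T.rels_add[OF this T.rels_zero_r[OF a(3)]] have an: "frag_of (a, n) \<in> T.K" by simp
      have "a \<in> carrier P" "x \<in> carrier P"
        using add Ac T.U.add_span_closed[OF _ Ac] by blast+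
      then have "frag_of (a \<oplus>\<^bsub>P\<^esub> x, n) - frag_of (a, n) - frag_of (x, n) \<in> T.K" using n by (rule T.rels_l)
      from T.rels_add[OF T.rels_add[OF this add(3)] an] show ?case by simp
    qed
    then show "frag_of (p, n) \<in> T.K" using projective_dual_basis[OF P p] by blast
  qed
qed

lemma trivial_group_self_factor:
  assumes "comm_group G"
  shows "trivial_group (G Mod carrier G)"
proof -
  interpret G: comm_group G by fact
  have sub: "subgroup (carrier G) G" by (rule G.subgroup_self)
  have "carrier (G Mod carrier G) = {\<one>\<^bsub>G Mod carrier G\<^esub>}"
    using G.coset_join2[OF _ sub] G.one_closed by (auto simp: carrier_FactGroup FactGroup_def image_iff RCOSETS_def)
  then show ?thesis
    using comm_group.axioms(2)[OF G.abelian_FactGroup[OF sub]] by (simp add: trivial_group_def)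
qed

text \<open>If the terms of one resolution are killed by tensoring, then the homotopy of
  \<open>projective_resolution_factor\<close> contracts every other resolution tensored with \<open>N\<close>.\<close>
lemma tensor_homology_trivial:
  assumes U: "left_module (opp R) U" and N: "left_module R N"
    and P: "projective_resolution (opp R) U P d \<epsilon>" and Q: "projective_resolution (opp R) U Q d' \<epsilon>'"
    and PN: "\<And>n. carrier (free_Abelian_group (carrier (P n) \<times> carrier N)) \<subseteq> tensor_rels R (P n) N"
  shows "trivial_group (tensor_homology R Q d' N (Suc k))"
proof -
  note Pd = projective_resolutionD[OF P] and Qd = projective_resolutionD[OF Q]
  obtain f g s where f: "\<And>n. f n \<in> mod_hom (opp R) (Q n) (P n)" and g: "\<And>n. g n \<in> mod_hom (opp R) (P n) (Q n)"
    and s: "\<And>n. s n \<in> mod_hom (opp R) (Q n) (Q (Suc n))"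
    and fgs: "\<And>n x. x \<in> carrier (Q (Suc n)) \<Longrightarrow>
      x = g (Suc n) (f (Suc n) x) \<oplus>\<^bsub>Q (Suc n)\<^esub> (d' (Suc n) (s (Suc n) x) \<oplus>\<^bsub>Q (Suc n)\<^esub> s n (d' n x))"
    by (rule projective_resolution_factor[OF U P Q]) (rule that)
  interpret A: tensor_pair R "Q k" N by (intro tensor_pair.intro Qd N)
  interpret B: tensor_pair R "Q (Suc k)" N by (intro tensor_pair.intro Qd N)
  interpret C: tensor_pair R "Q (Suc (Suc k))" N by (intro tensor_pair.intro Qd N)
  interpret TA: comm_group "tensor R (Q k) N" by (rule A.comm_group_tensor)
  interpret TB: comm_group "tensor R (Q (Suc k)) N" by (rule B.comm_group_tensor)
  let ?tA = "tensor_map R (Q k) N (d' k)" and ?tB = "tensor_map R (Q (Suc k)) N (d' (Suc k))"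
  note tA = tensor_map_coset[OF Qd(2) Qd(2) N Qd(4)[of k]] and tB = tensor_map_coset[OF Qd(2) Qd(2) N Qd(4)[of "Suc k"]]
  have dA: "frag_map (d' k) c \<in> carrier A.F" if "c \<in> carrier B.F" for c
    using mod_homD(1)[OF Qd(4)] that by (rule frag_map_closed)
  have dB: "frag_map (d' (Suc k)) c \<in> carrier B.F" if "c \<in> carrier C.F" for c
    using mod_homD(1)[OF Qd(4)] that by (rule frag_map_closed)
  have sB: "frag_map (s (Suc k)) c \<in> carrier C.F" if "c \<in> carrier B.F" for c
    using mod_homD(1)[OF s] that by (rule frag_map_closed)
  let ?Z = "kernel (tensor R (Q (Suc k)) N) (tensor R (Q k) N) ?tA"
  have Fadd: "a + b \<in> carrier B.F" if "a \<in> carrier B.F" "b \<in> carrier B.F" for a b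
    using that keys_add[of a b] unfolding free_Abelian_group_carrier_iff by blast
  have "?tA \<in> hom (tensor R (Q (Suc k)) N) (tensor R (Q k) N)"
  proof (rule homI)
    fix x assume "x \<in> carrier (tensor R (Q (Suc k)) N)"
    then obtain a where a: "a \<in> carrier B.F" "x = B.K #>\<^bsub>B.F\<^esub> a" unfolding B.carrier_tensor by blast
    show "?tA x \<in> carrier (tensor R (Q k) N)"
      unfolding a(2) tA[OF a(1)] A.carrier_tensor using dA[OF a(1)] by blast
    fix y assume "y \<in> carrier (tensor R (Q (Suc k)) N)"
    then obtain b where b: "b \<in> carrier B.F" "y = B.K #>\<^bsub>B.F\<^esub> b" unfolding B.carrier_tensor by blast
    show "?tA (x \<otimes>\<^bsub>tensor R (Q (Suc k)) N\<^esub> y) = ?tA x \<otimes>\<^bsub>tensor R (Q k) N\<^esub> ?tA y"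
      unfolding a(2) b(2) B.mult_tensor[OF a(1) b(1)] tA[OF a(1)] tA[OF b(1)] tA[OF Fadd[OF a(1) b(1)]]
        A.mult_tensor[OF dA[OF a(1)] dA[OF b(1)]] by simp
  qed
  then interpret h: group_hom "tensor R (Q (Suc k)) N" "tensor R (Q k) N" ?tA
    by (intro group_hom.intro group_hom_axioms.intro TA.is_group TB.is_group)
  have Z: "subgroup ?Z (tensor R (Q (Suc k)) N)" by (rule h.subgroup_kernel)
  \<comment> \<open>The homotopy formula id = g f + d s + s d, read modulo the relations. Additivity
    in the first factor splits the formula for \<open>x\<close> on each generator
    \<open>(x, n)\<close>.\<close>
  have key: "c - frag_map (d' (Suc k)) (frag_map (s (Suc k)) c) - frag_map (s k) (frag_map (d' k) c)
      - frag_map (g (Suc k)) (frag_map (f (Suc k)) c) \<in> B.K" if "c \<in> carrier B.F" for c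
    using that unfolding free_Abelian_group_carrier_iff
  proof (induction c rule: frag_induction)
    case zero
    then show ?case using B.rels_zero by simp
  next
    case (one z)
    then obtain x n where z: "z = (x, n)" and x: "x \<in> carrier (Q (Suc k))" and n: "n \<in> carrier N" by auto
    let ?u = "g (Suc k) (f (Suc k) x)" and ?v = "d' (Suc k) (s (Suc k) x)" and ?w = "s k (d' k x)"
    have c: "?u \<in> carrier (Q (Suc k))" "?v \<in> carrier (Q (Suc k))" "?w \<in> carrier (Q (Suc k))"
      using x by (simp_all add: mod_homD(1)[OF f] mod_homD(1)[OF g] mod_homD(1)[OF s] mod_homD(1)[OF Qd(4)])
    have "frag_of (x, n) - frag_of (?u, n) - frag_of (?v \<oplus>\<^bsub>Q (Suc k)\<^esub> ?w, n) \<in> B.K"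
      using B.rels_l[OF c(1) B.U.M.a_closed[OF c(2,3)] n] unfolding fgs[OF x, symmetric] .
    from B.rels_add[OF this B.rels_l[OF c(2,3) n]] show ?case by (simp add: z algebra_simps)
  next
    case (diff a b)
    from B.rels_diff[OF this] show ?case by (simp add: algebra_simps)
  qed
  \<comment> \<open>This composite passes through the tensor product of \<open>P (Suc k)\<close>
    with \<open>N\<close>, which is zero. On a cycle \<open>s d\<close> contributes only relations
    as well, so the cycle is the boundary of its image under \<open>s\<close>.\<close>
  have gf: "frag_map (g (Suc k)) (frag_map (f (Suc k)) c) \<in> B.K" if "c \<in> carrier B.F" for c
  proof -
    have "frag_map (f (Suc k)) c \<in> tensor_rels R (P (Suc k)) N"
      by (rule subsetD[OF PN frag_map_closed[OF mod_homD(1)[OF f] that]])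
    then show ?thesis by (rule rels_frag_map[OF Pd(2) Qd(2) N g])
  qed
  have "?Z = ?tB ` carrier (tensor R (Q (Suc (Suc k))) N)"
  proof
    show "?Z \<subseteq> ?tB ` carrier (tensor R (Q (Suc (Suc k))) N)"
    proof
      fix z assume z: "z \<in> ?Z"
      then obtain c where c: "c \<in> carrier B.F" "z = B.K #>\<^bsub>B.F\<^esub> c"
        unfolding kernel_def B.carrier_tensor by blast
      have "?tA z = A.K #>\<^bsub>A.F\<^esub> 0" using z unfolding kernel_def A.one_tensor by blast
      then have "frag_map (d' k) c \<in> A.K"
        unfolding c(2) tA[OF c(1)] using A.coset_eq_iff[OF dA[OF c(1)], of 0] by simp
      then have "frag_map (s k) (frag_map (d' k) c) \<in> B.K" by (rule rels_frag_map[OF Qd(2) Qd(2) N s])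
      from B.rels_add[OF B.rels_add[OF key[OF c(1)] gf[OF c(1)]] this]
      have "c - frag_map (d' (Suc k)) (frag_map (s (Suc k)) c) \<in> B.K" by simp
      then have "z = B.K #>\<^bsub>B.F\<^esub> frag_map (d' (Suc k)) (frag_map (s (Suc k)) c)"
        unfolding c(2) using B.coset_eq_iff[OF c(1) dB[OF sB[OF c(1)]]] by simp
      also have "\<dots> = ?tB (C.K #>\<^bsub>C.F\<^esub> frag_map (s (Suc k)) c)" by (rule tB[OF sB[OF c(1)], symmetric])
      finally show "z \<in> ?tB ` carrier (tensor R (Q (Suc (Suc k))) N)"
        unfolding C.carrier_tensor using sB[OF c(1)] by blast
    qed
    show "?tB ` carrier (tensor R (Q (Suc (Suc k))) N) \<subseteq> ?Z"
    proof
      fix z assume "z \<in> ?tB ` carrier (tensor R (Q (Suc (Suc k))) N)"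
      then obtain c where c: "c \<in> carrier C.F" "z = B.K #>\<^bsub>B.F\<^esub> frag_map (d' (Suc k)) c"
        unfolding C.carrier_tensor using tB by blast
      have "frag_map (d' k) (frag_map (d' (Suc k)) c) \<in> A.K"
        using c(1) unfolding free_Abelian_group_carrier_iff
      proof (induction c rule: frag_induction)
        case (one z)
        then show ?case using projective_resolution_dd[OF Q] A.rels_zero_l by (cases z) auto
      next
        case (diff a b)
        from A.rels_diff[OF this] show ?case by simp
      qed (simp add: A.rels_zero)
      then have "?tA z = A.K #>\<^bsub>A.F\<^esub> 0"
        unfolding c(2) tA[OF dB[OF c(1)]] using A.coset_eq_iff[OF dA[OF dB[OF c(1)]], of 0] by simp
      then show "z \<in> ?Z"
        unfolding kernel_def A.one_tensor B.carrier_tensor using c(2) dB[OF c(1)] by blast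
    qed
  qed
  \<comment> \<open>Since cycles and boundaries coincide, homology is the cycle group modulo its own
    carrier.\<close>
  then have "tensor_homology R Q d' N (Suc k) =
      (tensor R (Q (Suc k)) N)\<lparr>carrier := ?Z\<rparr> Mod carrier ((tensor R (Q (Suc k)) N)\<lparr>carrier := ?Z\<rparr>)"
    by (simp add: tensor_homology_def tensor_cycles_def)
  moreover have "comm_group ((tensor R (Q (Suc k)) N)\<lparr>carrier := ?Z\<rparr>)"
  proof (rule group.group_comm_groupI[OF TB.subgroup_imp_group[OF Z]])
    show "x \<otimes>\<^bsub>(tensor R (Q (Suc k)) N)\<lparr>carrier := ?Z\<rparr>\<^esub> y =
        y \<otimes>\<^bsub>(tensor R (Q (Suc k)) N)\<lparr>carrier := ?Z\<rparr>\<^esub> x"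
      if "x \<in> carrier ((tensor R (Q (Suc k)) N)\<lparr>carrier := ?Z\<rparr>)"
        "y \<in> carrier ((tensor R (Q (Suc k)) N)\<lparr>carrier := ?Z\<rparr>)" for x y
      using that TB.m_comm by (simp add: kernel_def)
  qed
  ultimately show ?thesis using trivial_group_self_factor by metis
qed

text \<open>\<open>Tor\<close> picks its resolution by \<open>SOME\<close>. Existence of some
  resolution ensures that the choice is one, and the homotopy argument applies to whichever it
  is.\<close>

lemma Tor_trivial:
  fixes U :: "('a, 'x, 'm) module_scheme"
  assumes U: "left_module (opp R) U" and N: "left_module R N"
    and P: "projective_resolution (opp R) U P d \<epsilon>"
    and PN: "\<And>n. carrier (free_Abelian_group (carrier (P n) \<times> carrier N)) \<subseteq> tensor_rels R (P n) N"
    and i: "i \<ge> 1"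
  shows "trivial_group (Tor R i U N)"
proof -
  obtain k where k: "i = Suc k" using i by (cases i) auto
  let ?S = "SOME (P :: nat \<Rightarrow> ('a, 'x) res_module, d, \<epsilon>). projective_resolution (opp R) U P d \<epsilon>"
  have "\<exists>t :: (nat \<Rightarrow> ('a, 'x) res_module) \<times> _. case t of (P, d, \<epsilon>) \<Rightarrow> projective_resolution (opp R) U P d \<epsilon>"
    using projective_resolution_exists[OF U] by auto
  then have Q: "case ?S of (P, d, \<epsilon>) \<Rightarrow> projective_resolution (opp R) U P d \<epsilon>" by (rule someI_ex)
  obtain Q d' \<epsilon>' where S: "?S = (Q, d', \<epsilon>')" by (cases ?S)
  have "projective_resolution (opp R) U Q d' \<epsilon>'" using Q unfolding S by simp
  from tensor_homology_trivial[OF U N P this PN, of k]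
  show ?thesis unfolding Tor_def S k by simp
qed

section \<open>Tensor powers\<close>

lemma right_mod_simps [simp]:
  "carrier (right_mod M) = carrier M" "x \<oplus>\<^bsub>right_mod M\<^esub> y = x \<oplus>\<^bsub>M\<^esub> y"
  "r \<odot>\<^bsub>right_mod M\<^esub> x = rsmult M x r" "\<zero>\<^bsub>right_mod M\<^esub> = \<zero>\<^bsub>M\<^esub>"
  by (simp_all add: right_mod_def)

locale tensor_power_setup =
  fixes R :: "('a, 'r) ring_scheme" and M :: "('a, 'b, 'm) bimodule_scheme" and j :: nat
  assumes bimod: "is_bimodule R M"
begin

sublocale L: left_module R M using bimod by (simp add: is_bimodule_def)
sublocale Rt: left_module "opp R" "right_mod M" using bimod by (simp add: is_bimodule_def)

abbreviation "F \<equiv> free_Abelian_group (tensor_words M j)"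
abbreviation "K \<equiv> tensor_power_rels R M j"

lemma rsmult_closed: "x \<in> carrier M \<Longrightarrow> r \<in> carrier R \<Longrightarrow> rsmult M x r \<in> carrier M"
  using Rt.smult_closed[of r x] by simp

definition power_gens :: "('b list \<Rightarrow>\<^sub>0 int) set" where
  "power_gens = {frag_of (u @ [x \<oplus>\<^bsub>M\<^esub> y] @ v) - frag_of (u @ [x] @ v) - frag_of (u @ [y] @ v) | u v x y.
         set u \<subseteq> carrier M \<and> set v \<subseteq> carrier M \<and> x \<in> carrier M \<and> y \<in> carrier M \<and>
         length u + 1 + length v = j} \<union>
      {frag_of (u @ [rsmult M x r, y] @ v) - frag_of (u @ [x, r \<odot>\<^bsub>M\<^esub> y] @ v) | u v x y r.
         set u \<subseteq> carrier M \<and> set v \<subseteq> carrier M \<and> x \<in> carrier M \<and> y \<in> carrier M \<and>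
         r \<in> carrier R \<and> length u + 2 + length v = j}"

lemma rels_eq: "K = generate F power_gens"
  by (simp add: tensor_power_rels_def power_gens_def)

lemma power_gens_cases:
  assumes "b \<in> power_gens"
  obtains
    (add) u v x y where "b = frag_of (u @ [x \<oplus>\<^bsub>M\<^esub> y] @ v) - frag_of (u @ [x] @ v) - frag_of (u @ [y] @ v)"
      "set u \<subseteq> carrier M" "set v \<subseteq> carrier M" "x \<in> carrier M" "y \<in> carrier M" "length u + 1 + length v = j"
  | (bal) u v x y r where "b = frag_of (u @ [rsmult M x r, y] @ v) - frag_of (u @ [x, r \<odot>\<^bsub>M\<^esub> y] @ v)"
      "set u \<subseteq> carrier M" "set v \<subseteq> carrier M" "x \<in> carrier M" "y \<in> carrier M" "r \<in> carrier R"
      "length u + 2 + length v = j"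
proof -
  from assms show ?thesis
    unfolding power_gens_def Un_iff mem_Collect_eq
    by (elim disjE exE conjE) ((rule add; assumption), (rule bal; assumption))
qed

lemma power_gens_closed: "power_gens \<subseteq> carrier F"
proof
  fix b assume "b \<in> power_gens"
  have diff: "a - c \<in> carrier F" if "a \<in> carrier F" "c \<in> carrier F" for a c
    using that keys_diff[of a c] unfolding free_Abelian_group_carrier_iff by blast
  show "b \<in> carrier F"
    using \<open>b \<in> power_gens\<close>
  proof (cases rule: power_gens_cases)
    case (add u v x y)
    show ?thesis unfolding add(1) by (intro diff) (use add in \<open>auto simp: tensor_words_def\<close>)
  next
    case (bal u v x y r)
    show ?thesis unfolding bal(1) by (intro diff) (use bal in \<open>auto simp: tensor_words_def rsmult_closed\<close>)
  qed
qed

lemma subgroup_rels: "subgroup K F"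
  unfolding rels_eq by (rule group.generate_is_subgroup[OF group_free_Abelian_group power_gens_closed])

lemma rels_add:
  assumes "set u \<subseteq> carrier M" "set v \<subseteq> carrier M" "x \<in> carrier M" "y \<in> carrier M" "length u + 1 + length v = j"
  shows "frag_of (u @ [x \<oplus>\<^bsub>M\<^esub> y] @ v) - frag_of (u @ [x] @ v) - frag_of (u @ [y] @ v) \<in> K"
  unfolding rels_eq by (rule generate.incl) (use assms in \<open>unfold power_gens_def, blast\<close>)

lemma rels_bal:
  assumes "set u \<subseteq> carrier M" "set v \<subseteq> carrier M" "x \<in> carrier M" "y \<in> carrier M" "r \<in> carrier R"
    "length u + 2 + length v = j"
  shows "frag_of (u @ [rsmult M x r, y] @ v) - frag_of (u @ [x, r \<odot>\<^bsub>M\<^esub> y] @ v) \<in> K"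
  unfolding rels_eq by (rule generate.incl) (use assms in \<open>unfold power_gens_def, blast\<close>)

lemma carrier_tensor_power: "carrier (tensor_power R M j) = (\<lambda>c. K #>\<^bsub>F\<^esub> c) ` carrier F"
  by (simp add: tensor_power_def Let_def carrier_FactGroup)

lemma zero_tensor_power: "\<zero>\<^bsub>tensor_power R M j\<^esub> = K #>\<^bsub>F\<^esub> 0"
  using group.coset_mult_one[OF group_free_Abelian_group subgroup.subset[OF subgroup_rels]]
  by (simp add: tensor_power_def Let_def)

lemma add_tensor_power:
  assumes "a \<in> carrier F" "b \<in> carrier F"
  shows "(K #>\<^bsub>F\<^esub> a) \<oplus>\<^bsub>tensor_power R M j\<^esub> (K #>\<^bsub>F\<^esub> b) = K #>\<^bsub>F\<^esub> (a + b)"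
proof -
  have "K \<lhd> F"
    by (rule comm_group.normal_iff_subgroup[OF abelian_free_Abelian_group, THEN iffD2, OF subgroup_rels])
  from normal.rcos_sum[OF this assms] show ?thesis by (simp add: tensor_power_def Let_def FactGroup_def)
qed

lemma coset_eq_iff: "a \<in> carrier F \<Longrightarrow> b \<in> carrier F \<Longrightarrow> K #>\<^bsub>F\<^esub> a = K #>\<^bsub>F\<^esub> b \<longleftrightarrow> a - b \<in> K"
  by (rule free_Abelian_group_coset_eq_iff[OF subgroup_rels])

end

text \<open>Appending a fixed tail to x \<otimes> y respects the relations, so the vanishing of M
  \<otimes> M in the first two places kills every word of length at least 2.\<close>

lemma tensor_power_trivial:
  assumes M: "is_bimodule R M" and j: "j \<ge> 2"
    and MM: "carrier (free_Abelian_group (carrier (right_mod M) \<times> carrier M)) \<subseteq> tensor_rels R (right_mod M) M"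
  shows "carrier (tensor_power R M j) = {\<zero>\<^bsub>tensor_power R M j\<^esub>}"
proof -
  interpret T: tensor_power_setup R M j by (rule tensor_power_setup.intro[OF M])
  interpret B: tensor_pair R "right_mod M" M
    by (intro tensor_pair.intro T.L.left_module_axioms T.Rt.left_module_axioms)
  have word: "frag_of w \<in> T.K" if ww: "w \<in> tensor_words M j" for w
  proof -
    obtain x y v where w: "w = x # y # v" "x \<in> carrier M" "y \<in> carrier M" "set v \<subseteq> carrier M" "length v + 2 = j"
      using ww j by (cases w; cases "tl w") (auto simp: tensor_words_def)
    \<comment> \<open>The word is rebuilt from the pair with the tail \<open>v\<close> frozen.
      Relations of the binary tensor product become relations of the power at its first two
      places.\<close>
    let ?t = "\<lambda>(x, y). frag_of (x # y # v)"
    have "frag_of (x, y) \<in> generate B.F B.rel_gens"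
      using MM w unfolding B.rels_eq[symmetric] by auto
    then have "frag_extend ?t (frag_of (x, y)) \<in> T.K"
    proof (rule frag_extend_generate_subset[OF B.rel_gens_closed T.subgroup_rels, rotated])
      fix b assume "b \<in> B.rel_gens"
      then show "frag_extend ?t b \<in> T.K"
      proof (cases rule: B.rel_gens_cases)
        case (l x x' y)
        then show ?thesis using T.rels_add[of "[]" "y # v" x x'] w by (simp add: frag_extend_diff)
      next
        case (r x y y')
        then show ?thesis using T.rels_add[of "[x]" v y y'] w by (simp add: frag_extend_diff)
      next
        case (b r x y)
        then show ?thesis using T.rels_bal[of "[]" v x y r] w by (simp add: frag_extend_diff)
      qed
    qed
    then show ?thesis by (simp add: w(1))
  qed
  have "c \<in> T.K" if "c \<in> carrier T.F" for c
    using that unfolding free_Abelian_group_carrier_iff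
    by (induction c rule: frag_induction)
      (use word free_Abelian_group_subgroup_zero[OF T.subgroup_rels] free_Abelian_group_subgroup_diff[OF T.subgroup_rels] in auto)
  then have "T.K #>\<^bsub>T.F\<^esub> c = T.K #>\<^bsub>T.F\<^esub> 0" if "c \<in> carrier T.F" for c
    by (intro T.coset_eq_iff[THEN iffD2]) (use that in auto)
  then have "(\<lambda>c. T.K #>\<^bsub>T.F\<^esub> c) ` carrier T.F = (\<lambda>_. T.K #>\<^bsub>T.F\<^esub> 0) ` carrier T.F"
    by (rule image_cong[OF refl])
  also have "\<dots> = {T.K #>\<^bsub>T.F\<^esub> 0}" by (rule image_constant[of 0]) simp
  finally show ?thesis unfolding T.carrier_tensor_power T.zero_tensor_power .
qed

text \<open>Balancing needs two neighbouring factors, so for words of length 1 only additivity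
  remains, and the free group modulo additivity gives back \<open>M\<close>. The power is still a
  set of cosets of formal sums, hence an isomorphism and not an equality.\<close>

lemma tensor_power_one_isomorphic:
  assumes M: "is_bimodule R M" and j: "j = 1"
  shows "mod_isomorphic (opp R) (right_mod M) (tensor_power R M j)"
proof -
  interpret T: tensor_power_setup R M j by (rule tensor_power_setup.intro[OF M])
  let ?T = "tensor_power R M j" and ?w = "\<lambda>x. frag_of [x]"
  have words: "w \<in> tensor_words M j \<longleftrightarrow> (\<exists>x\<in>carrier M. w = [x])" for w
    by (cases w) (auto simp: tensor_words_def j)
  have A: "comm_group (add_monoid M)" by (rule T.L.M.a_comm_group)
  \<comment> \<open>\<open>h\<close> evaluates a formal sum of one-letter words as a sum in
    \<open>M\<close>. It induces the inverse of the map sought.\<close>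
  obtain h where h: "h \<in> hom T.F (add_monoid M)" "\<And>w. w \<in> tensor_words M j \<Longrightarrow> h (frag_of w) = hd w"
    by (rule comm_group.free_Abelian_group_universal[OF A, of hd "tensor_words M j"]) (auto simp: words)
  interpret h: group_hom T.F "add_monoid M" h
    by (intro group_hom.intro group_hom_axioms.intro h(1) comm_group.axioms(2)[OF A] group_free_Abelian_group)
  have hw: "h (?w x) = x" if "x \<in> carrier M" for x using h(2)[of "[x]"] that by (auto simp: words)
  have hc: "h c \<in> carrier M" if "c \<in> carrier T.F" for c using h.hom_closed[OF that] by simp
  have hadd: "h (a + b) = h a \<oplus>\<^bsub>M\<^esub> h b" if "a \<in> carrier T.F" "b \<in> carrier T.F" for a b
    using h.hom_mult[OF that] by simp
  have h0: "h 0 = \<zero>\<^bsub>M\<^esub>" using h.hom_one by simp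
  have Fdiff: "a - b \<in> carrier T.F" if "a \<in> carrier T.F" "b \<in> carrier T.F" for a b
    using that keys_diff[of a b] unfolding free_Abelian_group_carrier_iff by blast
  have hdiff: "h (a - b) = h a \<ominus>\<^bsub>M\<^esub> h b" if ab: "a \<in> carrier T.F" "b \<in> carrier T.F" for a b
  proof -
    have "h a = h (a - b) \<oplus>\<^bsub>M\<^esub> h b" using hadd[OF Fdiff[OF ab] ab(2)] by simp
    then show ?thesis using hc[OF Fdiff[OF ab]] hc[OF ab(2)] by (simp add: a_minus_def T.L.M.a_assoc T.L.M.r_neg)
  qed
  have wF: "?w x \<in> carrier T.F" if "x \<in> carrier M" for x using that by (simp add: words)
  note Kadd = free_Abelian_group_subgroup_add[OF T.subgroup_rels]
    and Kdiff = free_Abelian_group_subgroup_diff[OF T.subgroup_rels]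
    and Kneg = free_Abelian_group_subgroup_uminus[OF T.subgroup_rels]
  have wadd: "?w (x \<oplus>\<^bsub>M\<^esub> y) - ?w x - ?w y \<in> T.K" if "x \<in> carrier M" "y \<in> carrier M" for x y
    using T.rels_add[of "[]" "[]" x y] that by (simp add: j)
  have hK: "h k = \<zero>\<^bsub>M\<^esub>" if "k \<in> T.K" for k
  proof -
    have "T.power_gens \<subseteq> kernel T.F (add_monoid M) h"
    proof
      fix b assume b: "b \<in> T.power_gens"
      then show "b \<in> kernel T.F (add_monoid M) h"
      proof (cases rule: T.power_gens_cases)
        case (add u v x y)
        then have "b = ?w (x \<oplus>\<^bsub>M\<^esub> y) - ?w x - ?w y" "x \<in> carrier M" "y \<in> carrier M" by (auto simp: j)
        then have xy: "x \<in> carrier M" "y \<in> carrier M" "x \<oplus>\<^bsub>M\<^esub> y \<in> carrier M"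
          and b': "b = ?w (x \<oplus>\<^bsub>M\<^esub> y) - ?w x - ?w y" by simp_all
        have "h b = (x \<oplus>\<^bsub>M\<^esub> y) \<ominus>\<^bsub>M\<^esub> x \<ominus>\<^bsub>M\<^esub> y"
          unfolding b' hdiff[OF Fdiff[OF wF[OF xy(3)] wF[OF xy(1)]] wF[OF xy(2)]]
            hdiff[OF wF[OF xy(3)] wF[OF xy(1)]] hw[OF xy(1)] hw[OF xy(2)] hw[OF xy(3)] ..
        also have "\<dots> = (x \<oplus>\<^bsub>M\<^esub> y) \<oplus>\<^bsub>M\<^esub> \<ominus>\<^bsub>M\<^esub> (x \<oplus>\<^bsub>M\<^esub> y)"
          using xy by (simp add: a_minus_def T.L.M.minus_add T.L.M.a_assoc)
        finally have "h b = \<zero>\<^bsub>M\<^esub>" using T.L.M.r_neg[OF xy(3)] by simp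
        then show ?thesis using subsetD[OF T.power_gens_closed b] by (simp add: kernel_def)
      qed (simp add: j)
    qed
    then have "T.K \<subseteq> kernel T.F (add_monoid M) h"
      unfolding T.rels_eq by (rule group.generate_subgroup_incl[OF group_free_Abelian_group _ h.subgroup_kernel])
    then show ?thesis using that by (auto simp: kernel_def)
  qed
  \<comment> \<open>Every formal sum is congruent to the single word of its value, so the coset of
    \<open>c\<close> depends only on \<open>h c\<close>.\<close>
  have rep: "c - ?w (h c) \<in> T.K" if "c \<in> carrier T.F" for c
  proof -
    have "c \<in> carrier T.F \<and> c - ?w (h c) \<in> T.K"
      using that[unfolded free_Abelian_group_carrier_iff]
    proof (induction c rule: frag_induction)
      case zero
      have "- ?w \<zero>\<^bsub>M\<^esub> \<in> T.K" using wadd[of "\<zero>\<^bsub>M\<^esub>" "\<zero>\<^bsub>M\<^esub>"] by simp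
      then show ?case by (simp add: h0)
    next
      case (one w)
      then obtain x where "x \<in> carrier M" "w = [x]" by (auto simp: words)
      then show ?case using hw wF free_Abelian_group_subgroup_zero[OF T.subgroup_rels] by simp
    next
      case (diff a b)
      then have ab: "a \<in> carrier T.F" "b \<in> carrier T.F" "a - ?w (h a) \<in> T.K" "b - ?w (h b) \<in> T.K" by blast+
      let ?z = "h a \<ominus>\<^bsub>M\<^esub> h b"
      have z: "?z \<in> carrier M" "?z \<oplus>\<^bsub>M\<^esub> h b = h a"
        using hc[OF ab(1)] hc[OF ab(2)] by (simp_all add: a_minus_def T.L.M.a_assoc T.L.M.l_neg)
      from wadd[OF z(1) hc[OF ab(2)]] have "?w (h a) - ?w ?z - ?w (h b) \<in> T.K" by (simp add: z(2))
      from Kadd[OF Kdiff[OF ab(3,4)] this] have "(a - b) - ?w ?z \<in> T.K" by (simp add: algebra_simps)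
      then show ?case using Fdiff[OF ab(1,2)] hdiff[OF ab(1,2)] by simp
    qed
    then show ?thesis ..
  qed
  define \<theta> where "\<theta> x = T.K #>\<^bsub>T.F\<^esub> ?w x" for x
  have \<theta>h: "T.K #>\<^bsub>T.F\<^esub> c = \<theta> (h c)" if "c \<in> carrier T.F" for c
    unfolding \<theta>_def using T.coset_eq_iff[OF that wF[OF hc[OF that]]] rep[OF that] by simp
  have "\<theta> \<in> mod_hom (opp R) (right_mod M) ?T"
  proof (rule mod_homI)
    fix x assume "x \<in> carrier (right_mod M)"
    then have x: "x \<in> carrier M" by simp
    show "\<theta> x \<in> carrier ?T" unfolding T.carrier_tensor_power \<theta>_def using wF[OF x] by blast
    show "\<theta> (x \<oplus>\<^bsub>right_mod M\<^esub> y) = \<theta> x \<oplus>\<^bsub>?T\<^esub> \<theta> y" if "y \<in> carrier (right_mod M)" for y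
    proof -
      have y: "y \<in> carrier M" using that by simp
      have s: "?w x + ?w y \<in> carrier T.F"
        using wF[OF x] wF[OF y] keys_add[of "?w x" "?w y"] unfolding free_Abelian_group_carrier_iff by blast
      have "\<theta> x \<oplus>\<^bsub>?T\<^esub> \<theta> y = T.K #>\<^bsub>T.F\<^esub> (?w x + ?w y)"
        unfolding \<theta>_def by (rule T.add_tensor_power[OF wF[OF x] wF[OF y]])
      also have "\<dots> = \<theta> (x \<oplus>\<^bsub>M\<^esub> y)" unfolding \<theta>h[OF s] by (simp only: hadd[OF wF[OF x] wF[OF y]] hw[OF x] hw[OF y])
      finally show ?thesis by simp
    qed
    show "\<theta> (r \<odot>\<^bsub>right_mod M\<^esub> x) = r \<odot>\<^bsub>?T\<^esub> \<theta> x" if "r \<in> carrier (opp R)" for r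
    proof -
      have r: "r \<in> carrier R" using that by simp
      \<comment> \<open>The action of \<open>r\<close> on representatives. Since \<open>h\<close>
        intertwines it with the action on \<open>M\<close>, the set under \<open>the_elem\<close>
        has just one element.\<close>
      define H where "H = frag_extend (\<lambda>w. frag_of (butlast w @ [rsmult M (last w) r]))"
      have H: "H c \<in> carrier T.F" "h (H c) = rsmult M (h c) r" if "c \<in> carrier T.F" for c
      proof -
        have "c \<in> carrier T.F \<and> H c \<in> carrier T.F \<and> h (H c) = rsmult M (h c) r"
          using that[unfolded free_Abelian_group_carrier_iff]
        proof (induction c rule: frag_induction)
          case zero
          show ?case using T.Rt.smult_r_null[of r] r by (simp add: H_def h0)
        next
          case (one w)
          then obtain y where y: "y \<in> carrier M" "w = [y]" by (auto simp: words)
          then have "H (frag_of w) = ?w (rsmult M y r)" by (simp add: H_def)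
          then show ?case using y wF hw T.rsmult_closed[OF y(1) r] by simp
        next
          case (diff a b)
          then have ab: "a \<in> carrier T.F" "b \<in> carrier T.F" "H a \<in> carrier T.F" "H b \<in> carrier T.F"
            "h (H a) = rsmult M (h a) r" "h (H b) = rsmult M (h b) r" by blast+
          have Hd: "H (a - b) = H a - H b" by (simp add: H_def frag_extend_diff)
          let ?z = "h (a - b)"
          have z: "?z \<in> carrier M" "h a = ?z \<oplus>\<^bsub>M\<^esub> h b"
            using hc[OF Fdiff[OF ab(1,2)]] hadd[OF Fdiff[OF ab(1,2)] ab(2)] by simp_all
          have "rsmult M (h a) r = rsmult M ?z r \<oplus>\<^bsub>M\<^esub> rsmult M (h b) r"
            using T.Rt.smult_r_distr[of r ?z "h b"] r z hc[OF ab(2)] by simp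
          then have "h (H a) \<ominus>\<^bsub>M\<^esub> h (H b) = rsmult M ?z r"
            using ab(5,6) T.rsmult_closed[OF z(1) r] T.rsmult_closed[OF hc[OF ab(2)] r]
            by (simp add: a_minus_def T.L.M.a_assoc T.L.M.r_neg)
          then show ?case using Hd hdiff[OF ab(3,4)] Fdiff[OF ab(1,2)] Fdiff[OF ab(3,4)] by simp
        qed
        then show "H c \<in> carrier T.F" "h (H c) = rsmult M (h c) r" by blast+
      qed
      have "T.K #>\<^bsub>T.F\<^esub> H c = \<theta> (rsmult M x r)" if c: "c \<in> T.K #>\<^bsub>T.F\<^esub> ?w x" for c
      proof -
        obtain k where k: "k \<in> T.K" "c = k + ?w x" using c by (auto simp: r_coset_def)
        have kF: "k \<in> carrier T.F" using k(1) subgroup.subset[OF T.subgroup_rels] by blast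
        then have cF: "c \<in> carrier T.F"
          using wF[OF x] keys_add[of k "?w x"] unfolding k(2) free_Abelian_group_carrier_iff by blast
        have "h c = x" unfolding k(2) hadd[OF kF wF[OF x]] hK[OF k(1)] hw[OF x] using x by simp
        then show ?thesis using \<theta>h[OF H(1)[OF cF]] H(2)[OF cF] by simp
      qed
      moreover have "?w x \<in> T.K #>\<^bsub>T.F\<^esub> ?w x"
        by (rule group.rcos_self[OF group_free_Abelian_group wF[OF x] T.subgroup_rels])
      ultimately have "(\<lambda>c. T.K #>\<^bsub>T.F\<^esub> H c) ` (T.K #>\<^bsub>T.F\<^esub> ?w x) = {\<theta> (rsmult M x r)}" by blast
      moreover have "r \<odot>\<^bsub>?T\<^esub> \<theta> x = the_elem ((\<lambda>c. T.K #>\<^bsub>T.F\<^esub> H c) ` (T.K #>\<^bsub>T.F\<^esub> ?w x))"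
        by (simp add: tensor_power_def Let_def H_def \<theta>_def)
      ultimately show ?thesis by simp
    qed
  qed
  moreover have "bij_betw \<theta> (carrier (right_mod M)) (carrier ?T)"
  proof (rule bij_betw_imageI)
    show "inj_on \<theta> (carrier (right_mod M))"
    proof (rule inj_onI)
      fix x y assume "x \<in> carrier (right_mod M)" "y \<in> carrier (right_mod M)" and eq: "\<theta> x = \<theta> y"
      then have xy: "x \<in> carrier M" "y \<in> carrier M" by simp_all
      have "?w x - ?w y \<in> T.K" using T.coset_eq_iff[OF wF[OF xy(1)] wF[OF xy(2)]] eq by (simp add: \<theta>_def)
      from hK[OF this] have xy0: "x \<ominus>\<^bsub>M\<^esub> y = \<zero>\<^bsub>M\<^esub>" using hdiff[OF wF[OF xy(1)] wF[OF xy(2)]] hw xy by simp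
      have "x = (x \<ominus>\<^bsub>M\<^esub> y) \<oplus>\<^bsub>M\<^esub> y" using xy by (simp add: a_minus_def T.L.M.a_assoc T.L.M.l_neg)
      then show "x = y" using xy by (simp add: xy0)
    qed
    show "\<theta> ` carrier (right_mod M) = carrier ?T"
      unfolding T.carrier_tensor_power using \<theta>h hc wF by (force simp: \<theta>_def)
  qed
  ultimately show ?thesis unfolding mod_isomorphic_def by blast
qed

section \<open>Resolutions of the zero module and transport along isomorphisms\<close>

lemma mod_hom_zero_map:
  assumes "left_module S W"
  shows "(\<lambda>_. \<zero>\<^bsub>W\<^esub>) \<in> mod_hom S V W"
proof -
  interpret W: left_module S W by fact
  show ?thesis by (rule mod_homI) (simp_all add: W.smult_r_null)
qed

text \<open>All terms are free on the empty set, so exactness holds trivially. This supplies the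
  resolution with vanishing terms for the higher tensor powers.\<close>

lemma projective_resolution_zero:
  fixes S :: "('a, 'r) ring_scheme"

  assumes S: "ring S" and U: "left_module S U" "carrier U = {\<zero>\<^bsub>U\<^esub>}"
  shows "projective_resolution S U (\<lambda>_. free_module S ({} :: 'i set)) (\<lambda>_ x. x) (\<lambda>_. \<zero>\<^bsub>U\<^esub>)"
proof -
  \<comment> \<open>\<open>projective\<close> compares a module with a free module indexed by its
    own element type, so a second copy of the zero module with that index type is required.\<close>
  let ?Z = "free_module S ({} :: 'i set)" and ?Z' = "free_module S ({} :: ('i \<Rightarrow> 'a) set)"
  interpret U: left_module S U by (rule U(1))
  have Zc: "carrier (free_module S ({} :: 'j set)) = {\<zero>\<^bsub>free_module S {}\<^esub>}" for S :: "('a, 'r) ring_scheme"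
    by (auto simp: free_module_def)
  have Z: "left_module S ?Z" and Z': "left_module S ?Z'" by (rule left_module_free_module[OF S])+
  have "iso_to_summand S ?Z ?Z'"
    by (rule iso_to_summandI[OF Z Z' mod_hom_zero_map[OF Z'] mod_hom_zero_map[OF Z]]) (simp add: Zc)
  then have "projective S ?Z" using Z unfolding projective_def by blast
  moreover have "(\<lambda>x. x) \<in> mod_hom S ?Z ?Z" by (rule mod_homI) simp_all
  ultimately show ?thesis
    unfolding projective_resolution_def by (auto simp: mod_hom_zero_map[OF U(1)] U(2) Zc)
qed

text \<open>Only the augmentation changes, so terms already known to vanish after tensoring can
  serve for an isomorphic module of another type.\<close>

lemma projective_resolution_iso:
  assumes V: "left_module S V" and U: "left_module S U"
    and P: "projective_resolution S U P d \<epsilon>"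
    and \<theta>: "\<theta> \<in> mod_hom S U V" "bij_betw \<theta> (carrier U) (carrier V)"
  shows "projective_resolution S V P d (\<lambda>p. \<theta> (\<epsilon> p))"
proof -
  note Pd = projective_resolutionD[OF P]
  have inj: "inj_on \<theta> (carrier U)" and im: "\<theta> ` carrier U = carrier V" using \<theta>(2) by (auto simp: bij_betw_def)
  interpret U: left_module S U by fact
  have "\<theta> (\<epsilon> p) = \<zero>\<^bsub>V\<^esub> \<longleftrightarrow> \<epsilon> p = \<zero>\<^bsub>U\<^esub>" if "p \<in> carrier (P 0)" for p
    using inj_on_eq_iff[OF inj mod_homD(1)[OF Pd(3) that] U.M.zero_closed] mod_hom_zero[OF U V \<theta>(1)] by simp
  then have "d 0 ` carrier (P (Suc 0)) = {p \<in> carrier (P 0). \<theta> (\<epsilon> p) = \<zero>\<^bsub>V\<^esub>}"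
    unfolding Pd(6) by auto
  moreover have "(\<lambda>p. \<theta> (\<epsilon> p)) ` carrier (P 0) = carrier V"
    using im Pd(5) by (simp flip: image_image[of \<theta> \<epsilon>])
  ultimately show ?thesis
    using P mod_hom_compose[OF Pd(3) \<theta>(1)] unfolding projective_resolution_def by simp
qed

theorem proposition5p21:
  fixes \<Gamma> :: "('a, 'r) ring_scheme"
    and E :: "'a set"
    and M :: "('a, 'b, 'm) bimodule_scheme"
  assumes "perfect_ring \<Gamma>"
    and "basic_set \<Gamma> E"
    and "is_bimodule \<Gamma> M"
    and "strongly_finite_right_pd \<Gamma> E M"
  shows "right_perfect_bimodule \<Gamma> M \<and> trivial_group (tensor \<Gamma> (right_mod M) M)"
proof -
  have lp: "left_perfect \<Gamma>" and S: "ring (opp \<Gamma>)" and R: "ring \<Gamma>"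
    using assms(1) by (simp_all add: perfect_ring_def left_perfect_def)
  have N: "left_module \<Gamma> M" and U: "left_module (opp \<Gamma>) (right_mod M)"
    using assms(3) by (simp_all add: is_bimodule_def)
  obtain P :: "nat \<Rightarrow> ('a, 'b) res_module" and d \<epsilon> where
    "minimal_projective_resolution (opp \<Gamma>) (right_mod M) P d \<epsilon>"
    and disj: "left_supp E M \<inter> (\<Union>j. supp_res \<Gamma> E P j) = {}" and pd: "finite_pd (opp \<Gamma>) (right_mod M)"
    using assms(4) unfolding strongly_finite_right_pd_def by blast
  then have P: "projective_resolution (opp \<Gamma>) (right_mod M) P d \<epsilon>"
    by (simp add: minimal_projective_resolution_def)
  note Pd = projective_resolutionD[OF P]
  have nil: "f p \<odot>\<^bsub>M\<^esub> n = \<zero>\<^bsub>M\<^esub>"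
    if f: "f \<in> mod_hom (opp \<Gamma>) (P k) (regular_module (opp \<Gamma>))" and p: "p \<in> carrier (P k)" and n: "n \<in> carrier M"
    for k f p n
  proof (rule ccontr)
    assume "f p \<odot>\<^bsub>M\<^esub> n \<noteq> \<zero>\<^bsub>M\<^esub>"
    from ex_local_idempotent_trace[where ?f0.0 = f and ?p0.0 = p, OF lp Pd(1) N f p n this]
    obtain e g q x where e: "ring.local_idempotent \<Gamma> e" and g: "g \<in> mod_hom (opp \<Gamma>) (P k) (regular_module (opp \<Gamma>))"
      and q: "q \<in> carrier (P k)" "e \<otimes>\<^bsub>\<Gamma>\<^esub> g q \<notin> jacobson_radical \<Gamma>" and x: "x \<in> carrier M" "e \<odot>\<^bsub>M\<^esub> x \<noteq> \<zero>\<^bsub>M\<^esub>"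
      by blast
    obtain e' where e': "e' \<in> E" "mod_isomorphic (opp \<Gamma>) (principal_module (opp \<Gamma>) e') (principal_module (opp \<Gamma>) e)"
      by (rule basic_set_local_idempotent[OF R S assms(2) e])
    have "is_idempotent \<Gamma> e" using e by (simp add: ring.local_idempotent_def[OF R])
    moreover have "\<forall>e\<in>E. primitive_idempotent \<Gamma> e"
      using assms(2) unfolding basic_set_def by (elim conjE)
    then have "is_idempotent \<Gamma> e'" using e'(1) by (simp add: primitive_idempotent_def)
    ultimately have "\<exists>y\<in>carrier M. e' \<odot>\<^bsub>M\<^esub> y \<noteq> \<zero>\<^bsub>M\<^esub>"
      using principal_module_isomorphic_nonzero[OF N S _ _ e'(2) x] by blast
    then have "e' \<in> left_supp E M" using e'(1) by (simp add: left_supp_def)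
    moreover have "iso_to_summand (opp \<Gamma>) (principal_module (opp \<Gamma>) e') (P k)"
      by (rule iso_to_summand_cong[OF e'(2) local_idempotent_summand[where f = g and q = q, OF R Pd(2) e g q]])
    then have "e' \<in> supp_res \<Gamma> E P k" using e'(1) by (simp add: supp_res_def)
    ultimately show False using disj by blast
  qed
  have PN: "carrier (free_Abelian_group (carrier (P k) \<times> carrier M)) \<subseteq> tensor_rels \<Gamma> (P k) M" for k
    by (rule carrier_subset_tensor_rels[OF Pd(1) N]) (rule nil)
  interpret UM: tensor_pair \<Gamma> "right_mod M" M by (intro tensor_pair.intro N U)
  \<comment> \<open>Right exactness in elementary form: the augmentation is onto, so every x
    \<otimes> y is the image of some p \<otimes> y, which already vanishes over
    \<open>P 0\<close>.\<close>
  have MM: "carrier UM.F \<subseteq> UM.K"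
  proof (rule UM.carrier_subset_rels)
    fix x y assume x: "x \<in> carrier (right_mod M)" and y: "y \<in> carrier M"
    obtain p where p: "p \<in> carrier (P 0)" "x = \<epsilon> p" using x Pd(5) by blast
    have "frag_of (p, y) \<in> tensor_rels \<Gamma> (P 0) M" using PN[of 0] p(1) y by auto
    from rels_frag_map[OF Pd(2) U N Pd(3) this] show "frag_of (x, y) \<in> UM.K" by (simp add: p(2))
  qed
  have "trivial_group (Tor \<Gamma> i (tensor_power \<Gamma> M j) M)" if i: "i \<ge> 1" and j: "j \<ge> 1" for i j
  proof -
    have T: "left_module (opp \<Gamma>) (tensor_power \<Gamma> M j)" by (rule left_module_tensor_power[OF assms(3) j])
    show ?thesis
    proof (cases "j = 1")
      case True
      obtain \<theta> where "\<theta> \<in> mod_hom (opp \<Gamma>) (right_mod M) (tensor_power \<Gamma> M j)"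
        "bij_betw \<theta> (carrier (right_mod M)) (carrier (tensor_power \<Gamma> M j))"
        using tensor_power_one_isomorphic[OF assms(3) True] unfolding mod_isomorphic_def by blast
      from Tor_trivial[OF T N projective_resolution_iso[OF T U P this] PN i] show ?thesis .
    next
      case False
      then have "j \<ge> 2" using j by simp
      from tensor_power_trivial[OF assms(3) this MM]
      have "projective_resolution (opp \<Gamma>) (tensor_power \<Gamma> M j) (\<lambda>_. free_module (opp \<Gamma>) ({} :: nat set))
          (\<lambda>_ x. x) (\<lambda>_. \<zero>\<^bsub>tensor_power \<Gamma> M j\<^esub>)"
        by (rule projective_resolution_zero[OF S T])
      then show ?thesis
      proof (rule Tor_trivial[OF T N _ _ i])
        interpret Z: tensor_pair \<Gamma> "free_module (opp \<Gamma>) ({} :: nat set)" M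
          by (intro tensor_pair.intro N left_module_free_module S)
        have "p = \<zero>\<^bsub>free_module (opp \<Gamma>) {}\<^esub>" if "p \<in> carrier (free_module (opp \<Gamma>) ({} :: nat set))" for p
          using that by (auto simp: free_module_def)
        then show "carrier Z.F \<subseteq> Z.K" by (intro Z.carrier_subset_rels) (metis Z.rels_zero_l)
      qed
    qed
  qed
  then show ?thesis using pd UM.trivial_tensor[OF MM] unfolding right_perfect_bimodule_def by blast
qed

end
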